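(* Let $G$ be a locally compact, second countable group and let $\lambda$ be an invariant subgroup measure of $G$, i.e. a $\sigma$-finite Borel measure on $\mathrm{Sub}_G$ that is invariant under the conjugation action of $G$. Then there exists a Borel map $$\mathrm{Sub}_G\to\mathcal{M}(\mathrm{Cos}_G),\qquad H\mapsto\nu^H,$$ such that for $\lambda$-a.e. $H$ the measure $\nu^H$ is nonzero, $G$-invariant and supported on the subset $G/H\subset\mathrm{Cos}_G$.
   Context: Topological groups are Hausdorff. $\mathrm{Sub}_G$ is the space of closed subgroups of $G$ with the Chabauty topology, on which $G$ acts by conjugation $H\mapsto kHk^{-1}$. $\mathrm{Cos}_G=\{gH: g\in G,\ H\in\mathrm{Sub}_G\}$ is the space of cosets of closed subgroups of $G$, with the Fell topology of closed subsets of $G$, i.e. the topology with subbasis $\{C:C\cap K=\emptyset\}$ ($K\subset G$ compact) and $\{C:C\cap U\ne\emptyset\}$ ($U\subset G$ open); its restriction to subgroups is the Chabauty topology. $G$ acts on $\mathrm{Cos}_G$ from the left by $k(gH)=kgH$, and $G$-invariance of $\nu^H$ refers to this action. $G/H\subset\mathrm{Cos}_G$ is the set of left cosets of $H$. $\mathcal{M}(X)$ denotes the set of $\sigma$-finite Borel measures on $X$; a map $t\mapsto\nu_t$ into $\mathcal{M}(X)$ is Borel if $t\mapsto\nu_t(B)$ is Borel for each Borel $B\subseteq X$. *)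

theory Defs
  imports "HOL-Analysis.Analysis"
begin

(* Topological groups are types of class topological_group_add. This class does not assume
   commutativity; the group law is merely written additively, so g H is (+) g ` H and
   k H k^-1 is (\<lambda>h. k + h - k) ` H. *)

definition closed_subgroups :: "'a::topological_group_add set set" where
  "closed_subgroups =
    {H. closed H \<and> 0 \<in> H \<and> (\<forall>x\<in>H. \<forall>y\<in>H. x + y \<in> H) \<and> (\<forall>x\<in>H. - x \<in> H)}"

definition left_translate :: "'a::plus \<Rightarrow> 'a set \<Rightarrow> 'a set" where
  "left_translate g C = (+) g ` C"

definition conjugate :: "'a::group_add \<Rightarrow> 'a set \<Rightarrow> 'a set" where
  "conjugate k H = (\<lambda>h. k + h - k) ` H"

definition left_cosets :: "'a::plus set \<Rightarrow> 'a set set" where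
  "left_cosets H = range (\<lambda>g. left_translate g H)"

definition closed_subgroup_cosets :: "'a::topological_group_add set set" where
  "closed_subgroup_cosets = (\<Union>H\<in>closed_subgroups. left_cosets H)"

(* The underlying set is {C. closed C}, including the empty set. *)
definition fell_topology :: "'a::topological_space set topology" where
  "fell_topology = topology_generated_by
    ({{C. closed C \<and> C \<inter> K = {}} |K. compact K} \<union> {{C. closed C \<and> C \<inter> U \<noteq> {}} |U. open U})"

definition Sub_topology :: "'a::topological_group_add set topology" where
  "Sub_topology = subtopology fell_topology closed_subgroups"

definition Cos_topology :: "'a::topological_group_add set topology" where
  "Cos_topology = subtopology fell_topology closed_subgroup_cosets"

definition borel_of :: "'b topology \<Rightarrow> 'b measure" where
  "borel_of T = sigma (topspace T) {U. openin T U}"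

definition sigma_finite_borel_measures :: "'b topology \<Rightarrow> 'b measure set" where
  "sigma_finite_borel_measures T = {M. sets M = sets (borel_of T) \<and> sigma_finite_measure M}"

definition borel_measure_map :: "'b topology \<Rightarrow> 'c topology \<Rightarrow> ('b \<Rightarrow> 'c measure) \<Rightarrow> bool" where
  "borel_measure_map S T \<nu> \<longleftrightarrow>
    \<nu> \<in> topspace S \<rightarrow> sigma_finite_borel_measures T \<and>
    (\<forall>B\<in>sets (borel_of T). (\<lambda>t. emeasure (\<nu> t) B) \<in> borel_measurable (borel_of S))"

definition invariant_measure :: "('g \<Rightarrow> 'b \<Rightarrow> 'b) \<Rightarrow> 'b measure \<Rightarrow> bool" where
  "invariant_measure act M \<longleftrightarrow> (\<forall>g. distr M M (act g) = M)"

definition invariant_subgroup_measure :: "'a::topological_group_add set measure \<Rightarrow> bool" where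
  "invariant_subgroup_measure M \<longleftrightarrow>
    M \<in> sigma_finite_borel_measures Sub_topology \<and> invariant_measure conjugate M"

end

theory Submission
  imports Defs
begin

text \<open>
  In this overview the group law is written multiplicatively. Let \<open>m\<close> be a left Haar measure of \<open>G\<close>
  and let \<open>p\<^sub>H\<close> be a left Haar measure of each closed subgroup \<open>H\<close>, normalized by one fixed bump function.
  A coset \<open>C = gH\<close> carries the image of \<open>p\<^sub>H\<close> under \<open>h \<mapsto> gh\<close>, which depends only on \<open>C\<close>. Choose a positive
  function \<open>\<psi>\<close> with finite integrals over \<open>G\<close> and over all cosets, and let \<open>j(C)\<close> be its integral over \<open>C\<close>. The
  measure \<open>\<nu>\<^sup>H\<close> is given by an explicit formula: it is the image of \<open>\<psi>(g) / j(gH) m(dg)\<close> under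
  \<open>g \<mapsto> gH\<close>. For every \<open>H\<close> it is nonzero, concentrated on \<open>G/H\<close> and sigma-finite, since the density is at most \<open>n \<psi>\<close>
  over the cosets with \<open>1 / j(C) < n\<close>. Only its invariance requires an argument, and it holds for
  almost every \<open>H\<close> only: it forces the modular functions of \<open>G\<close> and \<open>H\<close> to agree on \<open>H\<close>.

  A left coset \<open>gH\<close> is also the right coset \<open>Kg\<close> of \<open>K = gHg\<^sup>-\<^sup>1\<close>, and the substitution \<open>(H, g) \<mapsto> (gHg\<^sup>-\<^sup>1, g)\<close>
  preserves \<open>\<mu> \<times> m\<close> because \<open>\<mu>\<close> is invariant under conjugation. So the integral over \<open>A\<close> of the mass
  that the translate of \<open>\<nu>\<^sup>H\<close> by \<open>k\<close> gives to \<open>B\<close> becomes an integral over right cosets. Translation by \<open>k\<close> takes \<open>Kg\<close> to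
  \<open>(kKk\<^sup>-\<^sup>1)kg\<close>, and after a further measure preserving substitution its only effect is to replace the density
  \<open>\<psi>(g) / j(Kg)\<close> by \<open>\<psi>(k\<^sup>-\<^sup>1g) / j(k\<^sup>-\<^sup>1Kg)\<close> (\<open>translate_mass_integral_invariant\<close>). For a fixed \<open>K\<close> both densities
  have the same average over \<open>Kg\<close> with respect to the Haar measure of \<open>K\<close>: by uniqueness
  of Haar measure (\<open>haar_measure_unique\<close>) the measure carried by the coset \<open>Kg\<close> is proportional to the right translate of \<open>p\<^sub>K\<close>
  by \<open>g\<close>. As \<open>m\<close> is left invariant under \<open>K\<close>, integrals of functions of \<open>Kg\<close> depend on the density only through
  these averages (\<open>quotient_integral_formula\<close>, \<open>right_coset_mass_invariant\<close>).

  Since \<open>A\<close> is arbitrary, for each \<open>k\<close> and \<open>B\<close> the two masses of \<open>B\<close> agree for almost every \<open>H\<close>. A countable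
  pi-system of sets \<open>B\<close> and Fubini's theorem show that almost every \<open>\<nu>\<^sup>H\<close> is invariant under almost every \<open>k\<close>
  (\<open>coset_measure_AE_invariant\<close>), hence under every \<open>k\<close>, because a conull subgroup is the whole group.

  Two foundations are needed. Haar measures of closed subgroups are obtained from limits of covering
  numbers (\<open>haar_measure_exists\<close>), without any measurability in \<open>H\<close>. That \<open>j\<close> is nevertheless a Borel function on the space
  of cosets follows from a formula for \<open>p\<^sub>H\<close> in terms of \<open>m\<close> alone: normalized suitably, the restriction of
  \<open>m\<close> to the thickening \<open>HV\<close> converges to \<open>p\<^sub>H\<close> as the neighbourhood \<open>V\<close> of the identity
  shrinks (\<open>thickening_ratio_tendsto\<close>).
\<close>

section \<open>Translates, neighbourhoods and local compactness\<close>

lemma mem_translate: "y \<in> (+) x ` A \<longleftrightarrow> - x + y \<in> (A :: 'a::group_add set)"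
  by (force simp: image_iff add.assoc[symmetric])

lemma closed_subgroupsD:
  assumes "H \<in> closed_subgroups"
  shows "closed H" "0 \<in> H" "\<And>x y. x \<in> H \<Longrightarrow> y \<in> H \<Longrightarrow> x + y \<in> H" "\<And>x. x \<in> H \<Longrightarrow> - x \<in> H"
  using assms by (auto simp: closed_subgroups_def)

lemma open_vimage_continuous:
  assumes "open U" "continuous_on UNIV f"
  shows "open {x. f x \<in> U}"
  using open_vimage[OF assms] by (simp add: vimage_def)

lemma closed_vimage_continuous:
  assumes "closed U" "continuous_on UNIV f"
  shows "closed {x. f x \<in> U}"
  using closed_vimage[OF assms] by (simp add: vimage_def)

lemma open_translate:
  fixes A :: "'a::topological_group_add set"
  assumes "open A" shows "open ((+) x ` A)"
proof -
  have "(+) x ` A = {y. - x + y \<in> A}" using mem_translate[of _ x A] by auto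
  then show ?thesis using assms by (auto intro!: open_vimage_continuous continuous_intros)
qed

lemma compact_translate:
  fixes A :: "'a::topological_group_add set"
  assumes "compact A" shows "compact ((+) x ` A)"
  by (intro compact_continuous_image continuous_intros assms)

lemma locally_compact_nhd:
  fixes x :: "'a::t2_space"
  assumes "locally_compact_space (euclidean :: 'a topology)"
  obtains V K where "open V" "compact K" "x \<in> V" "V \<subseteq> K"
proof -
  obtain V K where "openin euclidean V" "compactin euclidean K" "x \<in> V" "V \<subseteq> K"
    using assms unfolding locally_compact_space_def topspace_euclidean by (meson UNIV_I)
  then show ?thesis using that by (simp flip: open_openin)
qed

lemma Hausdorff_space_t2: "Hausdorff_space (euclidean :: 'a::t2_space topology)"
  unfolding Hausdorff_space_def disjnt_def topspace_euclidean open_openin[symmetric] by (metis hausdorff)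

lemma compact_nhd_inside:
  fixes x :: "'a::t2_space"
  assumes "locally_compact_space (euclidean :: 'a topology)" "open W" "x \<in> W"
  obtains V K where "open V" "compact K" "x \<in> V" "V \<subseteq> K" "K \<subseteq> W"
proof -
  have "neighbourhood_base_of (compactin euclidean) (euclidean :: 'a topology)"
    using assms(1) Hausdorff_space_t2 locally_compact_space_neighbourhood_base by blast
  then have "\<exists>V K. open V \<and> compact K \<and> x \<in> V \<and> V \<subseteq> K \<and> K \<subseteq> W"
    using assms(2,3) by (simp add: neighbourhood_base_of)
  then show ?thesis using that by blast
qed

lemma open_nbhd_op:
  fixes f :: "'a::topological_space \<times> 'b::topological_space \<Rightarrow> 'c::topological_space"
  assumes "continuous_on UNIV f" "open W" "f (a, b) \<in> W"
  obtains U V where "open U" "open V" "a \<in> U" "b \<in> V" "\<And>x y. x \<in> U \<Longrightarrow> y \<in> V \<Longrightarrow> f (x, y) \<in> W"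
proof -
  have "open (f -` W)" using assms by (intro open_vimage)
  moreover have "(a, b) \<in> f -` W" using assms by simp
  ultimately obtain U V where "open U" "open V" "(a, b) \<in> U \<times> V" "U \<times> V \<subseteq> f -` W"
    by (rule open_prod_elim)
  then show ?thesis using that[of U V] by blast
qed

lemma open_nbhd_diff:
  fixes W :: "'a::topological_group_add set"
  assumes "open W" "0 \<in> W"
  obtains U where "open U" "0 \<in> U" "\<And>x y. x \<in> U \<Longrightarrow> y \<in> U \<Longrightarrow> - x + y \<in> W"
proof -
  have "continuous_on UNIV (\<lambda>p::'a\<times>'a. - fst p + snd p)" by (intro continuous_intros)
  then obtain U V where "open U" "open V" "0 \<in> U" "0 \<in> V" "\<And>x y. x \<in> U \<Longrightarrow> y \<in> V \<Longrightarrow> - x + y \<in> W"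
    using open_nbhd_op[of "\<lambda>p. - fst p + snd p" W 0 0] assms by auto
  then show ?thesis using that[of "U \<inter> V"] by auto
qed

section \<open>Haar measures on closed subgroups: existence\<close>

text \<open>
  Covering numbers are taken inside \<open>H\<close> but with subsets of the ambient group, so that
  the Haar measures of all closed subgroups live on one type and can be compared.
\<close>

definition covers :: "'a::group_add set \<Rightarrow> 'a set \<Rightarrow> 'a set \<Rightarrow> 'a set \<Rightarrow> bool" where
  "covers H A U F \<longleftrightarrow> finite F \<and> F \<subseteq> H \<and> A \<inter> H \<subseteq> (\<Union>x\<in>F. (+) x ` U)"

definition cover_number :: "'a::group_add set \<Rightarrow> 'a set \<Rightarrow> 'a set \<Rightarrow> nat" where
  "cover_number H A U = (LEAST n. \<exists>F. covers H A U F \<and> card F = n)"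

lemma cover_number_le: "covers H A U F \<Longrightarrow> cover_number H A U \<le> card F"
  unfolding cover_number_def by (rule Least_le) auto

lemma covers_exists:
  fixes H :: "'a::{topological_group_add,t2_space} set"
  assumes "H \<in> closed_subgroups" "compact A" "open U" "0 \<in> U"
  shows "\<exists>F. covers H A U F"
proof -
  have "compact (A \<inter> H)" using assms closed_subgroupsD(1) by (auto intro: compact_Int_closed)
  moreover have "A \<inter> H \<subseteq> (\<Union>x\<in>H. (+) x ` U)"
  proof
    fix a assume "a \<in> A \<inter> H"
    then show "a \<in> (\<Union>x\<in>H. (+) x ` U)" using assms(4) by (auto intro!: bexI[of _ a] simp: mem_translate)
  qed
  ultimately obtain F where "F \<subseteq> H" "finite F" "A \<inter> H \<subseteq> (\<Union>x\<in>F. (+) x ` U)"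
    using compactE_image[of "A \<inter> H" H "\<lambda>x. (+) x ` U"] open_translate[OF assms(3)] by metis
  then show ?thesis unfolding covers_def by blast
qed

lemma cover_number_obtain:
  fixes H :: "'a::{topological_group_add,t2_space} set"
  assumes "H \<in> closed_subgroups" "compact A" "open U" "0 \<in> U"
  obtains F where "covers H A U F" "card F = cover_number H A U"
proof -
  have "\<exists>F. covers H A U F \<and> card F = cover_number H A U"
    unfolding cover_number_def by (rule LeastI_ex) (use covers_exists[OF assms] in blast)
  then show ?thesis using that by blast
qed

context
  fixes H :: "'a::{topological_group_add,t2_space} set"
  assumes H: "H \<in> closed_subgroups"
begin

lemma cover_number_mono:
  assumes "compact B" "open U" "0 \<in> U" "A \<inter> H \<subseteq> B"
  shows "cover_number H A U \<le> cover_number H B U"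
proof -
  obtain F where F: "covers H B U F" "card F = cover_number H B U"
    using cover_number_obtain[OF H assms(1-3)] .
  have "covers H A U F" using F(1) assms(4) unfolding covers_def by blast
  then show ?thesis using cover_number_le F(2) by metis
qed

lemma cover_number_Un:
  assumes "compact A" "compact B" "open U" "0 \<in> U"
  shows "cover_number H (A \<union> B) U \<le> cover_number H A U + cover_number H B U"
proof -
  obtain F where F: "covers H A U F" "card F = cover_number H A U"
    using cover_number_obtain[OF H assms(1,3,4)] .
  obtain E where E: "covers H B U E" "card E = cover_number H B U"
    using cover_number_obtain[OF H assms(2,3,4)] .
  have "covers H (A \<union> B) U (F \<union> E)" using F(1) E(1) unfolding covers_def by blast
  then show ?thesis using cover_number_le card_Un_le[of F E] F(2) E(2) by (metis order_trans)
qed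

text \<open>
  A translate of \<open>U\<close> that helps to cover one set is useless for the other one. The limit over
  shrinking \<open>U\<close> turns this into additivity on disjoint compact sets.
\<close>

lemma cover_number_Un_separated:
  assumes "compact A" "compact B" "open U" "0 \<in> U"
    and sep: "\<And>x. (+) x ` U \<inter> A = {} \<or> (+) x ` U \<inter> B = {}"
  shows "cover_number H A U + cover_number H B U \<le> cover_number H (A \<union> B) U"
proof -
  obtain F where F: "covers H (A \<union> B) U F" "card F = cover_number H (A \<union> B) U"
    using cover_number_obtain[OF H _ assms(3,4)] assms(1,2) by blast
  let ?F1 = "{x\<in>F. (+) x ` U \<inter> A \<noteq> {}}" and ?F2 = "{x\<in>F. (+) x ` U \<inter> B \<noteq> {}}"
  have "covers H A U ?F1" "covers H B U ?F2" using F(1) unfolding covers_def by (auto, (blast dest: subsetD)+)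
  then have "cover_number H A U \<le> card ?F1" "cover_number H B U \<le> card ?F2" by (auto intro: cover_number_le)
  moreover have "card ?F1 + card ?F2 = card (?F1 \<union> ?F2)"
    using F(1) sep unfolding covers_def by (intro card_Un_disjoint[symmetric]) auto
  moreover have "card (?F1 \<union> ?F2) \<le> card F" using F(1) unfolding covers_def by (intro card_mono) auto
  ultimately show ?thesis using F(2) by linarith
qed

lemma cover_number_translate_le:
  assumes "compact A" "open U" "0 \<in> U" "h \<in> H"
  shows "cover_number H ((+) h ` A) U \<le> cover_number H A U"
proof -
  obtain F where F: "covers H A U F" "card F = cover_number H A U"
    using cover_number_obtain[OF H assms(1-3)] .
  have "covers H ((+) h ` A) U ((+) h ` F)"
    unfolding covers_def
  proof (intro conjI subsetI)
    show "finite ((+) h ` F)" using F(1) by (auto simp: covers_def)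
    show "x \<in> H" if "x \<in> (+) h ` F" for x
      using that F(1) assms(4) closed_subgroupsD(3)[OF H] by (auto simp: covers_def)
    fix y assume y: "y \<in> (+) h ` A \<inter> H"
    then have "- h + y \<in> A \<inter> H"
      using assms(4) closed_subgroupsD(3,4)[OF H] by (auto simp: mem_translate)
    then obtain x where "x \<in> F" "- h + y \<in> (+) x ` U" using F(1) unfolding covers_def by blast
    then have "h + x \<in> (+) h ` F" "y \<in> (+) (h + x) ` U"
      unfolding mem_translate minus_add add.assoc by simp_all
    then show "y \<in> (\<Union>x\<in>(+) h ` F. (+) x ` U)" by (rule UN_I)
  qed
  then have "cover_number H ((+) h ` A) U \<le> card ((+) h ` F)" by (rule cover_number_le)
  then show ?thesis using F(2) by (simp add: card_image)
qed

lemma cover_number_translate: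
  assumes "compact A" "open U" "0 \<in> U" "h \<in> H"
  shows "cover_number H ((+) h ` A) U = cover_number H A U"
proof (rule antisym)
  show "cover_number H ((+) h ` A) U \<le> cover_number H A U"
    by (rule cover_number_translate_le[OF assms])
  have "cover_number H ((+) (- h) ` (+) h ` A) U \<le> cover_number H ((+) h ` A) U"
    using assms closed_subgroupsD(4)[OF H] by (intro cover_number_translate_le compact_translate)
  then show "cover_number H A U \<le> cover_number H ((+) h ` A) U"
    by (simp add: image_image add.assoc[symmetric])
qed

text \<open>
  For a compact neighbourhood \<open>B\<close> of the identity this bounds \<open>cover_number H A U / cover_number H B U\<close> by a
  number that does not depend on \<open>U\<close>. With the roles of \<open>A\<close> and \<open>B\<close> exchanged it keeps the ratio away from zero.
\<close>

lemma cover_number_mult: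
  assumes "compact A" "compact B" "open V" "0 \<in> V" "V \<subseteq> B" "open U" "0 \<in> U"
  shows "cover_number H A U \<le> cover_number H A V * cover_number H B U"
proof -
  obtain F where F: "covers H A V F" "card F = cover_number H A V"
    using cover_number_obtain[OF H assms(1,3,4)] .
  obtain E where E: "covers H B U E" "card E = cover_number H B U"
    using cover_number_obtain[OF H assms(2,6,7)] .
  let ?G = "(\<lambda>(x,y). x + y) ` (F \<times> E)"
  have "covers H A U ?G"
    unfolding covers_def
  proof (intro conjI subsetI)
    show "finite ?G" using F(1) E(1) by (auto simp: covers_def)
    show "x \<in> H" if "x \<in> ?G" for x
      using that F(1) E(1) closed_subgroupsD(3)[OF H] by (auto simp: covers_def subset_iff)
    fix y assume y: "y \<in> A \<inter> H"
    then obtain x where x: "x \<in> F" "- x + y \<in> V" using F(1) unfolding covers_def mem_translate[symmetric] by blast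
    moreover have "- x + y \<in> H" using x(1) y F(1) closed_subgroupsD(3,4)[OF H] by (auto simp: covers_def)
    ultimately obtain z where "z \<in> E" "- x + y \<in> (+) z ` U" using E(1) assms(5) unfolding covers_def by blast
    then have "x + z \<in> ?G" "y \<in> (+) (x + z) ` U" using x(1)
      unfolding mem_translate minus_add add.assoc by auto
    then show "y \<in> (\<Union>x\<in>?G. (+) x ` U)" by (rule UN_I)
  qed
  then have "cover_number H A U \<le> card ?G" by (rule cover_number_le)
  also have "\<dots> \<le> card (F \<times> E)" using F(1) E(1) by (intro card_image_le) (auto simp: covers_def)
  finally show ?thesis using F(2) E(2) by (simp add: card_cartesian_product)
qed

lemma cover_number_pos:
  assumes "compact A" "open U" "0 \<in> U" "0 \<in> A"
  shows "0 < cover_number H A U"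
proof -
  obtain F where F: "covers H A U F" "card F = cover_number H A U"
    using cover_number_obtain[OF H assms(1-3)] .
  have "F \<noteq> {}" using F(1) assms(4) closed_subgroupsD(2)[OF H] unfolding covers_def by blast
  then show ?thesis using F unfolding covers_def by (metis card_gt_0_iff)
qed

end

text \<open>
  Tychonoff's theorem in the form used for contents: a pointwise bounded sequence of functions
  converges pointwise along some proper filter finer than \<open>sequentially\<close>, and limits
  along a filter preserve sums and inequalities.
\<close>

lemma cluster_point_in_box:
  fixes s :: "nat \<Rightarrow> 'b \<Rightarrow> real"
  assumes "\<And>n A. 0 \<le> s n A \<and> s n A \<le> b A"
  obtains l F where "F \<noteq> bot" "F \<le> sequentially" "\<And>A. ((\<lambda>n. s n A) \<longlongrightarrow> l A) F"
proof -
  let ?B = "PiE UNIV (\<lambda>A. {0..b A})"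
  have "compactin (product_topology (\<lambda>_. euclidean) UNIV) ?B"
    unfolding compactin_PiE by simp
  then have "compact ?B" by (simp add: euclidean_product_topology)
  moreover have "filtermap s sequentially \<noteq> bot" by (simp add: filtermap_bot_iff)
  moreover have "eventually (\<lambda>f. f \<in> ?B) (filtermap s sequentially)"
    using assms by (simp add: eventually_filtermap PiE_iff)
  ultimately obtain l where l: "inf (nhds l) (filtermap s sequentially) \<noteq> bot"
    unfolding compact_filter by blast
  let ?F = "inf (filtercomap s (nhds l)) sequentially"
  have "?F \<noteq> bot"
  proof
    assume "?F = bot"
    then have "eventually (\<lambda>_. False) ?F" by simp
    then obtain P Q R where "eventually P (nhds l)" "\<And>n. P (s n) \<Longrightarrow> Q n"
        "eventually R sequentially" "\<And>n. Q n \<Longrightarrow> R n \<Longrightarrow> False"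
      unfolding eventually_inf eventually_filtercomap by blast
    then have "eventually P (nhds l)" "eventually (\<lambda>f. \<not> P f) (filtermap s sequentially)"
      unfolding eventually_filtermap by (blast, metis (mono_tags, lifting) eventually_mono)
    then have "eventually (\<lambda>_. False) (inf (nhds l) (filtermap s sequentially))"
      unfolding eventually_inf by blast
    then show False using l by (simp add: eventually_False)
  qed
  moreover have "((\<lambda>n. s n A) \<longlongrightarrow> l A) ?F" for A
  proof -
    have "filterlim s (nhds l) (filtercomap s (nhds l))" by (rule filterlim_filtercomap)
    then have lim: "filterlim s (nhds l) ?F" by (rule filterlim_mono) auto
    show ?thesis
    proof (rule topological_tendstoI)
      fix S :: "real set" assume S: "open S" "l A \<in> S"
      have "open ((\<lambda>f. f A) -` S :: ('b \<Rightarrow> real) set)"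
        by (intro open_vimage S continuous_on_product_coordinates)
      then have "eventually (\<lambda>f. f \<in> (\<lambda>f. f A) -` S) (nhds l)"
        using S(2) by (intro eventually_nhds_in_open) auto
      then show "eventually (\<lambda>n. s n A \<in> S) ?F"
        using lim unfolding filterlim_iff by auto
    qed
  qed
  ultimately show ?thesis using that inf_le2 by blast
qed

text \<open>
  The content is a pointwise limit of \<open>cover_number H A U / cover_number H A0 U\<close> as \<open>U\<close>
  shrinks to the identity, where \<open>A0\<close> is a fixed compact neighbourhood of the identity. Dividing
  by the covering number of \<open>A0\<close> keeps the values in a bounded range and fixes the scale.
\<close>

lemma haar_content_exists:
  fixes H :: "'a::{topological_group_add,t2_space,second_countable_topology} set"
  assumes lc: "locally_compact_space (euclidean :: 'a topology)" and H: "H \<in> closed_subgroups"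
  obtains l :: "'a set \<Rightarrow> real" where
    "\<And>A. 0 \<le> l A"
    "\<And>A B. compact A \<Longrightarrow> compact B \<Longrightarrow> A \<inter> H \<subseteq> B \<Longrightarrow> l A \<le> l B"
    "\<And>A B. compact A \<Longrightarrow> compact B \<Longrightarrow> l (A \<union> B) \<le> l A + l B"
    "\<And>A B. compact A \<Longrightarrow> compact B \<Longrightarrow> A \<inter> B = {} \<Longrightarrow> l A + l B \<le> l (A \<union> B)"
    "\<And>A h. compact A \<Longrightarrow> h \<in> H \<Longrightarrow> l ((+) h ` A) = l A"
    "l {} = 0"
    "\<And>V K. open V \<Longrightarrow> 0 \<in> V \<Longrightarrow> V \<subseteq> K \<Longrightarrow> compact K \<Longrightarrow> 0 < l K"
proof -
  obtain V0 A0 where V0: "open V0" "compact A0" "(0::'a) \<in> V0" "V0 \<subseteq> A0"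
    using locally_compact_nhd[OF lc] .
  obtain U :: "nat \<Rightarrow> 'a set" where U: "\<And>n. open (U n)" "\<And>n. 0 \<in> U n"
      "\<And>S. open S \<Longrightarrow> 0 \<in> S \<Longrightarrow> \<forall>\<^sub>F n in sequentially. U n \<subseteq> S"
    using countable_basis_at_decseq[of "0::'a"] by metis
  let ?N = "cover_number H"
  define s where "s n A = (if compact A then real (?N A (U n)) / real (?N A0 (U n)) else 0)" for n A
  define b where "b A = (if compact A then real (?N A V0) else 0)" for A
  have N0: "0 < ?N A0 (U n)" for n using V0 U by (intro cover_number_pos[OF H]) auto
  have box: "0 \<le> s n A \<and> s n A \<le> b A" for n A
  proof -
    have "?N A (U n) \<le> ?N A V0 * ?N A0 (U n)" if "compact A"
      using cover_number_mult[OF H that V0(2,1,3,4) U(1,2)] .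
    then have "compact A \<Longrightarrow> real (?N A (U n)) \<le> real (?N A V0) * real (?N A0 (U n))"
      by (simp flip: of_nat_mult)
    then show ?thesis using N0[of n] by (auto simp: s_def b_def divide_simps)
  qed
  obtain l F where F: "F \<noteq> bot" "F \<le> sequentially" and l: "\<And>A. ((\<lambda>n. s n A) \<longlongrightarrow> l A) F"
    using cluster_point_in_box[of s b, OF box] by blast
  have ev: "eventually P F" if "eventually P sequentially" for P using F(2) that by (rule filter_leD)
  have le: "l A \<le> l B" if "\<And>n. s n A \<le> s n B" for A B
    by (rule tendsto_le[OF F(1) l l]) (use that in simp)
  show ?thesis
  proof (rule that[of l])
    show "0 \<le> l A" for A by (rule tendsto_lowerbound[OF l _ F(1)]) (use box in simp)
    show "l A \<le> l B" if "compact A" "compact B" "A \<inter> H \<subseteq> B" for A B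
      using that cover_number_mono[OF H that(2) U(1,2) that(3)]
      by (intro le) (auto simp: s_def divide_right_mono)
    show "l (A \<union> B) \<le> l A + l B" if "compact A" "compact B" for A B
      using that cover_number_Un[OF H that U(1,2)]
      by (intro tendsto_le[OF F(1) tendsto_add[OF l l] l])
         (auto simp: s_def compact_Un divide_right_mono add_divide_distrib[symmetric] simp flip: of_nat_add)
    show "l ((+) h ` A) = l A" if "compact A" "h \<in> H" for A h
      using that compact_translate[OF that(1)] cover_number_translate[OF H that(1) U(1,2) that(2)]
      by (intro tendsto_unique[OF F(1) l]) (use l[of A] in \<open>auto simp: s_def\<close>)
    have "covers H {} (U n) {}" for n by (simp add: covers_def)
    then have "?N {} (U n) = 0" for n using cover_number_le[of H "{}" "U n" "{}"] by simp
    then have "s n {} = 0" for n by (simp add: s_def)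
    then show "l {} = 0" using tendsto_unique[OF F(1) l[of "{}"]] by simp
    show "l A + l B \<le> l (A \<union> B)" if AB: "compact A" "compact B" "A \<inter> B = {}" for A B
    proof -
      let ?D = "(\<lambda>(a,b). - a + b) ` (A \<times> B)"
      have "compact ?D" using AB
        by (intro compact_continuous_image compact_Times) (auto simp: case_prod_beta intro!: continuous_intros)
      moreover have "0 \<notin> ?D"
      proof
        assume "0 \<in> ?D"
        then obtain a b where "a \<in> A" "b \<in> B" "- a + b = 0" by auto
        then show False using AB(3) by (metis disjoint_iff minus_unique minus_minus)
      qed
      ultimately have "open (- ?D)" "0 \<in> - ?D" by (auto intro: compact_imp_closed)
      then obtain W where W: "open W" "0 \<in> W" "\<And>x y. x \<in> W \<Longrightarrow> y \<in> W \<Longrightarrow> - x + y \<in> - ?D"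
        by (rule open_nbhd_diff) (rule that)
      have "eventually (\<lambda>n. s n A + s n B \<le> s n (A \<union> B)) sequentially"
        using U(3)[OF W(1,2)]
      proof eventually_elim
        case (elim n)
        have "(+) x ` U n \<inter> A = {} \<or> (+) x ` U n \<inter> B = {}" for x
        proof (rule ccontr)
          assume "\<not> ?thesis"
          then obtain u v where uv: "u \<in> U n" "x + u \<in> A" "v \<in> U n" "x + v \<in> B" by auto
          then have "- (x + u) + (x + v) \<in> ?D" by force
          then have "- u + v \<in> ?D" by (simp only: minus_add add.assoc minus_add_cancel)
          then show False using W(3)[of u v] uv elim by auto
        qed
        then have "?N A (U n) + ?N B (U n) \<le> ?N (A \<union> B) (U n)"
          by (intro cover_number_Un_separated[OF H AB(1,2) U(1,2)])
        then show ?case using AB(1,2)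
          by (auto simp: s_def compact_Un divide_right_mono add_divide_distrib[symmetric] simp flip: of_nat_add)
      qed
      then show ?thesis by (intro tendsto_le[OF F(1) l tendsto_add[OF l l]] ev)
    qed
    show "0 < l K" if K: "open V" "0 \<in> V" "V \<subseteq> K" "compact K" for V K
    proof -
      have "1 \<le> real (?N A0 V) * s n K" for n
      proof -
        have "?N A0 (U n) \<le> ?N A0 V * ?N K (U n)"
          using cover_number_mult[OF H V0(2) K(4,1,2,3) U(1,2)] .
        then have "real (?N A0 (U n)) \<le> real (?N A0 V) * real (?N K (U n))"
          by (simp flip: of_nat_mult)
        then show ?thesis using N0[of n] K(4) by (simp add: s_def divide_simps)
      qed
      then have "1 \<le> real (?N A0 V) * l K"
        by (intro tendsto_lowerbound[OF tendsto_mult[OF tendsto_const l] _ F(1)]) simp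
      then show ?thesis by (metis less_eq_real_def mult_nonneg_nonpos not_one_le_zero of_nat_0_le_iff order_trans linorder_not_le)
    qed
  qed
qed

text \<open>
  Separate the disjoint compact sets \<open>K - V\<close> and \<open>K - U\<close> by open sets and remove these from \<open>K\<close>.
\<close>

lemma compact_split:
  fixes K :: "'a::t2_space set"
  assumes "compact K" "open U" "open V" "K \<subseteq> U \<union> V"
  obtains A B where "compact A" "compact B" "A \<subseteq> U" "B \<subseteq> V" "K = A \<union> B"
proof -
  have "compact (K - V)" "compact (K - U)" using assms by (auto intro: compact_diff)
  moreover have "disjnt (K - V) (K - U)" using assms by (auto simp: disjnt_def)
  ultimately have "\<exists>P Q. open P \<and> open Q \<and> K - V \<subseteq> P \<and> K - U \<subseteq> Q \<and> disjnt P Q"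
    using Hausdorff_space_t2[where 'a='a] by (simp add: Hausdorff_space_compact_sets)
  then obtain P Q where PQ: "open P" "open Q" "K - V \<subseteq> P" "K - U \<subseteq> Q" "disjnt P Q"
    by blast
  show ?thesis
    by (rule that[of "K - Q" "K - P"]) (use assms PQ in \<open>auto intro: compact_diff simp: disjnt_def\<close>)
qed

text \<open>
  Halmos' extension: inner approximation of open sets by compact ones, then outer approximation
  of arbitrary sets by open ones, gives an outer measure for which open sets are
  Caratheodory measurable. The last property, outer regularity, is what transports
  invariance from the content to the measure.
\<close>

lemma content_extends_to_borel_measure:
  fixes l :: "'a::t2_space set \<Rightarrow> ennreal"
  assumes mono: "\<And>A B. compact A \<Longrightarrow> compact B \<Longrightarrow> A \<subseteq> B \<Longrightarrow> l A \<le> l B"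
    and sub: "\<And>A B. compact A \<Longrightarrow> compact B \<Longrightarrow> l (A \<union> B) \<le> l A + l B"
    and super: "\<And>A B. compact A \<Longrightarrow> compact B \<Longrightarrow> A \<inter> B = {} \<Longrightarrow> l A + l B \<le> l (A \<union> B)"
    and empty: "l {} = 0"
  obtains M where "sets M = sets borel"
    "\<And>U. open U \<Longrightarrow> emeasure M U = (SUP K\<in>{K. compact K \<and> K \<subseteq> U}. l K)"
    "\<And>E. E \<in> sets borel \<Longrightarrow> emeasure M E = (INF U\<in>{U. open U \<and> E \<subseteq> U}. emeasure M U)"
proof -
  define v where "v U = (SUP K\<in>{K. compact K \<and> K \<subseteq> U}. l K)" for U
  define mu where "mu E = (INF U\<in>{U. open U \<and> E \<subseteq> U}. v U)" for E
  have v_upper: "l K \<le> v U" if "compact K" "K \<subseteq> U" for K U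
    unfolding v_def using that by (intro SUP_upper) auto
  have v_least: "v U \<le> c" if "\<And>K. compact K \<Longrightarrow> K \<subseteq> U \<Longrightarrow> l K \<le> c" for U c
    unfolding v_def using that by (intro SUP_least) auto
  have v_mono: "v U \<le> v V" if "U \<subseteq> V" for U V
    using that by (intro v_least v_upper) auto
  have v_empty: "v {} = 0"
    using v_least[of "{}" 0] empty by auto
  have mu_lower: "mu E \<le> v U" if "open U" "E \<subseteq> U" for E U
    unfolding mu_def using that by (intro INF_lower) auto
  have mu_greatest: "c \<le> mu E" if "\<And>U. open U \<Longrightarrow> E \<subseteq> U \<Longrightarrow> c \<le> v U" for c E
    unfolding mu_def using that by (intro INF_greatest) auto
  have mu_open: "mu U = v U" if "open U" for U
  proof (rule antisym)
    show "mu U \<le> v U" using that by (intro mu_lower) auto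
    show "v U \<le> mu U" by (intro mu_greatest v_mono)
  qed
  have mu_mono: "mu E \<le> mu F" if "E \<subseteq> F" for E F
    using that by (intro mu_greatest mu_lower) auto
  have mu_empty: "mu {} = 0" using mu_open[of "{}"] v_empty by simp
  have v_Un: "v (U \<union> V) \<le> v U + v V" if UV: "open U" "open V" for U V
  proof (rule v_least)
    fix K assume K: "compact K" "K \<subseteq> U \<union> V"
    obtain A B where AB: "compact A" "compact B" "A \<subseteq> U" "B \<subseteq> V" "K = A \<union> B"
      by (rule compact_split[OF K(1) UV K(2)]) (rule that)
    then have "l K \<le> l A + l B" using sub by simp
    also have "\<dots> \<le> v U + v V" using AB by (intro add_mono v_upper)
    finally show "l K \<le> v U + v V" .
  qed
  have v_finite: "v (\<Union>i\<in>I. U i) \<le> (\<Sum>i\<in>I. v (U i))" if "finite I" "\<And>i::nat. open (U i)" for U I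
    using that(1)
  proof induction
    case (insert i I)
    have "v (\<Union>i\<in>insert i I. U i) \<le> v (U i) + v (\<Union>i\<in>I. U i)"
      using v_Un[of "U i" "\<Union>i\<in>I. U i"] that by auto
    also have "\<dots> \<le> v (U i) + (\<Sum>i\<in>I. v (U i))" by (intro add_left_mono insert)
    finally show ?case using insert by simp
  qed (simp add: v_empty)
  have v_countable: "v (\<Union>i. U i) \<le> (\<Sum>i. v (U i))" if U: "\<And>i::nat. open (U i)" for U
  proof (rule v_least)
    fix K assume K: "compact K" "K \<subseteq> (\<Union>i. U i)"
    obtain I where I: "finite I" "K \<subseteq> (\<Union>i\<in>I. U i)"
      by (rule compactE_image[OF K(1) U K(2)]) (rule that)
    have "l K \<le> v (\<Union>i\<in>I. U i)" using K I by (intro v_upper)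
    also have "\<dots> \<le> (\<Sum>i\<in>I. v (U i))" using I that by (intro v_finite)
    also have "\<dots> \<le> (\<Sum>i. v (U i))" using I by (intro sum_le_suminf) auto
    finally show "l K \<le> (\<Sum>i. v (U i))" .
  qed
  have mu_countable: "mu (\<Union>i. A i) \<le> (\<Sum>i. mu (A i))" for A :: "nat \<Rightarrow> 'a set"
  proof (rule ennreal_le_epsilon)
    fix e :: real assume e: "0 < e" "(\<Sum>i. mu (A i)) < top"
    then have less: "mu (A i) < mu (A i) + e * (1/2)^Suc i" for i
      by (auto simp add: less_top dest!: ennreal_suminf_lessD)
    have "\<exists>U. open U \<and> A i \<subseteq> U \<and> v U \<le> mu (A i) + e * (1/2)^Suc i" for i
      using less[of i] unfolding mu_def INF_less_iff by (auto intro: less_imp_le)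
    then obtain U where U: "\<And>i. open (U i)" "\<And>i. A i \<subseteq> U i"
        "\<And>i. v (U i) \<le> mu (A i) + e * (1/2)^Suc i" by metis
    have "mu (\<Union>i. A i) \<le> v (\<Union>i. U i)" using U by (intro mu_lower) auto
    also have "\<dots> \<le> (\<Sum>i. v (U i))" using U by (intro v_countable)
    also have "\<dots> \<le> (\<Sum>i. mu (A i) + e * (1/2)^Suc i)" using U by (intro suminf_le) auto
    also have "\<dots> = (\<Sum>i. mu (A i)) + (\<Sum>n. ennreal e * ennreal ((1/2) ^ Suc n))"
      using \<open>0 < e\<close> by (subst suminf_add[symmetric])
                       (auto simp del: ennreal_suminf_cmult simp add: ennreal_mult[symmetric])
    also have "\<dots> = (\<Sum>i. mu (A i)) + e"
      unfolding ennreal_suminf_cmult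
      by (subst suminf_ennreal_eq[OF zero_le_power power_half_series]) auto
    finally show "mu (\<Union>i. A i) \<le> (\<Sum>i. mu (A i)) + e" .
  qed
  interpret P: sigma_algebra UNIV "Pow UNIV :: 'a set set" by (rule sigma_algebra_Pow)
  have outer: "outer_measure_space (Pow UNIV) mu"
    unfolding outer_measure_space_def positive_def increasing_def countably_subadditive_def
    using mu_empty mu_mono mu_countable by auto
  let ?L = "lambda_system UNIV (Pow UNIV) mu"
  have ms: "measure_space UNIV ?L mu" by (rule P.caratheodory_lemma[OF outer])
  have mu_Un: "mu (A \<union> B) \<le> mu A + mu B" if "A \<inter> B = {}" for A B
  proof -
    have "subadditive (Pow UNIV) mu"
      using outer by (intro P.countably_subadditive_subadditive) (auto simp: outer_measure_space_def)
    then show ?thesis using that by (auto intro: subadditiveD)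
  qed
  have open_L: "W \<in> ?L" if "open W" for W
  proof -
    have "mu (E \<inter> W) + mu (E - W) = mu E" for E
    proof (rule antisym)
      have "mu E = mu ((E \<inter> W) \<union> (E - W))" by (rule arg_cong[of _ _ mu]) auto
      also have "\<dots> \<le> mu (E \<inter> W) + mu (E - W)" by (rule mu_Un) auto
      finally show "mu E \<le> mu (E \<inter> W) + mu (E - W)" .
      show "mu (E \<inter> W) + mu (E - W) \<le> mu E"
      proof (rule mu_greatest)
        fix Q assume Q: "open Q" "E \<subseteq> Q"
        have *: "l K + mu (E - W) \<le> v Q" if K: "compact K" "K \<subseteq> Q \<inter> W" for K
        proof -
          have "closed K" using K by (simp add: compact_imp_closed)
          have "mu (E - W) \<le> v (Q - K)" using Q K \<open>closed K\<close> by (intro mu_lower) auto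
          then have "l K + mu (E - W) \<le> l K + v (Q - K)" by (rule add_left_mono)
          also have "\<dots> = (SUP L\<in>{L. compact L \<and> L \<subseteq> Q - K}. l K + l L)"
            unfolding v_def by (rule ennreal_SUP_add_right) auto
          also have "\<dots> \<le> v Q"
          proof (rule SUP_least)
            fix L assume "L \<in> {L. compact L \<and> L \<subseteq> Q - K}"
            then have L: "compact L" "L \<subseteq> Q - K" by auto
            then have "l K + l L \<le> l (K \<union> L)" using K by (intro super) auto
            also have "\<dots> \<le> v Q" using K L by (intro v_upper compact_Un) auto
            finally show "l K + l L \<le> v Q" .
          qed
          finally show ?thesis .
        qed
        have "mu (E \<inter> W) + mu (E - W) \<le> v (Q \<inter> W) + mu (E - W)"
          using Q that by (intro add_right_mono mu_lower) auto
        also have "\<dots> = (SUP K\<in>{K. compact K \<and> K \<subseteq> Q \<inter> W}. l K + mu (E - W))"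
          unfolding v_def by (rule ennreal_SUP_add_left[symmetric]) auto
        also have "\<dots> \<le> v Q" using * by (intro SUP_least) auto
        finally show "mu (E \<inter> W) + mu (E - W) \<le> v Q" .
      qed
    qed
    then show ?thesis unfolding P.lambda_system_eq by simp
  qed
  interpret L: sigma_algebra UNIV ?L using ms by (simp add: measure_space_def)
  have "sigma_sets UNIV {U. open U} \<subseteq> ?L"
    by (rule L.sigma_sets_subset) (use open_L in auto)
  then have borel_L: "sets borel \<subseteq> ?L" by (simp add: borel_def)
  let ?M = "measure_of UNIV (sets borel) mu"
  have em: "emeasure ?M E = mu E" if "E \<in> sets borel" for E
  proof (rule emeasure_measure_of_sigma[OF _ _ _ that])
    show "sigma_algebra UNIV (sets (borel :: 'a measure))"
      using sets.sigma_algebra_axioms[of "borel :: 'a measure"] by simp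
    show "positive (sets borel) mu" by (simp add: positive_def mu_empty)
    show "countably_additive (sets borel) mu"
    proof (unfold countably_additive_def, intro allI impI)
      fix A :: "nat \<Rightarrow> 'a set" assume "range A \<subseteq> sets borel" "disjoint_family A" "(\<Union>i. A i) \<in> sets borel"
      moreover have "countably_additive ?L mu" using ms by (simp add: measure_space_def)
      ultimately show "(\<Sum>i. mu (A i)) = mu (\<Union>i. A i)"
        using borel_L unfolding countably_additive_def by blast
    qed
  qed
  show ?thesis
  proof (rule that[of ?M])
    show "sets ?M = sets borel" using sets.sigma_sets_eq[of "borel :: 'a measure"] by simp
    show op: "emeasure ?M U = (SUP K\<in>{K. compact K \<and> K \<subseteq> U}. l K)" if "open U" for U
      using that em[of U] mu_open v_def by simp
    show "emeasure ?M E = (INF U\<in>{U. open U \<and> E \<subseteq> U}. emeasure ?M U)" if "E \<in> sets borel" for E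
    proof -
      have "emeasure ?M U = v U" if "open U" for U using that em[of U] mu_open by simp
      then have "(INF U\<in>{U. open U \<and> E \<subseteq> U}. emeasure ?M U) = (INF U\<in>{U. open U \<and> E \<subseteq> U}. v U)"
        by (intro INF_cong) auto
      then show ?thesis using em[OF that] mu_def[of E] by simp
    qed
  qed
qed

text \<open>
  A Haar measure of \<open>H\<close> is regarded as a Borel measure on the ambient group that vanishes
  off \<open>H\<close>.
\<close>

definition haar_measure_on :: "'a::topological_group_add set \<Rightarrow> 'a measure \<Rightarrow> bool" where
  "haar_measure_on H M \<longleftrightarrow> sets M = sets borel \<and> emeasure M (- H) = 0 \<and>
    (\<forall>h\<in>H. distr M borel ((+) h) = M) \<and>
    (\<forall>K. compact K \<longrightarrow> emeasure M K < \<infinity>) \<and>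
    (\<forall>U. open U \<longrightarrow> 0 \<in> U \<longrightarrow> 0 < emeasure M U)"

lemma haar_measure_exists:
  fixes H :: "'a::{topological_group_add,t2_space,second_countable_topology} set"
  assumes lc: "locally_compact_space (euclidean :: 'a topology)" and H: "H \<in> closed_subgroups"
  shows "\<exists>M. haar_measure_on H M"
proof -
  obtain l :: "'a set \<Rightarrow> real" where l:
    "\<And>A. 0 \<le> l A"
    "\<And>A B. compact A \<Longrightarrow> compact B \<Longrightarrow> A \<inter> H \<subseteq> B \<Longrightarrow> l A \<le> l B"
    "\<And>A B. compact A \<Longrightarrow> compact B \<Longrightarrow> l (A \<union> B) \<le> l A + l B"
    "\<And>A B. compact A \<Longrightarrow> compact B \<Longrightarrow> A \<inter> B = {} \<Longrightarrow> l A + l B \<le> l (A \<union> B)"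
    "\<And>A h. compact A \<Longrightarrow> h \<in> H \<Longrightarrow> l ((+) h ` A) = l A"
    "l {} = 0"
    "\<And>V K. open V \<Longrightarrow> 0 \<in> V \<Longrightarrow> V \<subseteq> K \<Longrightarrow> compact K \<Longrightarrow> 0 < l K"
    by (rule haar_content_exists[OF lc H]) (rule that)
  obtain M :: "'a measure" where M: "sets M = sets borel"
    "\<And>U. open U \<Longrightarrow> emeasure M U = (SUP K\<in>{K. compact K \<and> K \<subseteq> U}. ennreal (l K))"
    "\<And>E. E \<in> sets borel \<Longrightarrow> emeasure M E = (INF U\<in>{U. open U \<and> E \<subseteq> U}. emeasure M U)"
  proof (rule content_extends_to_borel_measure[of "\<lambda>A. ennreal (l A)"])
    show "ennreal (l A) \<le> ennreal (l B)" if "compact A" "compact B" "A \<subseteq> B" for A B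
      using that by (intro ennreal_leI l(2)) auto
    show "ennreal (l (A \<union> B)) \<le> ennreal (l A) + ennreal (l B)" if "compact A" "compact B" for A B
      using l(3)[OF that] l(1) by (simp add: ennreal_leI flip: ennreal_plus)
    show "ennreal (l A) + ennreal (l B) \<le> ennreal (l (A \<union> B))"
      if "compact A" "compact B" "A \<inter> B = {}" for A B
      using l(4)[OF that] l(1) by (simp add: ennreal_leI flip: ennreal_plus)
    show "ennreal (l {}) = 0" using l(6) by simp
  qed (rule that)
  have translate_open: "emeasure M U \<le> emeasure M ((+) h ` U)" if "open U" "h \<in> H" for U h
    unfolding M(2)[OF that(1)] M(2)[OF open_translate[OF that(1)]]
  proof (rule SUP_least)
    fix K assume K: "K \<in> {K. compact K \<and> K \<subseteq> U}"
    then have "ennreal (l K) = ennreal (l ((+) h ` K))" using l(5) that(2) by simp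
    also have "\<dots> \<le> (SUP K\<in>{K. compact K \<and> K \<subseteq> (+) h ` U}. ennreal (l K))"
      using K compact_translate by (intro SUP_upper) auto
    finally show "ennreal (l K) \<le> (SUP K\<in>{K. compact K \<and> K \<subseteq> (+) h ` U}. ennreal (l K))" .
  qed
  have vimage: "(+) h -` E = (+) (- h) ` E" for h :: 'a and E
    by (auto simp: mem_translate)
  have meas: "(+) h \<in> borel_measurable borel" for h :: 'a
    by (intro borel_measurable_continuous_onI continuous_intros)
  have translate: "emeasure M E \<le> emeasure M ((+) h -` E)" if "E \<in> sets borel" "h \<in> H" for E h
  proof -
    have "(+) h -` E \<in> sets borel" using measurable_sets[OF meas that(1)] by simp
    then have "emeasure M ((+) h -` E) = (INF U\<in>{U. open U \<and> (+) h -` E \<subseteq> U}. emeasure M U)" by (rule M(3))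
    moreover have "emeasure M E \<le> (INF U\<in>{U. open U \<and> (+) h -` E \<subseteq> U}. emeasure M U)"
    proof (rule INF_greatest)
      fix U assume "U \<in> {U. open U \<and> (+) h -` E \<subseteq> U}"
      then have U: "open U" "(+) h -` E \<subseteq> U" by auto
      then have "E \<subseteq> (+) h ` U" by (force simp: mem_translate)
      then have "emeasure M E \<le> emeasure M ((+) h ` U)"
        using M(1) open_translate[OF U(1)] by (intro emeasure_mono) auto
      also have "\<dots> \<le> emeasure M ((+) (- h) ` (+) h ` U)"
        using U that closed_subgroupsD(4)[OF H] by (intro translate_open open_translate)
      also have "\<dots> = emeasure M U" by (simp add: image_image add.assoc[symmetric])
      finally show "emeasure M E \<le> emeasure M U" .
    qed
    ultimately show ?thesis by simp
  qed
  have "haar_measure_on H M"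
    unfolding haar_measure_on_def
  proof (intro conjI ballI allI impI)
    show "sets M = sets borel" by fact
    have "open (- H)" using closed_subgroupsD(1)[OF H] by auto
    then have "emeasure M (- H) = (SUP K\<in>{K. compact K \<and> K \<subseteq> - H}. ennreal (l K))" by (rule M(2))
    also have "\<dots> \<le> 0"
    proof (rule SUP_least)
      fix K assume "K \<in> {K. compact K \<and> K \<subseteq> - H}"
      then have "l K \<le> l {}" by (intro l(2)) auto
      then show "ennreal (l K) \<le> 0" using l(6) by (simp add: ennreal_neg)
    qed
    finally show "emeasure M (- H) = 0" by simp
    show "distr M borel ((+) h) = M" if h: "h \<in> H" for h
    proof (rule measure_eqI)
      fix E assume "E \<in> sets (distr M borel ((+) h))"
      then have E: "E \<in> sets borel" by simp
      have "(+) h \<in> measurable M borel" using meas M(1) by (simp cong: measurable_cong_sets)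
      then have "emeasure (distr M borel ((+) h)) E = emeasure M ((+) h -` E)"
        using E sets_eq_imp_space_eq[OF M(1)] by (simp add: emeasure_distr)
      moreover have "emeasure M ((+) h -` E) \<le> emeasure M ((+) (-h) -` (+) h -` E)"
        using measurable_sets[OF meas E] h closed_subgroupsD(4)[OF H] by (intro translate) auto
      moreover have "(+) (-h) -` (+) h -` E = E" by (auto simp: add.assoc[symmetric])
      ultimately show "emeasure (distr M borel ((+) h)) E = emeasure M E"
        using translate[OF E h] by (intro antisym) auto
    qed (simp add: M(1))
    show "emeasure M K < \<infinity>" if K: "compact K" for K
    proof -
      have "\<exists>V B. open V \<and> compact B \<and> x \<in> V \<and> V \<subseteq> B" for x :: 'a
        by (rule locally_compact_nhd[OF lc, of x]) blast
      then obtain V B where VB: "\<And>x::'a. open (V x)" "\<And>x. compact (B x)" "\<And>x. x \<in> V x" "\<And>x. V x \<subseteq> B x"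
        by metis
      have UN: "K \<subseteq> (\<Union>x\<in>UNIV. V x)" using VB(3) by blast
      obtain I where I: "finite I" "K \<subseteq> (\<Union>x\<in>I. V x)"
        by (rule compactE_image[OF K VB(1) UN]) (rule that)
      let ?B = "\<Union>x\<in>I. B x" and ?V = "\<Union>x\<in>I. V x"
      have "compact ?B" using I VB by (intro compact_UN) auto
      have "emeasure M K \<le> emeasure M ?V" using I M(1) VB by (intro emeasure_mono) auto
      also have "\<dots> = (SUP K\<in>{K. compact K \<and> K \<subseteq> ?V}. ennreal (l K))" using VB by (intro M(2)) auto
      also have "\<dots> \<le> ennreal (l ?B)"
        using \<open>compact ?B\<close> VB(4) by (intro SUP_least ennreal_leI l(2)) blast+
      also have "\<dots> < \<infinity>" by simp
      finally show ?thesis .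
    qed
    show "0 < emeasure M U" if U: "open U" "0 \<in> U" for U
    proof -
      obtain V B where V: "open V" "compact B" "(0::'a) \<in> V" "V \<subseteq> B" "B \<subseteq> U"
        using compact_nhd_inside[OF lc U] .
      then have "0 < ennreal (l B)" using l(7) by simp
      also have "\<dots> \<le> emeasure M U" unfolding M(2)[OF U(1)] using V by (intro SUP_upper) auto
      finally show ?thesis .
    qed
  qed
  then show ?thesis by blast
qed

section \<open>Borel sets of the Fell topology\<close>

abbreviation fell_borel :: "'a::topological_space set set \<Rightarrow> 'a set measure" where
  "fell_borel X \<equiv> borel_of (subtopology fell_topology X)"

lemma topspace_fell: "topspace fell_topology = {C. closed C}"
proof
  show "topspace fell_topology \<subseteq> {C. closed C}"
    unfolding fell_topology_def topology_generated_by_topspace by auto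
  have "{C. closed C \<and> C \<inter> {} = {}} \<subseteq> topspace (fell_topology :: 'a set topology)"
    unfolding fell_topology_def topology_generated_by_topspace
    by (intro Union_upper UnI1 CollectI exI[of _ "{}"]) simp
  then show "{C. closed C} \<subseteq> topspace (fell_topology :: 'a set topology)" by simp
qed

lemma space_fell_borel [simp]:
  assumes "X \<subseteq> {C. closed C}" shows "space (fell_borel X) = X"
  using assms by (simp add: borel_of_def topspace_fell Int_absorb1 space_measure_of_conv)

lemma openin_fell_hit: "open U \<Longrightarrow> openin fell_topology {C. closed C \<and> C \<inter> U \<noteq> {}}"
  unfolding fell_topology_def by (intro topology_generated_by_Basis UnI2 CollectI exI[of _ U]) simp

text \<open>
  The sets of the Fell subbasis, but with open sets in the place of compact ones. Missing an open set is in general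
  not an open condition, but it is measurable, and both parameters can range over subsets of a countable basis.
\<close>

definition fell_nbhd :: "'a::topological_space set set \<Rightarrow> 'a set set \<Rightarrow> 'a set set" where
  "fell_nbhd F E = {D. closed D \<and> D \<inter> \<Union>F = {} \<and> (\<forall>U\<in>E. D \<inter> U \<noteq> {})}"

text \<open>
  A compact set missed by the closed set \<open>C\<close> is contained in a finite union of basic open sets that
  \<open>C\<close> misses as well. So each Fell open set is a union of members of a countable family of sets \<open>fell_nbhd F E\<close>.
\<close>

lemma openin_fell_basic_nhd:
  fixes \<B> :: "'a::topological_space set set"
  assumes \<B>: "topological_basis \<B>" and T: "openin fell_topology T" and C: "C \<in> T" "closed C"
  shows "\<exists>F E. finite F \<and> F \<subseteq> \<B> \<and> finite E \<and> E \<subseteq> \<B> \<and> C \<in> fell_nbhd F E \<and> fell_nbhd F E \<subseteq> T"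
proof -
  have "generate_topology_on ({{C. closed C \<and> C \<inter> K = {}} |K. compact K} \<union>
      {{C. closed C \<and> C \<inter> U \<noteq> {}} |U. open U}) T"
    using T unfolding fell_topology_def by (rule openin_topology_generated_by)
  then show ?thesis using C
  proof (induction arbitrary: C)
    case (Int S T)
    obtain F E where 1: "finite F" "F \<subseteq> \<B>" "finite E" "E \<subseteq> \<B>" "C \<in> fell_nbhd F E" "fell_nbhd F E \<subseteq> S"
      using Int.IH(1)[of C] Int.prems by auto
    obtain F' E' where 2: "finite F'" "F' \<subseteq> \<B>" "finite E'" "E' \<subseteq> \<B>" "C \<in> fell_nbhd F' E'" "fell_nbhd F' E' \<subseteq> T"
      using Int.IH(2)[of C] Int.prems by auto
    have "fell_nbhd (F \<union> F') (E \<union> E') = fell_nbhd F E \<inter> fell_nbhd F' E'"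
      by (auto simp: fell_nbhd_def)
    then show ?case using 1 2 by (intro exI[of _ "F \<union> F'"] exI[of _ "E \<union> E'"]) auto
  next
    case (UN K)
    then obtain T where T: "T \<in> K" "C \<in> T" by blast
    obtain F E where 1: "finite F" "F \<subseteq> \<B>" "finite E" "E \<subseteq> \<B>" "C \<in> fell_nbhd F E" "fell_nbhd F E \<subseteq> T"
      using UN.IH[OF T \<open>closed C\<close>] by auto
    then show ?case using T(1) by (intro exI[of _ F] exI[of _ E]) auto
  next
    case (Basis S)
    then have "(\<exists>K. compact K \<and> S = {C. closed C \<and> C \<inter> K = {}}) \<or> (\<exists>U. open U \<and> S = {C. closed C \<and> C \<inter> U \<noteq> {}})"
      by auto
    then show ?case
    proof
      assume "\<exists>K. compact K \<and> S = {C. closed C \<and> C \<inter> K = {}}"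
      then obtain K where K: "compact K" "S = {C. closed C \<and> C \<inter> K = {}}" by auto
      let ?N = "{B\<in>\<B>. B \<subseteq> - C}"
      have "open (- C)" using Basis.prems by auto
      have cover: "K \<subseteq> (\<Union>B\<in>?N. B)"
      proof
        fix x assume "x \<in> K"
        then have "x \<in> - C" using K Basis.prems by auto
        then obtain B where "B \<in> \<B>" "x \<in> B" "B \<subseteq> - C"
          by (rule topological_basisE[OF \<B> \<open>open (- C)\<close>]) (rule that)
        then show "x \<in> (\<Union>B\<in>?N. B)" by auto
      qed
      have op: "open B" if "B \<in> ?N" for B
        using that topological_basis_open[OF \<B>] by auto
      obtain F where F: "F \<subseteq> ?N" "finite F" "K \<subseteq> (\<Union>B\<in>F. B)"
        by (rule compactE_image[OF K(1) op cover]) (assumption | rule that)+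
      have "C \<in> fell_nbhd F {}" "fell_nbhd F {} \<subseteq> S"
        using F K(2) Basis.prems by (auto simp: fell_nbhd_def)
      then show ?thesis using F by (intro exI[of _ F] exI[of _ "{}"]) auto
    next
      assume "\<exists>U. open U \<and> S = {C. closed C \<and> C \<inter> U \<noteq> {}}"
      then obtain U where U: "open U" "S = {C. closed C \<and> C \<inter> U \<noteq> {}}" by auto
      then obtain x where x: "x \<in> C" "x \<in> U" using Basis.prems by auto
      obtain B where B: "B \<in> \<B>" "x \<in> B" "B \<subseteq> U"
        by (rule topological_basisE[OF \<B> U(1) x(2)]) (rule that)
      then have "C \<in> fell_nbhd {} {B}" "fell_nbhd {} {B} \<subseteq> S"
        using U(2) x Basis.prems by (auto simp: fell_nbhd_def)
      then show ?thesis using B by (intro exI[of _ "{}"] exI[of _ "{B}"]) auto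
    qed
  qed simp
qed

text \<open>
  The reduction of measurability questions to hitting open sets: every Fell open set
  is a countable union of sets \<open>fell_nbhd F E\<close>, so the Borel sets are already generated by
  the sets of those \<open>C\<close> that hit a given open set.
\<close>

lemma sets_fell_borel:
  fixes X :: "'a::second_countable_topology set set"
  assumes X: "X \<subseteq> {C. closed C}"
  shows "sets (fell_borel X) = sigma_sets X {{C\<in>X. C \<inter> U \<noteq> {}} |U. open U}"
proof -
  let ?S = "sigma_sets X {{C\<in>X. C \<inter> U \<noteq> {}} |U. open U}"
  have ts: "topspace (subtopology fell_topology X) = X"
    using X by (simp add: topspace_fell Int_absorb1)
  have "{U. openin (subtopology fell_topology X) U} \<subseteq> Pow X"
    using openin_subset[of "subtopology fell_topology X"] unfolding ts by blast
  then have eq: "sets (fell_borel X) = sigma_sets X {U. openin (subtopology fell_topology X) U}"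
    unfolding borel_of_def ts by (rule sets_measure_of)
  interpret S: sigma_algebra X ?S by (rule sigma_algebra_sigma_sets) auto
  have "T \<inter> X \<in> ?S" if T: "openin fell_topology T" for T
  proof -
    obtain \<B> :: "'a set set" where \<B>: "countable \<B>" "topological_basis \<B>"
      using ex_countable_basis by blast
    let ?fin = "{F. F \<subseteq> \<B> \<and> finite F}"
    let ?b = "\<lambda>p. fell_nbhd (fst p) (snd p) \<inter> X"
    have hit: "{C\<in>X. C \<inter> U \<noteq> {}} \<in> ?S" if "open U" for U using that by (intro sigma_sets.Basic) auto
    have b: "?b p \<in> ?S" if p: "p \<in> ?fin \<times> ?fin" for p
    proof -
      obtain F E where FE: "p = (F, E)" "finite F" "finite E" "F \<subseteq> \<B>" "E \<subseteq> \<B>" using p by auto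
      have op: "open (\<Union>F)" using FE \<B>(2) by (auto intro: topological_basis_open)
      let ?Z = "X - (\<Union>U\<in>E. X - {C\<in>X. C \<inter> U \<noteq> {}})"
      have "X - {C\<in>X. C \<inter> U \<noteq> {}} \<in> ?S" if "U \<in> E" for U
        using that FE topological_basis_open[OF \<B>(2)] by (intro S.compl_sets hit) auto
      then have "?Z \<in> ?S"
        using FE by (intro S.compl_sets[OF S.finite_UN]) auto
      then have "?Z \<inter> (X - {C\<in>X. C \<inter> \<Union>F \<noteq> {}}) \<in> ?S"
        using S.compl_sets[OF hit[OF op]] by (rule S.Int)
      moreover have "?b p = ?Z \<inter> (X - {C\<in>X. C \<inter> \<Union>F \<noteq> {}})"
        using FE(1) X by (auto simp: fell_nbhd_def)
      ultimately show ?thesis by simp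
    qed
    let ?I = "{p\<in>?fin \<times> ?fin. ?b p \<subseteq> T}"
    have "countable ?fin"
      using countable_Collect_finite_subset[OF \<B>(1)] by (simp add: conj_commute)
    then have "countable (?fin \<times> ?fin)" by simp
    then have "countable ?I" by (rule countable_subset[rotated]) auto
    then have "(\<Union>p\<in>?I. ?b p) \<in> ?S" using b by (intro S.countable_UN') auto
    moreover have "T \<inter> X = (\<Union>p\<in>?I. ?b p)"
    proof (intro equalityI subsetI)
      fix C assume C: "C \<in> T \<inter> X"
      then have "closed C" using X by auto
      then obtain F E where "finite F" "F \<subseteq> \<B>" "finite E" "E \<subseteq> \<B>" "C \<in> fell_nbhd F E" "fell_nbhd F E \<subseteq> T"
        using openin_fell_basic_nhd[OF \<B>(2) T, of C] C by auto
      then have "(F, E) \<in> ?I" "C \<in> ?b (F, E)" using C by auto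
      then show "C \<in> (\<Union>p\<in>?I. ?b p)" by (rule UN_I)
    qed auto
    ultimately show ?thesis by simp
  qed
  then have "{U. openin (subtopology fell_topology X) U} \<subseteq> ?S"
    by (auto simp: openin_subtopology)
  then have "sets (fell_borel X) \<subseteq> ?S" unfolding eq by (rule S.sigma_sets_subset)
  moreover have "?S \<subseteq> sets (fell_borel X)"
    unfolding eq
  proof (rule sigma_sets_mono, safe)
    fix U :: "'a set" assume "open U"
    then have "openin (subtopology fell_topology X) ({C. closed C \<and> C \<inter> U \<noteq> {}} \<inter> X)"
      by (intro openin_subtopology_Int openin_fell_hit)
    moreover have "{C. closed C \<and> C \<inter> U \<noteq> {}} \<inter> X = {C\<in>X. C \<inter> U \<noteq> {}}" using X by auto
    ultimately show "{C\<in>X. C \<inter> U \<noteq> {}} \<in> sigma_sets X {U. openin (subtopology fell_topology X) U}"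
      by (intro sigma_sets.Basic) simp
  qed
  ultimately show ?thesis by blast
qed

lemma hit_in_fell_borel:
  fixes X :: "'a::second_countable_topology set set"
  assumes "X \<subseteq> {C. closed C}" "open U" shows "{C\<in>X. C \<inter> U \<noteq> {}} \<in> sets (fell_borel X)"
  unfolding sets_fell_borel[OF assms(1)] using assms(2) by (intro sigma_sets.Basic) auto

lemma measurable_fell_borelI:
  fixes Y :: "'a::second_countable_topology set set"
  assumes "Y \<subseteq> {C. closed C}" "\<And>x. x \<in> space M \<Longrightarrow> f x \<in> Y"
    and "\<And>U. open U \<Longrightarrow> {x\<in>space M. f x \<inter> U \<noteq> {}} \<in> sets M"
  shows "f \<in> measurable M (fell_borel Y)"
proof (rule measurable_sigma_sets[OF sets_fell_borel[OF assms(1)]])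
  show "f \<in> space M \<rightarrow> Y" using assms(2) by auto
  fix y assume "y \<in> {{C \<in> Y. C \<inter> U \<noteq> {}} |U. open U}"
  then obtain U where U: "open U" "y = {C \<in> Y. C \<inter> U \<noteq> {}}" by auto
  have "f -` y \<inter> space M = {x\<in>space M. f x \<inter> U \<noteq> {}}" using U(2) assms(2) by auto
  then show "f -` y \<inter> space M \<in> sets M" using assms(3)[OF U(1)] by simp
qed auto

text \<open>
  If \<open>\<phi> (g, x)\<close> lies in \<open>U\<close>, then it does so for all points of a product of basic neighbourhoods
  of \<open>g\<close> and \<open>x\<close>. Hence the set in question is a countable union of rectangles.
\<close>

lemma measurable_hit_continuous_image:
  fixes \<phi> :: "'b::second_countable_topology \<times> 'a::second_countable_topology \<Rightarrow> 'c::topological_space"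
  assumes X: "X \<subseteq> {C. closed C}" and \<phi>: "continuous_on UNIV \<phi>" and U: "open U"
  shows "{p\<in>space (fell_borel X \<Otimes>\<^sub>M borel). \<exists>x\<in>fst p. \<phi> (snd p, x) \<in> U} \<in> sets (fell_borel X \<Otimes>\<^sub>M borel)"
proof -
  obtain \<A> :: "'b set set" where \<A>: "countable \<A>" "topological_basis \<A>"
    using ex_countable_basis by blast
  obtain \<B> :: "'a set set" where \<B>: "countable \<B>" "topological_basis \<B>"
    using ex_countable_basis by blast
  let ?I = "{(A, B)\<in>\<A> \<times> \<B>. \<phi> ` (A \<times> B) \<subseteq> U}"
  let ?R = "\<Union>(A, B)\<in>?I. {C\<in>X. C \<inter> B \<noteq> {}} \<times> A"
  have "countable ?I" using \<A>(1) \<B>(1) by (intro countable_subset[of ?I "\<A> \<times> \<B>"]) auto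
  moreover have "{C\<in>X. C \<inter> B \<noteq> {}} \<times> A \<in> sets (fell_borel X \<Otimes>\<^sub>M borel)" if "(A, B) \<in> ?I" for A B
    using that \<A>(2) \<B>(2)
    by (intro pair_measureI hit_in_fell_borel X borel_open) (auto intro: topological_basis_open)
  ultimately have "?R \<in> sets (fell_borel X \<Otimes>\<^sub>M borel)" by (intro sets.countable_UN') auto
  moreover have "{p\<in>space (fell_borel X \<Otimes>\<^sub>M borel). \<exists>x\<in>fst p. \<phi> (snd p, x) \<in> U} = ?R"
  proof (intro equalityI subsetI)
    fix p assume "p \<in> {p\<in>space (fell_borel X \<Otimes>\<^sub>M (borel :: 'b measure)). \<exists>x\<in>fst p. \<phi> (snd p, x) \<in> U}"
    then obtain C g x where p: "p = (C, g)" "C \<in> X" "x \<in> C" "\<phi> (g, x) \<in> U"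
      using X by (cases p) (auto simp: space_pair_measure)
    obtain P Q where PQ: "open P" "open Q" "g \<in> P" "x \<in> Q" "\<And>x y. x \<in> P \<Longrightarrow> y \<in> Q \<Longrightarrow> \<phi> (x, y) \<in> U"
      by (rule open_nbhd_op[OF \<phi> U p(4)]) (rule that)
    obtain A where A: "A \<in> \<A>" "g \<in> A" "A \<subseteq> P" using topological_basisE[OF \<A>(2) PQ(1,3)] by metis
    obtain B where B: "B \<in> \<B>" "x \<in> B" "B \<subseteq> Q" using topological_basisE[OF \<B>(2) PQ(2,4)] by metis
    have "(A, B) \<in> ?I" using A B PQ(5) by auto
    moreover have "p \<in> {C\<in>X. C \<inter> B \<noteq> {}} \<times> A" using p A B by auto
    ultimately show "p \<in> ?R" by blast
  next
    fix p assume "p \<in> ?R"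
    then obtain A B where AB: "(A, B) \<in> ?I" "p \<in> {C\<in>X. C \<inter> B \<noteq> {}} \<times> A" by auto
    then obtain x where "x \<in> fst p" "x \<in> B" "snd p \<in> A" "fst p \<in> X" by auto
    then show "p \<in> {p\<in>space (fell_borel X \<Otimes>\<^sub>M (borel :: 'b measure)). \<exists>x\<in>fst p. \<phi> (snd p, x) \<in> U}"
      using AB(1) X by (cases p) (auto simp: space_pair_measure intro!: bexI[of _ x])
  qed
  ultimately show ?thesis by simp
qed

section \<open>The spaces of closed subgroups and of their cosets\<close>

abbreviation sub_borel :: "'a::topological_group_add set measure" where
  "sub_borel \<equiv> borel_of Sub_topology"

abbreviation cos_borel :: "'a::topological_group_add set measure" where
  "cos_borel \<equiv> borel_of Cos_topology"

text \<open>
  For a left coset \<open>C\<close> of a subgroup this is the subgroup, that is \<open>C\<^sup>-\<^sup>1C\<close> in multiplicative notation.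
\<close>

definition differences :: "'a::group_add set \<Rightarrow> 'a set" where
  "differences C = (\<lambda>(x, y). - x + y) ` (C \<times> C)"

lemma left_translate_0 [simp]: "left_translate 0 (C :: 'a::group_add set) = C"
  by (simp add: left_translate_def)

lemma left_translate_left_translate:
  "left_translate g (left_translate h C) = left_translate (g + h) (C :: 'a::group_add set)"
  by (simp add: left_translate_def image_image add.assoc)

lemma mem_left_translate: "x \<in> left_translate g C \<longleftrightarrow> - g + x \<in> (C :: 'a::group_add set)"
  unfolding left_translate_def by (rule mem_translate)

lemma differences_left_translate [simp]:
  "differences (left_translate g C) = differences (C :: 'a::group_add set)"
proof -
  have "- (g + x) + (g + y) = - x + y" for x y :: 'a by (simp only: minus_add add.assoc minus_add_cancel)
  then have "(\<lambda>p. - (g + fst p) + (g + snd p)) ` (C \<times> C) = (\<lambda>p. - fst p + snd p) ` (C \<times> C)" by simp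
  moreover have "left_translate g C \<times> left_translate g C = map_prod ((+) g) ((+) g) ` (C \<times> C)"
    by (force simp: left_translate_def)
  ultimately show ?thesis unfolding differences_def by (simp add: image_image case_prod_beta)
qed

lemma differences_subgroup:
  assumes H: "H \<in> closed_subgroups" shows "differences H = H"
proof (intro equalityI subsetI)
  show "x \<in> H" if "x \<in> differences H" for x
    using that closed_subgroupsD(3,4)[OF H] by (auto simp: differences_def)
  show "x \<in> differences H" if "x \<in> H" for x
    unfolding differences_def using that closed_subgroupsD(2)[OF H] by (intro image_eqI[of _ _ "(0, x)"]) auto
qed

lemma compact_differences:
  fixes T :: "'a::topological_group_add set"
  assumes "compact T" shows "compact (differences T)"
  unfolding differences_def case_prod_beta using assms
  by (intro compact_continuous_image compact_Times continuous_intros)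

lemma closed_subgroup_cosetsE:
  assumes "C \<in> closed_subgroup_cosets"
  obtains g H where "H \<in> closed_subgroups" "C = left_translate g H"
  using assms by (auto simp: closed_subgroup_cosets_def left_cosets_def)

lemma left_translate_in_cosets:
  "H \<in> closed_subgroups \<Longrightarrow> left_translate g H \<in> closed_subgroup_cosets"
  by (auto simp: closed_subgroup_cosets_def left_cosets_def)

lemma left_translate_coset_in_cosets:
  "C \<in> closed_subgroup_cosets \<Longrightarrow> left_translate g C \<in> closed_subgroup_cosets"
  by (metis closed_subgroup_cosetsE left_translate_in_cosets left_translate_left_translate)

lemma coset_eq_translate_differences:
  assumes "C \<in> closed_subgroup_cosets" "c \<in> C"
  shows "C = left_translate c (differences C)" "differences C \<in> closed_subgroups"
proof -
  obtain g H where H: "H \<in> closed_subgroups" "C = left_translate g H"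
    by (rule closed_subgroup_cosetsE[OF assms(1)]) (rule that)
  then have D: "differences C = H" by (simp add: differences_subgroup)
  then show "differences C \<in> closed_subgroups" using H by simp
  have c: "- g + c \<in> H" using assms(2) H(2) by (simp add: mem_left_translate)
  have "x \<in> left_translate g H \<longleftrightarrow> x \<in> left_translate c H" for x
  proof -
    have "- c + x = - (- g + c) + (- g + x)" by (simp only: minus_add add.assoc minus_minus add_minus_cancel)
    moreover have "- g + x = (- g + c) + (- c + x)" by (simp only: add.assoc add_minus_cancel)
    ultimately show ?thesis
      using c closed_subgroupsD(3,4)[OF H(1)] unfolding mem_left_translate by metis
  qed
  then show "C = left_translate c (differences C)" using D H(2) by blast
qed

lemma closed_subgroups_closed: "closed_subgroups \<subseteq> {C. closed C}"
  by (auto simp: closed_subgroups_def)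

lemma closed_left_translate:
  fixes C :: "'a::topological_group_add set"
  assumes "closed C" shows "closed (left_translate g C)"
proof -
  have "left_translate g C = {x. - g + x \<in> C}" by (auto simp: mem_left_translate)
  then show ?thesis using assms by (auto intro!: closed_vimage_continuous continuous_intros)
qed

lemma cosets_closed: "closed_subgroup_cosets \<subseteq> {C. closed C}"
  using closed_subgroups_closed by (auto elim!: closed_subgroup_cosetsE intro!: closed_left_translate)

lemma space_sub_borel [simp]: "space sub_borel = closed_subgroups"
  unfolding Sub_topology_def by (rule space_fell_borel[OF closed_subgroups_closed])

lemma space_cos_borel [simp]: "space cos_borel = closed_subgroup_cosets"
  unfolding Cos_topology_def by (rule space_fell_borel[OF cosets_closed])

lemma UNIV_closed_subgroup: "UNIV \<in> closed_subgroups"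
  by (simp add: closed_subgroups_def)

lemma conjugate_in_closed_subgroups:
  fixes H :: "'a::topological_group_add set"
  assumes H: "H \<in> closed_subgroups" shows "conjugate g H \<in> closed_subgroups"
proof -
  have mem: "x \<in> conjugate g H \<longleftrightarrow> - g + x + g \<in> H" for x
  proof
    assume "x \<in> conjugate g H"
    then obtain h where "h \<in> H" "x = g + h - g" by (auto simp: conjugate_def)
    then have "- g + x + g = h"
      by (simp only: diff_conv_add_uminus add.assoc minus_add_cancel left_minus add_0_right)
    then show "- g + x + g \<in> H" using \<open>h \<in> H\<close> by simp
  next
    assume "- g + x + g \<in> H"
    moreover have "x = g + (- g + x + g) - g"
      by (simp only: diff_conv_add_uminus add.assoc add_minus_cancel right_minus add_0_right)
    ultimately show "x \<in> conjugate g H" unfolding conjugate_def by (rule image_eqI[rotated])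
  qed
  have "closed {x. - g + x + g \<in> H}"
    using closed_subgroupsD(1)[OF H] by (intro closed_vimage_continuous continuous_intros)
  moreover have "conjugate g H = {x. - g + x + g \<in> H}" using mem by auto
  moreover have "- g + (x + y) + g = (- g + x + g) + (- g + y + g)" for x y
    by (simp only: add.assoc add_minus_cancel)
  moreover have "- g + - x + g = - (- g + x + g)" for x
    by (simp only: minus_add add.assoc minus_minus)
  ultimately show ?thesis
    using closed_subgroupsD(2-4)[OF H] by (simp add: closed_subgroups_def)
qed

lemma conjugate_conjugate:
  "conjugate g (conjugate h H) = conjugate (g + h) (H :: 'a::group_add set)"
proof -
  have "g + (h + x - h) - g = (g + h) + x - (g + h)" for x
    by (simp only: diff_conv_add_uminus minus_add add.assoc)
  then show ?thesis unfolding conjugate_def image_image by simp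
qed

lemma right_coset_eq:
  "left_translate g (conjugate (- g) K) = (\<lambda>x. x + g) ` (K :: 'a::group_add set)"
proof -
  have "g + (- g + x - - g) = x + g" for x
    by (simp only: diff_conv_add_uminus minus_minus add.assoc add_minus_cancel)
  then show ?thesis unfolding left_translate_def conjugate_def image_image by simp
qed

lemma conjugate_by_member:
  assumes K: "K \<in> closed_subgroups" and k: "k \<in> K" shows "conjugate (- k) K = K"
proof -
  have sub: "conjugate x K \<subseteq> K" if "x \<in> K" for x
    using that closed_subgroupsD(3,4)[OF K] by (auto simp: conjugate_def diff_conv_add_uminus simp del: add_uminus_conv_diff)
  have "conjugate k (conjugate (- k) K) = conjugate 0 K" "conjugate (- k) (conjugate k K) = conjugate 0 K"
    by (simp_all add: conjugate_conjugate)
  moreover have "conjugate 0 K = K" by (simp add: conjugate_def)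
  moreover have "conjugate (- k) (conjugate k K) \<subseteq> conjugate (- k) K"
    using sub[OF k] unfolding conjugate_def by (rule image_mono)
  ultimately show ?thesis using sub[OF closed_subgroupsD(4)[OF K k]] by simp
qed

lemma measurable_cos_borelI:
  fixes f :: "'b \<Rightarrow> 'a::{topological_group_add,t2_space,second_countable_topology} set"
  assumes "\<And>x. x \<in> space M \<Longrightarrow> f x \<in> closed_subgroup_cosets"
    and "\<And>U. open U \<Longrightarrow> {x\<in>space M. f x \<inter> U \<noteq> {}} \<in> sets M"
  shows "f \<in> measurable M cos_borel"
  unfolding Cos_topology_def by (rule measurable_fell_borelI[OF cosets_closed assms])

lemma measurable_sub_borelI:
  fixes f :: "'b \<Rightarrow> 'a::{topological_group_add,t2_space,second_countable_topology} set"
  assumes "\<And>x. x \<in> space M \<Longrightarrow> f x \<in> closed_subgroups"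
    and "\<And>U. open U \<Longrightarrow> {x\<in>space M. f x \<inter> U \<noteq> {}} \<in> sets M"
  shows "f \<in> measurable M sub_borel"
  unfolding Sub_topology_def by (rule measurable_fell_borelI[OF closed_subgroups_closed assms])

lemma measurable_hit_cos:
  fixes \<phi> :: "'b::second_countable_topology \<times> 'a::{topological_group_add,t2_space,second_countable_topology} \<Rightarrow> 'c::topological_space"
  assumes "continuous_on UNIV \<phi>" "open U"
  shows "{p\<in>space (cos_borel \<Otimes>\<^sub>M borel). \<exists>x\<in>fst p. \<phi> (snd p, x) \<in> U} \<in> sets (cos_borel \<Otimes>\<^sub>M borel)"
  unfolding Cos_topology_def by (rule measurable_hit_continuous_image[OF cosets_closed assms])

lemma measurable_hit_sub:
  fixes \<phi> :: "'b::second_countable_topology \<times> 'a::{topological_group_add,t2_space,second_countable_topology} \<Rightarrow> 'c::topological_space"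
  assumes "continuous_on UNIV \<phi>" "open U"
  shows "{p\<in>space (sub_borel \<Otimes>\<^sub>M borel). \<exists>x\<in>fst p. \<phi> (snd p, x) \<in> U} \<in> sets (sub_borel \<Otimes>\<^sub>M borel)"
  unfolding Sub_topology_def by (rule measurable_hit_continuous_image[OF closed_subgroups_closed assms])

lemma image_hit_iff: "f ` C \<inter> U \<noteq> {} \<longleftrightarrow> (\<exists>x\<in>C. f x \<in> U)"
  by auto

lemma continuous_add_pair: "continuous_on UNIV (\<lambda>p::'a::topological_group_add\<times>'a. fst p + snd p)"
  by (intro continuous_intros)

lemma measurable_left_translate_sub:
  "(\<lambda>(H, g::'a::{topological_group_add,t2_space,second_countable_topology}). left_translate g H) \<in> measurable (sub_borel \<Otimes>\<^sub>M borel) cos_borel"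
proof (rule measurable_cos_borelI)
  show "(case p of (H, g) \<Rightarrow> left_translate g H) \<in> closed_subgroup_cosets"
    if "p \<in> space (sub_borel \<Otimes>\<^sub>M (borel :: 'a measure))" for p :: "'a set \<times> 'a"
    using that by (auto simp: space_pair_measure left_translate_in_cosets)
  fix U :: "'a set" assume U: "open U"
  show "{p \<in> space (sub_borel \<Otimes>\<^sub>M (borel :: 'a measure)). (case p of (H, g) \<Rightarrow> left_translate g H) \<inter> U \<noteq> {}}
      \<in> sets (sub_borel \<Otimes>\<^sub>M borel)"
    using measurable_hit_sub[OF continuous_add_pair U]
    by (simp add: left_translate_def image_hit_iff case_prod_beta)
qed

lemma measurable_left_translate_cos:
  "(\<lambda>(C, g::'a::{topological_group_add,t2_space,second_countable_topology}). left_translate g C) \<in> measurable (cos_borel \<Otimes>\<^sub>M borel) cos_borel"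
proof (rule measurable_cos_borelI)
  show "(case p of (H, g) \<Rightarrow> left_translate g H) \<in> closed_subgroup_cosets"
    if "p \<in> space (cos_borel \<Otimes>\<^sub>M (borel :: 'a measure))" for p :: "'a set \<times> 'a"
    using that by (auto simp: space_pair_measure left_translate_coset_in_cosets)
  fix U :: "'a set" assume U: "open U"
  show "{p \<in> space (cos_borel \<Otimes>\<^sub>M (borel :: 'a measure)). (case p of (H, g) \<Rightarrow> left_translate g H) \<inter> U \<noteq> {}}
      \<in> sets (cos_borel \<Otimes>\<^sub>M borel)"
    using measurable_hit_cos[OF continuous_add_pair U]
    by (simp add: left_translate_def image_hit_iff case_prod_beta)
qed

lemma left_translate_measurable:
  "left_translate (k :: 'a::{topological_group_add,t2_space,second_countable_topology}) \<in> measurable cos_borel cos_borel"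
  using measurable_compose[OF measurable_Pair[OF measurable_ident measurable_const[of k borel]] measurable_left_translate_cos]
  by simp

lemma measurable_conjugate:
  "(\<lambda>(H, g::'a::{topological_group_add,t2_space,second_countable_topology}). conjugate g H) \<in> measurable (sub_borel \<Otimes>\<^sub>M borel) sub_borel"
proof (rule measurable_sub_borelI)
  show "(case p of (H, g) \<Rightarrow> conjugate g H) \<in> closed_subgroups"
    if "p \<in> space (sub_borel \<Otimes>\<^sub>M (borel :: 'a measure))" for p :: "'a set \<times> 'a"
    using that by (auto simp: space_pair_measure conjugate_in_closed_subgroups)
  fix U :: "'a set" assume U: "open U"
  have c: "continuous_on UNIV (\<lambda>p::'a\<times>'a. fst p + snd p - fst p)"
    by (intro continuous_intros)
  show "{p \<in> space (sub_borel \<Otimes>\<^sub>M (borel :: 'a measure)). (case p of (H, g) \<Rightarrow> conjugate g H) \<inter> U \<noteq> {}}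
      \<in> sets (sub_borel \<Otimes>\<^sub>M borel)"
    using measurable_hit_sub[OF c U]
    by (simp add: conjugate_def image_hit_iff case_prod_beta)
qed

lemma measurable_left_translate_comp [measurable (raw)]:
  fixes H :: "'b \<Rightarrow> 'a::{topological_group_add,t2_space,second_countable_topology} set"
  assumes "H \<in> measurable M sub_borel" "g \<in> measurable M borel"
  shows "(\<lambda>x. left_translate (g x) (H x)) \<in> measurable M cos_borel"
  using measurable_compose[OF measurable_Pair[OF assms] measurable_left_translate_sub] by simp

lemma measurable_conjugate_comp [measurable (raw)]:
  fixes H :: "'b \<Rightarrow> 'a::{topological_group_add,t2_space,second_countable_topology} set"
  assumes "H \<in> measurable M sub_borel" "g \<in> measurable M borel"
  shows "(\<lambda>x. conjugate (g x) (H x)) \<in> measurable M sub_borel"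
  using measurable_compose[OF measurable_Pair[OF assms] measurable_conjugate] by simp

lemma measurable_differences:
  "differences \<in> measurable cos_borel (cos_borel :: 'a::{topological_group_add,t2_space,second_countable_topology} set measure)"
proof (rule measurable_cos_borelI)
  show "differences C \<in> closed_subgroup_cosets" if "C \<in> space (cos_borel :: 'a set measure)" for C :: "'a set"
  proof -
    have C: "C \<in> closed_subgroup_cosets" using that by simp
    then obtain g H where "H \<in> closed_subgroups" "C = left_translate g H" by (rule closed_subgroup_cosetsE)
    then show ?thesis using left_translate_in_cosets[of H 0] by (simp add: differences_subgroup)
  qed
  fix U :: "'a set" assume U: "open U"
  have c: "continuous_on UNIV (\<lambda>p::'a\<times>'a. - fst p + snd p)"
    by (intro continuous_intros)
  obtain \<B> :: "'a set set" where \<B>: "countable \<B>" "topological_basis \<B>"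
    using ex_countable_basis by blast
  let ?I = "{(A, B)\<in>\<B> \<times> \<B>. \<forall>x\<in>A. \<forall>y\<in>B. - x + y \<in> U}"
  let ?hit = "\<lambda>A. {C\<in>closed_subgroup_cosets. C \<inter> A \<noteq> {}} :: 'a set set"
  have "countable ?I" using \<B>(1) by (intro countable_subset[of ?I "\<B> \<times> \<B>"]) auto
  moreover have "?hit A \<in> sets cos_borel" if "A \<in> \<B>" for A
    unfolding Cos_topology_def using that \<B>(2)
    by (intro hit_in_fell_borel cosets_closed) (auto intro: topological_basis_open)
  ultimately have "(\<Union>(A, B)\<in>?I. ?hit A \<inter> ?hit B) \<in> sets cos_borel"
    by (intro sets.countable_UN') auto
  moreover have "{C \<in> space cos_borel. differences C \<inter> U \<noteq> {}} = (\<Union>(A, B)\<in>?I. ?hit A \<inter> ?hit B)"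
  proof (intro equalityI subsetI)
    fix C assume "C \<in> {C \<in> space cos_borel. differences C \<inter> U \<noteq> {}}"
    then obtain x y where C: "C \<in> closed_subgroup_cosets" "x \<in> C" "y \<in> C" "- x + y \<in> U"
      by (auto simp: differences_def)
    obtain P Q where PQ: "open P" "open Q" "x \<in> P" "y \<in> Q" "\<And>x y. x \<in> P \<Longrightarrow> y \<in> Q \<Longrightarrow> - x + y \<in> U"
      using open_nbhd_op[OF c U, of x y] C(4) by auto
    obtain A where A: "A \<in> \<B>" "x \<in> A" "A \<subseteq> P" using topological_basisE[OF \<B>(2) PQ(1,3)] by metis
    obtain B where B: "B \<in> \<B>" "y \<in> B" "B \<subseteq> Q" using topological_basisE[OF \<B>(2) PQ(2,4)] by metis
    have "(A, B) \<in> ?I" using A B PQ(5) by auto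
    moreover have "C \<in> ?hit A \<inter> ?hit B" using C A B by auto
    ultimately show "C \<in> (\<Union>(A, B)\<in>?I. ?hit A \<inter> ?hit B)" by blast
  next
    fix C assume "C \<in> (\<Union>(A, B)\<in>?I. ?hit A \<inter> ?hit B)"
    then obtain A B where AB: "(A, B) \<in> ?I" "C \<in> ?hit A" "C \<in> ?hit B" by auto
    then obtain x y where "x \<in> C" "x \<in> A" "y \<in> C" "y \<in> B" by auto
    then have "- x + y \<in> differences C" "- x + y \<in> U" using AB(1) by (auto simp: differences_def)
    then show "C \<in> {C \<in> space cos_borel. differences C \<inter> U \<noteq> {}}" using AB(2) by auto
  qed
  ultimately show "{C \<in> space cos_borel. differences C \<inter> U \<noteq> {}} \<in> sets cos_borel" by simp
qed

lemma measurable_thickening_cos: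
  fixes V :: "'a::{topological_group_add,t2_space,second_countable_topology} set"
  assumes "open V"
  shows "{p\<in>space (cos_borel \<Otimes>\<^sub>M borel). \<exists>c\<in>fst p. - c + snd p \<in> V} \<in> sets (cos_borel \<Otimes>\<^sub>M borel)"
proof -
  have c: "continuous_on UNIV (\<lambda>p::'a\<times>'a. - snd p + fst p)"
    by (intro continuous_intros)
  show ?thesis using measurable_hit_cos[OF c assms] by simp
qed

text \<open>
  A closed set is determined by the members of a countable basis that it hits.
\<close>

lemma measurable_singleton_cos:
  assumes "H \<in> closed_subgroup_cosets" shows "{H} \<in> sets (cos_borel :: 'a::{topological_group_add,t2_space,second_countable_topology} set measure)"
proof -
  obtain \<B> :: "'a set set" where \<B>: "countable \<B>" "topological_basis \<B>"
    using ex_countable_basis by blast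
  let ?E = "\<lambda>B. if H \<inter> B \<noteq> {} then {C\<in>closed_subgroup_cosets. C \<inter> B \<noteq> {}}
    else closed_subgroup_cosets - {C\<in>closed_subgroup_cosets. C \<inter> B \<noteq> {}}"
  have hit: "{C\<in>closed_subgroup_cosets. C \<inter> B \<noteq> {}} \<in> sets cos_borel" if "B \<in> \<B>" for B
    unfolding Cos_topology_def using that \<B>(2)
    by (intro hit_in_fell_borel cosets_closed) (auto intro: topological_basis_open)
  then have "closed_subgroup_cosets - {C\<in>closed_subgroup_cosets. C \<inter> B \<noteq> {}} \<in> sets cos_borel" if "B \<in> \<B>" for B
    using sets.compl_sets[OF hit[OF that]] by simp
  then have E: "?E B \<in> sets cos_borel" if "B \<in> \<B>" for B using hit that by auto
  have "\<B> \<noteq> {}" using topological_basisE[OF \<B>(2) open_UNIV UNIV_I] by blast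
  then have "(\<Inter>B\<in>\<B>. ?E B) \<in> sets cos_borel" by (intro sets.countable_INT' image_subsetI E \<B>(1) \<open>\<B> \<noteq> {}\<close>)
  moreover have "(\<Inter>B\<in>\<B>. ?E B) = {H}"
  proof (intro equalityI subsetI)
    fix C assume C: "C \<in> (\<Inter>B\<in>\<B>. ?E B)"
    obtain B where "B \<in> \<B>" using \<open>\<B> \<noteq> {}\<close> by blast
    then have "C \<in> ?E B" using C by blast
    then have "C \<in> closed_subgroup_cosets" by (cases "H \<inter> B = {}") auto
    have iff: "C \<inter> B \<noteq> {} \<longleftrightarrow> H \<inter> B \<noteq> {}" if "B \<in> \<B>" for B
    proof -
      have "C \<in> ?E B" using C that by blast
      then show ?thesis by (cases "H \<inter> B = {}") auto
    qed
    have sub: "A \<subseteq> A'" if A: "closed A'" "\<And>B. B \<in> \<B> \<Longrightarrow> A \<inter> B \<noteq> {} \<Longrightarrow> A' \<inter> B \<noteq> {}" for A A'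
    proof (rule ccontr)
      assume "\<not> A \<subseteq> A'"
      then obtain x where "x \<in> A" "x \<in> - A'" by blast
      moreover obtain B where "B \<in> \<B>" "x \<in> B" "B \<subseteq> - A'"
        using topological_basisE[OF \<B>(2), of "- A'" x] A(1) \<open>x \<in> - A'\<close> by (metis open_Compl)
      ultimately show False using A(2)[of B] by blast
    qed
    have "C = H" using sub[of H C] sub[of C H] iff \<open>C \<in> closed_subgroup_cosets\<close> assms cosets_closed by blast
    then show "C \<in> {H}" by simp
  qed (use assms in auto)
  ultimately show ?thesis by simp
qed

text \<open>
  Hitting \<open>U\<close> means hitting some basic open subset of \<open>U\<close>. Countability lets a null set be
  discarded for every generator.
\<close>

lemma countable_generator_cos_borel:
  obtains \<H> :: "'a::{topological_group_add,t2_space,second_countable_topology} set set set"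
  where "countable \<H>" "\<H> \<subseteq> sets cos_borel" "sets (cos_borel :: 'a set measure) = sigma_sets closed_subgroup_cosets \<H>"
proof -
  obtain \<B> :: "'a set set" where \<B>: "countable \<B>" "topological_basis \<B>" using ex_countable_basis by blast
  let ?hit = "\<lambda>U. {C\<in>closed_subgroup_cosets. C \<inter> U \<noteq> {}} :: 'a set set"
  let ?\<H> = "?hit ` \<B>"
  let ?X = "closed_subgroup_cosets :: 'a set set"
  have eq: "sets (cos_borel :: 'a set measure) = sigma_sets ?X {?hit U |U. open U}"
    unfolding Cos_topology_def by (rule sets_fell_borel[OF cosets_closed])
  have sub: "?\<H> \<subseteq> {?hit U |U. open U}" using topological_basis_open[OF \<B>(2)] by blast
  interpret S: sigma_algebra ?X "sigma_sets ?X ?\<H>" by (rule sigma_algebra_sigma_sets) auto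
  have "?hit U \<in> sigma_sets ?X ?\<H>" if U: "open U" for U
  proof -
    have "(\<Union>B\<in>{B\<in>\<B>. B \<subseteq> U}. ?hit B) \<in> sigma_sets ?X ?\<H>"
    proof (rule S.countable_UN'')
      show "countable {B\<in>\<B>. B \<subseteq> U}" using \<B>(1) by (rule countable_subset[rotated]) auto
      show "?hit B \<in> sigma_sets ?X ?\<H>" if "B \<in> {B\<in>\<B>. B \<subseteq> U}" for B using that by (intro sigma_sets.Basic) auto
    qed
    moreover have "?hit U = (\<Union>B\<in>{B\<in>\<B>. B \<subseteq> U}. ?hit B)"
    proof (intro equalityI subsetI)
      fix C assume "C \<in> ?hit U"
      then obtain x where C: "C \<in> ?X" "x \<in> C" "x \<in> U" by auto
      obtain B where "B \<in> \<B>" "x \<in> B" "B \<subseteq> U" by (rule topological_basisE[OF \<B>(2) U C(3)]) (rule that)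
      then show "C \<in> (\<Union>B\<in>{B\<in>\<B>. B \<subseteq> U}. ?hit B)" using C by auto
    qed auto
    ultimately show ?thesis by simp
  qed
  then have "sigma_sets ?X {?hit U |U. open U} \<subseteq> sigma_sets ?X ?\<H>"
    by (intro S.sigma_sets_subset) auto
  moreover have "sigma_sets ?X ?\<H> \<subseteq> sigma_sets ?X {?hit U |U. open U}" by (rule sigma_sets_mono'[OF sub])
  ultimately have gen: "sets (cos_borel :: 'a set measure) = sigma_sets ?X ?\<H>" unfolding eq by (rule equalityI)
  have "?\<H> \<subseteq> sets (cos_borel :: 'a set measure)"
    unfolding eq by (rule subset_trans[OF sub sigma_sets_superset_generator])
  with \<B>(1) show ?thesis by (intro that[of ?\<H>] gen countable_image)
qed

section \<open>Integration against Haar measures and uniqueness\<close>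

lemma group_minus_measurable [measurable (raw)]:
  fixes f :: "'b \<Rightarrow> 'a::{topological_group_add,second_countable_topology}"
  assumes "f \<in> borel_measurable M" shows "(\<lambda>x. - f x) \<in> borel_measurable M"
  by (rule borel_measurable_continuous_on[OF _ assms]) (intro continuous_intros)

lemma group_diff_measurable [measurable (raw)]:
  fixes f g :: "'b \<Rightarrow> 'a::{topological_group_add,second_countable_topology}"
  assumes [measurable]: "f \<in> borel_measurable M" "g \<in> borel_measurable M"
  shows "(\<lambda>x. f x - g x) \<in> borel_measurable M"
  unfolding diff_conv_add_uminus by measurable

lemma haar_measure_onD:
  assumes "haar_measure_on H M"
  shows "sets M = sets borel" "space M = UNIV" "emeasure M (- H) = 0"
    "\<And>h. h \<in> H \<Longrightarrow> distr M borel ((+) h) = M"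
    "\<And>K. compact K \<Longrightarrow> emeasure M K < \<infinity>"
    "\<And>U. open U \<Longrightarrow> 0 \<in> U \<Longrightarrow> 0 < emeasure M U"
  using assms sets_eq_imp_space_eq[of M borel] unfolding haar_measure_on_def by auto

lemma haar_AE_mem:
  assumes "haar_measure_on H M" "closed H" shows "AE x in M. x \<in> H"
  using haar_measure_onD(1,2,3)[OF assms(1)] assms(2)
  by (intro AE_I[of _ _ "- H"]) auto

lemma sigma_compact:
  assumes "locally_compact_space (euclidean :: 'a::{t2_space,second_countable_topology} topology)"
  obtains \<K> :: "'a::{t2_space,second_countable_topology} set set" where "countable \<K>" "\<And>K. K \<in> \<K> \<Longrightarrow> compact K" "\<Union>\<K> = UNIV"
proof -
  let ?F = "{V :: 'a set. open V \<and> (\<exists>K. compact K \<and> V \<subseteq> K)}"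
  have op: "open V" if "V \<in> ?F" for V using that by auto
  obtain F' where F': "F' \<subseteq> ?F" "countable F'" "\<Union>F' = \<Union>?F"
    by (rule Lindelof[OF op]) (assumption | rule that)+
  have "x \<in> \<Union>?F" for x
  proof -
    obtain V K where "open V" "compact K" "x \<in> V" "V \<subseteq> K" by (rule locally_compact_nhd[OF assms]) (rule that)
    then show ?thesis by auto
  qed
  then have UN: "\<Union>F' = UNIV" using F'(3) by blast
  have "\<forall>V\<in>F'. \<exists>K. compact K \<and> V \<subseteq> K" using F'(1) by auto
  then obtain k where k: "\<forall>V\<in>F'. compact (k V) \<and> V \<subseteq> k V" by (rule bchoice[THEN exE])
  have "x \<in> \<Union>(k ` F')" for x
  proof -
    have "x \<in> \<Union>F'" by (simp add: UN)
    then obtain V where V: "V \<in> F'" "x \<in> V" by (rule UnionE)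
    then have "x \<in> k V" using k by auto
    then show ?thesis using V(1) by auto
  qed
  then have cover: "\<Union>(k ` F') = UNIV" by (simp add: set_eq_iff)
  have "compact K" if "K \<in> k ` F'" for K using that k by auto
  moreover have "countable (k ` F')" using F'(2) by (rule countable_image)
  ultimately show ?thesis using that cover by simp
qed

lemma haar_sigma_finite:
  fixes H :: "'a::{topological_group_add,t2_space,second_countable_topology} set"
  assumes lc: "locally_compact_space (euclidean :: 'a topology)" and M: "haar_measure_on H M"
  shows "sigma_finite_measure M"
proof -
  obtain \<K> :: "'a set set" where K: "countable \<K>" "\<And>K. K \<in> \<K> \<Longrightarrow> compact K" "\<Union>\<K> = UNIV"
    by (rule sigma_compact[OF lc]) (rule that)
  show ?thesis
  proof
    show "\<exists>A. countable A \<and> A \<subseteq> sets M \<and> \<Union> A = space M \<and> (\<forall>a\<in>A. emeasure M a \<noteq> \<infinity>)"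
      using K haar_measure_onD(1,2)[OF M] haar_measure_onD(5)[OF M]
      by (intro exI[of _ \<K>]) (auto simp: less_top[symmetric] compact_imp_closed)
  qed
qed

lemma nn_integral_translate:
  fixes f :: "'a::{topological_group_add,second_countable_topology} \<Rightarrow> ennreal"
  assumes "distr M borel ((+) h) = M" "sets M = sets borel" and [measurable]: "f \<in> borel_measurable borel"
  shows "(\<integral>\<^sup>+x. f (h + x) \<partial>M) = (\<integral>\<^sup>+x. f x \<partial>M)"
proof -
  have "(+) h \<in> borel_measurable borel" by measurable
  then have "(+) h \<in> borel_measurable M" using assms(2) by (simp cong: measurable_cong_sets)
  then have "(\<integral>\<^sup>+x. f x \<partial>distr M borel ((+) h)) = (\<integral>\<^sup>+x. f (h + x) \<partial>M)"
    by (intro nn_integral_distr) auto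
  then show ?thesis using assms(1) by simp
qed

lemma haar_open_pos:
  fixes H :: "'a::{topological_group_add,t2_space,second_countable_topology} set"
  assumes H: "H \<in> closed_subgroups" and M: "haar_measure_on H M" and U: "open U" and x: "x \<in> H" "x \<in> U"
  shows "0 < emeasure M U"
proof -
  have inv: "distr M borel ((+) x) = M" using haar_measure_onD(4)[OF M x(1)] .
  have m: "(+) x \<in> measurable M borel"
    using haar_measure_onD(1)[OF M] by (simp cong: measurable_cong_sets)
  have op: "open ((+) x -` U)" using U by (intro open_vimage continuous_intros)
  have "0 < emeasure M ((+) x -` U)"
    using haar_measure_onD(6)[OF M op] x(2) by simp
  also have "\<dots> = emeasure (distr M borel ((+) x)) U"
    using U m haar_measure_onD(2)[OF M] by (simp add: emeasure_distr)
  finally show ?thesis using inv by simp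
qed

lemma haar_integral_pos:
  fixes f :: "'a::topological_group_add \<Rightarrow> ennreal"
  assumes M: "haar_measure_on H M" and f: "f \<in> borel_measurable borel"
    and U: "open U" "0 \<in> U" and pos: "\<And>x. x \<in> U \<Longrightarrow> 0 < f x"
  shows "0 < (\<integral>\<^sup>+x. f x \<partial>M)"
proof (rule ccontr)
  assume "\<not> 0 < (\<integral>\<^sup>+x. f x \<partial>M)"
  then have "(\<integral>\<^sup>+x. f x \<partial>M) = 0" by simp
  moreover have "f \<in> borel_measurable M"
    using f haar_measure_onD(1)[OF M] by (simp cong: measurable_cong_sets)
  ultimately have "AE x in M. f x = 0" by (simp add: nn_integral_0_iff_AE)
  then have "AE x in M. x \<notin> U"
    by eventually_elim (use pos in force)
  then have "emeasure M U = 0"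
    using U haar_measure_onD(1,2)[OF M] AE_iff_measurable[of U M "\<lambda>x. x \<notin> U"] by auto
  then show False using haar_measure_onD(6)[OF M U] by simp
qed

lemma haar_measure_scale:
  fixes H :: "'a::{topological_group_add,second_countable_topology} set"
  assumes a: "haar_measure_on H \<alpha>" and r: "0 < r" "r < \<infinity>"
  shows "haar_measure_on H (scale_measure r \<alpha>)"
  unfolding haar_measure_on_def
proof (intro conjI ballI allI impI)
  show "sets (scale_measure r \<alpha>) = sets borel" using haar_measure_onD(1)[OF a] by simp
  show "emeasure (scale_measure r \<alpha>) (- H) = 0" using haar_measure_onD(3)[OF a] by simp
  show "emeasure (scale_measure r \<alpha>) K < \<infinity>" if "compact K" for K
    using haar_measure_onD(5)[OF a that] r by (simp add: ennreal_mult_less_top)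
  show "0 < emeasure (scale_measure r \<alpha>) U" if "open U" "0 \<in> U" for U
    using haar_measure_onD(6)[OF a that] r by (simp add: ennreal_zero_less_mult_iff)
  show "distr (scale_measure r \<alpha>) borel ((+) h) = scale_measure r \<alpha>" if h: "h \<in> H" for h
  proof (rule measure_eqI)
    fix E assume "E \<in> sets (distr (scale_measure r \<alpha>) borel ((+) h))"
    then have E: "E \<in> sets borel" by simp
    have m: "(+) h \<in> measurable \<alpha> borel" using haar_measure_onD(1)[OF a] by (simp cong: measurable_cong_sets)
    then have m': "(+) h \<in> measurable (scale_measure r \<alpha>) borel" by (simp cong: measurable_cong_sets)
    have "emeasure (distr (scale_measure r \<alpha>) borel ((+) h)) E = r * emeasure (distr \<alpha> borel ((+) h)) E"
      using E m m' by (simp add: emeasure_distr space_scale_measure)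
    then show "emeasure (distr (scale_measure r \<alpha>) borel ((+) h)) E = emeasure (scale_measure r \<alpha>) E"
      using haar_measure_onD(4)[OF a h] by simp
  qed (use haar_measure_onD(1)[OF a] in simp)
qed

lemma haar_integral_finite:
  fixes f :: "'a::{topological_group_add,t2_space,second_countable_topology} \<Rightarrow> real"
  assumes a: "haar_measure_on H \<alpha>"
    and f: "continuous_on UNIV f" and S: "compact S" "\<And>x. x \<notin> S \<Longrightarrow> f x = 0"
  shows "(\<integral>\<^sup>+x. f x \<partial>\<alpha>) < \<infinity>"
proof -
  have "bounded (f ` S)"
    using S(1) continuous_on_subset[OF f] by (intro compact_imp_bounded compact_continuous_image) auto
  then obtain M where M: "\<forall>x\<in>S. norm (f x) \<le> M" unfolding bounded_iff by auto
  have Ss: "S \<in> sets \<alpha>" using S(1) haar_measure_onD(1)[OF a] by (simp add: compact_imp_closed)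
  have "(\<integral>\<^sup>+x. f x \<partial>\<alpha>) \<le> (\<integral>\<^sup>+x. ennreal M * indicator S x \<partial>\<alpha>)"
  proof (rule nn_integral_mono)
    fix x show "ennreal (f x) \<le> ennreal M * indicator S x"
    proof (cases "x \<in> S")
      case True
      then have "f x \<le> M" using M by force
      then show ?thesis using True by (simp add: ennreal_leI)
    qed (simp add: S(2))
  qed
  also have "\<dots> = ennreal M * emeasure \<alpha> S" by (rule nn_integral_cmult_indicator[OF Ss])
  also have "\<dots> < \<infinity>" using haar_measure_onD(5)[OF a S(1)] by (simp add: ennreal_mult_less_top)
  finally show ?thesis .
qed

text \<open>
  If the translate meets \<open>H\<close> in a point \<open>h\<close>, then it is contained in \<open>h + differences T\<close>. The bound
  does not depend on \<open>y\<close>.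
\<close>

lemma haar_translate_bound:
  fixes H :: "'a::{topological_group_add,t2_space,second_countable_topology} set"
  assumes a: "haar_measure_on H \<alpha>" and H: "H \<in> closed_subgroups" and T: "compact T"
  shows "emeasure \<alpha> {x. y + x \<in> T} \<le> emeasure \<alpha> (differences T)"
proof (cases "\<exists>h\<in>H. y + h \<in> T")
  case True
  then obtain h where h: "h \<in> H" "y + h \<in> T" by auto
  have D: "differences T \<in> sets borel" using compact_differences[OF T] by (simp add: compact_imp_closed)
  have m: "(+) (- h) \<in> measurable \<alpha> borel" using haar_measure_onD(1)[OF a] by (simp cong: measurable_cong_sets)
  have sub: "{x. y + x \<in> T} \<subseteq> (+) (- h) -` differences T"
  proof
    fix x assume "x \<in> {x. y + x \<in> T}"
    then have "- (y + h) + (y + x) \<in> differences T"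
      unfolding differences_def using h(2) by (intro image_eqI[of _ _ "(y + h, y + x)"]) auto
    then have "- h + x \<in> differences T" by (simp only: minus_add add.assoc minus_add_cancel)
    then show "x \<in> (+) (- h) -` differences T" by simp
  qed
  have "emeasure \<alpha> {x. y + x \<in> T} \<le> emeasure \<alpha> ((+) (- h) -` differences T \<inter> space \<alpha>)"
    using sub measurable_sets[OF m D] haar_measure_onD(2)[OF a] by (intro emeasure_mono) auto
  also have "\<dots> = emeasure (distr \<alpha> borel ((+) (- h))) (differences T)"
    using m D by (simp add: emeasure_distr)
  also have "\<dots> = emeasure \<alpha> (differences T)"
    using haar_measure_onD(4)[OF a closed_subgroupsD(4)[OF H h(1)]] by simp
  finally show ?thesis .
next
  case False
  then have "{x. y + x \<in> T} \<subseteq> - H" by auto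
  then have "emeasure \<alpha> {x. y + x \<in> T} \<le> emeasure \<alpha> (- H)"
    using closed_subgroupsD(1)[OF H] haar_measure_onD(1)[OF a] by (intro emeasure_mono) auto
  then show ?thesis using haar_measure_onD(3)[OF a] by simp
qed

text \<open>
  The integral of a left \<open>K\<close>-invariant function \<open>b\<close> with weight \<open>w\<close> depends on \<open>w\<close> only through its
  averages over the right cosets of \<open>K\<close>. Multiply by \<open>1 = (\<integral> u (- x + g) \<partial>\<alpha>(x)) / D g\<close>, where \<open>D\<close> is
  left \<open>K\<close>-invariant, exchange the integrals and substitute \<open>x + g\<close> for \<open>g\<close>.
\<close>

lemma quotient_integral_formula:
  fixes K :: "'a::{topological_group_add,t2_space,second_countable_topology} set"
    and b u w :: "'a \<Rightarrow> ennreal"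
  assumes a: "sigma_finite_measure \<alpha>" "sets \<alpha> = sets borel" "AE x in \<alpha>. x \<in> K"
      "\<And>k. k \<in> K \<Longrightarrow> distr \<alpha> borel ((+) k) = \<alpha>"
    and m: "sigma_finite_measure \<mu>" "sets \<mu> = sets borel" "\<And>k. k \<in> K \<Longrightarrow> distr \<mu> borel ((+) k) = \<mu>"
    and [measurable]: "b \<in> borel_measurable borel" "u \<in> borel_measurable borel" "w \<in> borel_measurable borel"
    and b: "\<And>k g. k \<in> K \<Longrightarrow> b (k + g) = b g"
    and D: "\<And>g. b g \<noteq> 0 \<Longrightarrow> 0 < (\<integral>\<^sup>+x. u (- x + g) \<partial>\<alpha>) \<and> (\<integral>\<^sup>+x. u (- x + g) \<partial>\<alpha>) < \<infinity>"
  shows "(\<integral>\<^sup>+g. w g * b g \<partial>\<mu>) =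
    (\<integral>\<^sup>+g. u g * (b g / (\<integral>\<^sup>+x. u (- x + g) \<partial>\<alpha>)) * (\<integral>\<^sup>+x. w (x + g) \<partial>\<alpha>) \<partial>\<mu>)"
proof -
  interpret A: sigma_finite_measure \<alpha> by fact
  interpret M: sigma_finite_measure \<mu> by fact
  interpret P: pair_sigma_finite \<mu> \<alpha> ..
  note [measurable_cong] = a(2) m(2)
  define D where "D g = (\<integral>\<^sup>+x. u (- x + g) \<partial>\<alpha>)" for g
  have [measurable]: "D \<in> borel_measurable borel" unfolding D_def by measurable
  have D_inv: "D (k + g) = D g" if "k \<in> K" for k g
  proof -
    have "(\<integral>\<^sup>+x. u (- x + (k + g)) \<partial>\<alpha>) = (\<integral>\<^sup>+x. u (- (k + x) + (k + g)) \<partial>\<alpha>)"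
      by (rule nn_integral_translate[symmetric, OF a(4)[OF that] a(2), of "\<lambda>x. u (- x + (k + g))"]) measurable
    also have "\<dots> = D g" unfolding D_def by (simp only: minus_add add.assoc minus_add_cancel)
    finally show ?thesis unfolding D_def .
  qed
  define c where "c g = b g / D g" for g
  have [measurable]: "c \<in> borel_measurable borel" unfolding c_def by measurable
  have c_inv: "c (k + g) = c g" if "k \<in> K" for k g using D_inv b that by (simp add: c_def)
  have cD: "c g * D g = b g" for g
  proof (cases "b g = 0")
    case False
    then have "0 < D g" "D g < \<infinity>" using D[of g] by (auto simp: D_def)
    then show ?thesis by (simp add: c_def ennreal_divide_times ennreal_mult_divide_eq less_top[symmetric])
  qed (simp add: c_def)
  have "(\<integral>\<^sup>+g. w g * b g \<partial>\<mu>) = (\<integral>\<^sup>+g. (\<integral>\<^sup>+x. w g * c g * u (- x + g) \<partial>\<alpha>) \<partial>\<mu>)"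
    by (subst nn_integral_cmult) (measurable, simp add: mult.assoc cD flip: D_def)
  also have "\<dots> = (\<integral>\<^sup>+x. (\<integral>\<^sup>+g. w g * c g * u (- x + g) \<partial>\<mu>) \<partial>\<alpha>)"
    by (rule P.Fubini'[symmetric]) measurable
  also have "\<dots> = (\<integral>\<^sup>+x. (\<integral>\<^sup>+g. w (x + g) * c g * u g \<partial>\<mu>) \<partial>\<alpha>)"
  proof (rule nn_integral_cong_AE, rule AE_mp[OF a(3)], rule AE_I2, rule impI)
    fix x assume x: "x \<in> K"
    have "(\<integral>\<^sup>+g. w g * c g * u (- x + g) \<partial>\<mu>) = (\<integral>\<^sup>+g. w (x + g) * c (x + g) * u (- x + (x + g)) \<partial>\<mu>)"
      by (rule nn_integral_translate[symmetric, OF m(3)[OF x] m(2), of "\<lambda>g. w g * c g * u (- x + g)"]) measurable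
    then show "(\<integral>\<^sup>+g. w g * c g * u (- x + g) \<partial>\<mu>) = (\<integral>\<^sup>+g. w (x + g) * c g * u g \<partial>\<mu>)"
      using c_inv[OF x] by simp
  qed
  also have "\<dots> = (\<integral>\<^sup>+g. (\<integral>\<^sup>+x. w (x + g) * c g * u g \<partial>\<alpha>) \<partial>\<mu>)"
    by (rule P.Fubini') measurable
  also have "\<dots> = (\<integral>\<^sup>+g. (\<integral>\<^sup>+x. (u g * c g) * w (x + g) \<partial>\<alpha>) \<partial>\<mu>)"
    by (simp add: mult_ac)
  also have "\<dots> = (\<integral>\<^sup>+g. u g * c g * (\<integral>\<^sup>+x. w (x + g) \<partial>\<alpha>) \<partial>\<mu>)"
    by (simp add: nn_integral_cmult)
  finally show ?thesis unfolding c_def D_def .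
qed

lemma haar_right_translate_pos_finite:
  fixes H :: "'a::{topological_group_add,t2_space,second_countable_topology} set"
  assumes H: "H \<in> closed_subgroups" and M: "haar_measure_on H M"
    and V: "open V" "0 \<in> V" "V \<subseteq> B" "compact B" and x: "x \<in> H"
  shows "0 < emeasure M {y. y + x \<in> V}" "emeasure M {y. y + x \<in> V} < \<infinity>"
proof -
  have op: "open {y. y + x \<in> V}" using V by (intro open_vimage_continuous continuous_intros)
  show "0 < emeasure M {y. y + x \<in> V}"
    using V(2) x closed_subgroupsD(4)[OF H] by (intro haar_open_pos[OF H M op, of "- x"]) auto
  have c: "compact ((\<lambda>v. v - x) ` B)" using V by (intro compact_continuous_image continuous_intros)
  have "{y. y + x \<in> V} \<subseteq> (\<lambda>v. v - x) ` B"
  proof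
    fix y assume "y \<in> {y. y + x \<in> V}"
    then have "y + x \<in> B" using V(3) by auto
    then show "y \<in> (\<lambda>v. v - x) ` B" by (intro image_eqI[of _ _ "y + x"]) auto
  qed
  then have "emeasure M {y. y + x \<in> V} \<le> emeasure M ((\<lambda>v. v - x) ` B)"
    using c haar_measure_onD(1)[OF M] by (intro emeasure_mono) (auto simp: compact_imp_closed)
  also have "\<dots> < \<infinity>" by (rule haar_measure_onD(5)[OF M c])
  finally show "emeasure M {y. y + x \<in> V} < \<infinity>" .
qed

text \<open>
  The right-hand side depends on \<open>\<gamma>\<close> only through the factor \<open>emeasure \<gamma> V\<close>, which gives uniqueness.
  The proof inserts \<open>1 = (\<integral> indicator V (y + x) \<partial>\<alpha>(y)) / D x\<close> and uses the invariance of \<open>\<gamma>\<close>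
  and then that of \<open>\<alpha>\<close>.
\<close>

lemma haar_integral_ratio:
  fixes H :: "'a::{topological_group_add,t2_space,second_countable_topology} set"
  assumes lc: "locally_compact_space (euclidean :: 'a topology)"
    and H: "H \<in> closed_subgroups" and a: "haar_measure_on H \<alpha>" and c: "haar_measure_on H \<gamma>"
    and V: "open V" "0 \<in> V" "V \<subseteq> B" "compact B" and [measurable]: "f \<in> borel_measurable borel"
  shows "(\<integral>\<^sup>+x. f x \<partial>\<gamma>) =
    emeasure \<gamma> V * (\<integral>\<^sup>+y. f (- y) / emeasure \<alpha> {z. z - y \<in> V} \<partial>\<alpha>)"
proof -
  interpret A: sigma_finite_measure \<alpha> by (rule haar_sigma_finite[OF lc a])
  interpret C: sigma_finite_measure \<gamma> by (rule haar_sigma_finite[OF lc c])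
  interpret P: pair_sigma_finite \<gamma> \<alpha> ..
  note [measurable_cong] = haar_measure_onD(1)[OF a] haar_measure_onD(1)[OF c]
  have [measurable]: "V \<in> sets borel" using V by auto
  define D where "D x = (\<integral>\<^sup>+y. indicator V (y + x) \<partial>\<alpha>)" for x
  have [measurable]: "D \<in> borel_measurable borel" unfolding D_def by measurable
  have D_eq: "D x = emeasure \<alpha> {y. y + x \<in> V}" for x
  proof -
    have "D x = (\<integral>\<^sup>+y. indicator {y. y + x \<in> V} y \<partial>\<alpha>)" unfolding D_def
      by (intro nn_integral_cong) (auto simp: indicator_def)
    also have "\<dots> = emeasure \<alpha> {y. y + x \<in> V}"
    proof (rule nn_integral_indicator)
      have "{y. y + x \<in> V} \<in> sets borel" using V(1) by (intro borel_open open_vimage_continuous continuous_intros)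
      then show "{y. y + x \<in> V} \<in> sets \<alpha>" using haar_measure_onD(1)[OF a] by simp
    qed
    finally show ?thesis .
  qed
  let ?q = "\<lambda>x. f x / D x"
  have "(\<integral>\<^sup>+x. f x \<partial>\<gamma>) = (\<integral>\<^sup>+x. (\<integral>\<^sup>+y. ?q x * indicator V (y + x) \<partial>\<alpha>) \<partial>\<gamma>)"
  proof (rule nn_integral_cong_AE, rule AE_mp[OF haar_AE_mem[OF c closed_subgroupsD(1)[OF H]]], rule AE_I2, rule impI)
    fix x assume x: "x \<in> H"
    have "0 < D x" "D x < \<infinity>" unfolding D_eq using haar_right_translate_pos_finite[OF H a V x] by auto
    moreover have "(\<integral>\<^sup>+y. ?q x * indicator V (y + x) \<partial>\<alpha>) = ?q x * D x"
      unfolding D_def by (rule nn_integral_cmult) measurable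
    ultimately show "f x = (\<integral>\<^sup>+y. ?q x * indicator V (y + x) \<partial>\<alpha>)"
      by (simp add: ennreal_divide_times ennreal_mult_divide_eq less_top[symmetric])
  qed
  also have "\<dots> = (\<integral>\<^sup>+y. (\<integral>\<^sup>+x. ?q x * indicator V (y + x) \<partial>\<gamma>) \<partial>\<alpha>)"
    by (rule P.Fubini'[symmetric]) measurable
  also have "\<dots> = (\<integral>\<^sup>+y. (\<integral>\<^sup>+x. ?q (- y + x) * indicator V x \<partial>\<gamma>) \<partial>\<alpha>)"
  proof (rule nn_integral_cong_AE, rule AE_mp[OF haar_AE_mem[OF a closed_subgroupsD(1)[OF H]]], rule AE_I2, rule impI)
    fix y assume "y \<in> H"
    then have y: "- y \<in> H" using closed_subgroupsD(4)[OF H] by simp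
    have "(\<integral>\<^sup>+x. ?q x * indicator V (y + x) \<partial>\<gamma>) = (\<integral>\<^sup>+x. ?q (- y + x) * indicator V (y + (- y + x)) \<partial>\<gamma>)"
      by (rule nn_integral_translate[symmetric, OF haar_measure_onD(4)[OF c y] haar_measure_onD(1)[OF c],
            of "\<lambda>x. ?q x * indicator V (y + x)"]) measurable
    then show "(\<integral>\<^sup>+x. ?q x * indicator V (y + x) \<partial>\<gamma>) = (\<integral>\<^sup>+x. ?q (- y + x) * indicator V x \<partial>\<gamma>)" by simp
  qed
  also have "\<dots> = (\<integral>\<^sup>+x. (\<integral>\<^sup>+y. ?q (- y + x) * indicator V x \<partial>\<alpha>) \<partial>\<gamma>)"
    by (rule P.Fubini') measurable
  also have "\<dots> = (\<integral>\<^sup>+x. (\<integral>\<^sup>+y. ?q (- y) \<partial>\<alpha>) * indicator V x \<partial>\<gamma>)"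
  proof (rule nn_integral_cong_AE, rule AE_mp[OF haar_AE_mem[OF c closed_subgroupsD(1)[OF H]]], rule AE_I2, rule impI)
    fix x assume x: "x \<in> H"
    have "(\<integral>\<^sup>+y. ?q (- y + x) \<partial>\<alpha>) = (\<integral>\<^sup>+y. ?q (- (x + y) + x) \<partial>\<alpha>)"
      by (rule nn_integral_translate[symmetric, OF haar_measure_onD(4)[OF a x] haar_measure_onD(1)[OF a],
            of "\<lambda>y. ?q (- y + x)"]) measurable
    also have "\<dots> = (\<integral>\<^sup>+y. ?q (- y) \<partial>\<alpha>)"
      by (simp only: minus_add add.assoc left_minus add_0_right)
    finally show "(\<integral>\<^sup>+y. ?q (- y + x) * indicator V x \<partial>\<alpha>) = (\<integral>\<^sup>+y. ?q (- y) \<partial>\<alpha>) * indicator V x"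
      by (simp add: nn_integral_multc)
  qed
  also have "\<dots> = (\<integral>\<^sup>+y. ?q (- y) \<partial>\<alpha>) * emeasure \<gamma> V"
    by (subst nn_integral_cmult_indicator) auto
  finally show ?thesis by (simp add: D_eq mult.commute)
qed

lemma haar_measure_unique:
  fixes H :: "'a::{topological_group_add,t2_space,second_countable_topology} set"
  assumes lc: "locally_compact_space (euclidean :: 'a topology)"
    and H: "H \<in> closed_subgroups" and a: "haar_measure_on H \<alpha>" and c: "haar_measure_on H \<gamma>"
  obtains s :: ennreal where "0 < s" "s < \<infinity>"
    "\<And>f. f \<in> borel_measurable borel \<Longrightarrow> (\<integral>\<^sup>+x. f x \<partial>\<gamma>) = s * (\<integral>\<^sup>+x. f x \<partial>\<alpha>)"
proof -
  obtain V B where V: "open V" "compact B" "(0::'a) \<in> V" "V \<subseteq> B" using locally_compact_nhd[OF lc] .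
  have fin: "0 < emeasure M V" "emeasure M V < \<infinity>" if M: "haar_measure_on H M" for M
  proof -
    show "0 < emeasure M V" using haar_measure_onD(6)[OF M V(1,3)] .
    have "emeasure M V \<le> emeasure M B" using V haar_measure_onD(1)[OF M]
      by (intro emeasure_mono) (auto simp: compact_imp_closed)
    then show "emeasure M V < \<infinity>" using haar_measure_onD(5)[OF M V(2)] by (rule le_less_trans)
  qed
  show ?thesis
  proof (rule that[of "emeasure \<gamma> V / emeasure \<alpha> V"])
    show "0 < emeasure \<gamma> V / emeasure \<alpha> V" "emeasure \<gamma> V / emeasure \<alpha> V < \<infinity>"
      using fin[OF a] fin[OF c]
      by (auto simp: ennreal_zero_less_divide ennreal_divide_eq_top_iff less_top[symmetric])
    fix f :: "'a \<Rightarrow> ennreal" assume f: "f \<in> borel_measurable borel"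
    let ?L = "\<integral>\<^sup>+y. f (- y) / emeasure \<alpha> {z. z - y \<in> V} \<partial>\<alpha>"
    have "(\<integral>\<^sup>+x. f x \<partial>\<gamma>) = emeasure \<gamma> V * ?L" "(\<integral>\<^sup>+x. f x \<partial>\<alpha>) = emeasure \<alpha> V * ?L"
      using haar_integral_ratio[OF lc H a c V(1,3,4,2) f] haar_integral_ratio[OF lc H a a V(1,3,4,2) f] by auto
    moreover have "emeasure \<gamma> V / emeasure \<alpha> V * (emeasure \<alpha> V * ?L) = emeasure \<gamma> V * ?L"
    proof -
      have "emeasure \<gamma> V / emeasure \<alpha> V * emeasure \<alpha> V = emeasure \<gamma> V"
        using fin[OF a] by (simp add: ennreal_divide_times ennreal_mult_divide_eq less_top[symmetric])
      then show ?thesis by (simp add: mult.assoc[symmetric])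
    qed
    ultimately show "(\<integral>\<^sup>+x. f x \<partial>\<gamma>) = emeasure \<gamma> V / emeasure \<alpha> V * (\<integral>\<^sup>+x. f x \<partial>\<alpha>)" by simp
  qed
qed

lemma haar_measure_conjugate:
  fixes H :: "'a::{topological_group_add,t2_space,second_countable_topology} set"
  assumes M: "haar_measure_on H M" and H: "H \<in> closed_subgroups"
  shows "haar_measure_on (conjugate g H) (distr M borel (\<lambda>x. g + x - g))"
proof -
  let ?c = "\<lambda>x. g + x - g"
  have c: "?c \<in> borel_measurable borel" by measurable
  then have cM: "?c \<in> borel_measurable M" using haar_measure_onD(1)[OF M] by (simp cong: measurable_cong_sets)
  have cont: "continuous_on UNIV ?c" by (intro continuous_intros)
  have em: "emeasure (distr M borel ?c) E = emeasure M (?c -` E)" if "E \<in> sets borel" for E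
    using that cM haar_measure_onD(2)[OF M] by (simp add: emeasure_distr)
  show ?thesis unfolding haar_measure_on_def
  proof (intro conjI ballI allI impI)
    have "closed (conjugate g H)"
      by (rule closed_subgroupsD(1)[OF conjugate_in_closed_subgroups[OF H]])
    then have "- conjugate g H \<in> sets borel" by auto
    moreover have "?c -` (- conjugate g H) = - H"
    proof -
      have "x = h" if "?c x = ?c h" for x h
        using that by (simp only: diff_conv_add_uminus add_right_cancel add_left_cancel)
      then have "inj ?c" by (rule injI)
      then show ?thesis unfolding conjugate_def by (simp add: vimage_Compl inj_vimage_image_eq)
    qed
    ultimately show "emeasure (distr M borel ?c) (- conjugate g H) = 0"
      using em haar_measure_onD(3)[OF M] by simp
    show "distr (distr M borel ?c) borel ((+) k) = distr M borel ?c" if k: "k \<in> conjugate g H" for k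
    proof -
      obtain h where h: "h \<in> H" "k = g + h - g" using k by (auto simp: conjugate_def)
      have hM: "(+) h \<in> measurable M borel" using haar_measure_onD(1)[OF M] by (simp cong: measurable_cong_sets)
      have "distr (distr M borel ?c) borel ((+) k) = distr M borel ((+) k \<circ> ?c)"
        using cM by (intro distr_distr) auto
      also have "(+) k \<circ> ?c = ?c \<circ> (+) h"
        using h(2) by (auto simp: fun_eq_iff diff_conv_add_uminus add.assoc simp del: add_uminus_conv_diff)
      also have "distr M borel (?c \<circ> (+) h) = distr (distr M borel ((+) h)) borel ?c"
        using hM c by (intro distr_distr[symmetric]) auto
      also have "\<dots> = distr M borel ?c" using haar_measure_onD(4)[OF M h(1)] by simp
      finally show ?thesis .
    qed
    show "emeasure (distr M borel ?c) K < \<infinity>" if K: "compact K" for K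
    proof -
      have co: "compact ((\<lambda>x. - g + x + g) ` K)" using K by (intro compact_continuous_image continuous_intros)
      have "?c -` K \<subseteq> (\<lambda>x. - g + x + g) ` K"
      proof
        fix x assume "x \<in> ?c -` K"
        then have "?c x \<in> K" by simp
        moreover have "x = - g + ?c x + g"
          by (simp only: diff_conv_add_uminus add.assoc minus_add_cancel left_minus add_0_right)
        ultimately show "x \<in> (\<lambda>x. - g + x + g) ` K" by (rule image_eqI[rotated])
      qed
      then have "emeasure M (?c -` K) \<le> emeasure M ((\<lambda>x. - g + x + g) ` K)"
        using co haar_measure_onD(1)[OF M] by (intro emeasure_mono) (auto simp: compact_imp_closed)
      then show ?thesis using em[of K] K haar_measure_onD(5)[OF M co]
        by (simp add: compact_imp_closed)
    qed
    show "0 < emeasure (distr M borel ?c) U" if U: "open U" "0 \<in> U" for U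
    proof -
      have "open (?c -` U)" using U cont by (intro open_vimage)
      moreover have "0 \<in> ?c -` U" using U by simp
      ultimately show ?thesis using em[of U] U haar_measure_onD(6)[OF M] by simp
    qed
  qed simp
qed

section \<open>Haar measures of subgroups as limits of thickenings\<close>

lemma bump_function_exists:
  assumes lc: "locally_compact_space (euclidean :: 'a topology)"
  obtains f :: "'a::{topological_group_add,t2_space} \<Rightarrow> real" and S :: "'a set"
  where "continuous_on UNIV f" "\<And>x. 0 \<le> f x" "\<And>x. f x \<le> 1" "f 0 = 1" "compact S" "\<And>x. x \<notin> S \<Longrightarrow> f x = 0"
proof -
  obtain V S where V: "open V" "compact S" "(0::'a) \<in> V" "V \<subseteq> S" using locally_compact_nhd[OF lc] .
  have cr: "completely_regular_space (euclidean :: 'a topology)"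
    using lc Hausdorff_space_t2 by (intro locally_compact_regular_imp_completely_regular_space) auto
  have c0: "compactin (euclidean :: 'a topology) {0}" and cV: "closedin euclidean (- V)" and dj: "disjnt {0} (- V)"
    using V by (auto simp: closed_closedin[symmetric])
  obtain f where f: "continuous_map (euclidean :: 'a topology) (subtopology euclidean {0..1::real}) f"
      "f ` (- V) \<subseteq> {0}" "f ` {0} \<subseteq> {1}"
    by (rule Urysohn_completely_regular_compact_closed[OF zero_le_one cr c0 cV dj]) (rule that)
  have "f x \<in> {0..1}" for x using f(1) by (auto simp: continuous_map_in_subtopology)
  moreover have "continuous_on UNIV f" using f(1) by (simp add: continuous_map_in_subtopology)
  moreover have "f x = 0" if "x \<notin> S" for x using f(2) that V(4) by auto
  ultimately show ?thesis using that[of f S] f(3) V(2) by auto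
qed

lemma compactly_supported_uniformly_continuous:
  fixes f :: "'a::{topological_group_add,t2_space} \<Rightarrow> real" and S V B :: "'a set"
  assumes f: "continuous_on UNIV f" and S: "compact S" "\<And>x. x \<notin> S \<Longrightarrow> f x = 0"
    and B: "open V" "0 \<in> V" "V \<subseteq> B" "compact B" and e: "0 < e"
  obtains T W where "compact T" "open W" "0 \<in> W"
    "\<And>x v. v \<in> W \<Longrightarrow> \<bar>f (x + v) - f x\<bar> \<le> e * indicator T x"
proof -
  let ?T = "(\<lambda>p. fst p - snd p) ` (S \<times> B)"
  have T: "compact ?T" using S B by (intro compact_continuous_image compact_Times continuous_intros)
  let ?O = "{p :: 'a \<times> 'a. \<bar>f (snd p + fst p) - f (snd p)\<bar> < e}"
  have "continuous_on UNIV (\<lambda>p :: 'a \<times> 'a. f (snd p + fst p))" "continuous_on UNIV (\<lambda>p :: 'a \<times> 'a. f (snd p))"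
    by (rule continuous_on_compose2[OF f], intro continuous_intros, simp)+
  then have "open ?O" by (intro open_Collect_less continuous_intros)
  moreover have "{0} \<times> ?T \<subseteq> ?O" using e by auto
  ultimately have "\<exists>W. 0 \<in> W \<and> open W \<and> W \<times> ?T \<subseteq> ?O"
    by (rule Elementary_Topology.tube_lemma[OF T])
  then obtain W where W: "0 \<in> W" "open W" "W \<times> ?T \<subseteq> ?O" by (elim exE conjE)
  show ?thesis
  proof (rule that[OF T, of "W \<inter> V"])
    show "open (W \<inter> V)" "0 \<in> W \<inter> V" using W B by auto
    fix x v assume v: "v \<in> W \<inter> V"
    show "\<bar>f (x + v) - f x\<bar> \<le> e * indicator ?T x"
    proof (cases "x \<in> ?T")
      case True
      then have "(v, x) \<in> W \<times> ?T" using v by simp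
      then have "(v, x) \<in> ?O" using W(3) by (rule subsetD[rotated])
      then show ?thesis using True by simp
    next
      case False
      have "x \<notin> S"
      proof
        assume "x \<in> S"
        then have "(x, 0) \<in> S \<times> B" using B by auto
        then have "fst (x, 0) - snd (x, 0) \<in> ?T" by (intro image_eqI[of _ _ "(x, 0)"]) simp_all
        then show False using False by simp
      qed
      moreover have "x + v \<notin> S"
      proof
        assume "x + v \<in> S"
        then have "(x + v, v) \<in> S \<times> B" using v B by auto
        then have "fst (x + v, v) - snd (x + v, v) \<in> ?T" by (intro image_eqI[of _ _ "(x + v, v)"]) simp_all
        then show False using False by simp
      qed
      ultimately show ?thesis using S(2) e by simp
    qed
  qed
qed

text \<open>
  A continuous function with compact support is uniformly continuous, and its small right
  translates differ from it only on a fixed compact set.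
\<close>

lemma haar_average_near_identity:
  fixes f :: "'a::{topological_group_add,t2_space,second_countable_topology} \<Rightarrow> real"
  assumes lc: "locally_compact_space (euclidean :: 'a topology)"
    and a: "haar_measure_on H \<alpha>"
    and f: "continuous_on UNIV f" "\<And>x. 0 \<le> f x" and S: "compact S" "\<And>x. x \<notin> S \<Longrightarrow> f x = 0" and e: "0 < (e::real)"
  obtains W where "open W" "0 \<in> W"
    "\<And>v. v \<in> W \<Longrightarrow> (\<integral>\<^sup>+x. f (x + v) \<partial>\<alpha>) \<le> (\<integral>\<^sup>+x. f x \<partial>\<alpha>) + e"
    "\<And>v. v \<in> W \<Longrightarrow> (\<integral>\<^sup>+x. f x \<partial>\<alpha>) \<le> (\<integral>\<^sup>+x. f (x + v) \<partial>\<alpha>) + e"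
proof -
  note [measurable_cong] = haar_measure_onD(1)[OF a]
  have [measurable]: "f \<in> borel_measurable borel" using f(1) by (rule borel_measurable_continuous_onI)
  obtain V B where V: "open V" "compact B" "(0::'a) \<in> V" "V \<subseteq> B" using locally_compact_nhd[OF lc] .
  \<comment> \<open>the compact set carrying the differences depends only on the supports, so fix it first\<close>
  obtain T W0 where T: "compact T" "open W0" "0 \<in> W0"
      "\<And>x v. v \<in> W0 \<Longrightarrow> \<bar>f (x + v) - f x\<bar> \<le> 1 * indicator T x"
    by (rule compactly_supported_uniformly_continuous[OF f(1) S V(1,3,4,2) zero_less_one]) (assumption | rule that)+
  have Tfin: "emeasure \<alpha> T < \<infinity>" using haar_measure_onD(5)[OF a T(1)] .
  \<comment> \<open>adding 1 avoids division by zero when T is a null set\<close>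
  define d where "d = e / (enn2real (emeasure \<alpha> T) + 1)"
  have d: "0 < d" unfolding d_def using e by (intro divide_pos_pos) (auto simp: add_nonneg_pos)
  obtain T' W' where W': "compact T'" "open W'" "0 \<in> W'"
      "\<And>x v. v \<in> W' \<Longrightarrow> \<bar>f (x + v) - f x\<bar> \<le> d * indicator T' x"
    by (rule compactly_supported_uniformly_continuous[OF f(1) S V(1,3,4,2) d]) (assumption | rule that)+
  have bound: "\<bar>f (x + v) - f x\<bar> \<le> d * indicator T x" if "v \<in> W0 \<inter> W'" for x v
  proof (cases "x \<in> T")
    case True
    have "d * indicator T' x \<le> d" using d by (simp add: indicator_def)
    then have "\<bar>f (x + v) - f x\<bar> \<le> d" using W'(4)[of v x] that by auto
    then show ?thesis using True by simp
  next
    case False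
    then show ?thesis using T(4)[of v x] that by simp
  qed
  have T_sets: "T \<in> sets borel" using T(1) by (simp add: compact_imp_closed)
  note [measurable] = T_sets
  have de: "ennreal d * emeasure \<alpha> T \<le> ennreal e"
  proof -
    have "emeasure \<alpha> T = ennreal (enn2real (emeasure \<alpha> T))" using Tfin by simp
    then have "ennreal d * emeasure \<alpha> T = ennreal (d * enn2real (emeasure \<alpha> T))"
      using d by (metis ennreal_mult' less_imp_le)
    also have "\<dots> \<le> ennreal e"
    proof (rule ennreal_leI)
      have "d * enn2real (emeasure \<alpha> T) \<le> d * (enn2real (emeasure \<alpha> T) + 1)" using d by simp
      also have "\<dots> = e"
      proof -
        have "enn2real (emeasure \<alpha> T) + 1 \<noteq> 0" using enn2real_nonneg[of "emeasure \<alpha> T"] by linarith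
        then show ?thesis by (simp add: d_def)
      qed
      finally show "d * enn2real (emeasure \<alpha> T) \<le> e" .
    qed
    finally show ?thesis .
  qed
  have int: "(\<integral>\<^sup>+x. ennreal (g x) + ennreal d * indicator T x \<partial>\<alpha>) \<le> (\<integral>\<^sup>+x. ennreal (g x) \<partial>\<alpha>) + e"
    if [measurable]: "g \<in> borel_measurable borel" for g
  proof -
    have "(\<integral>\<^sup>+x. ennreal (g x) + ennreal d * indicator T x \<partial>\<alpha>) = (\<integral>\<^sup>+x. ennreal (g x) \<partial>\<alpha>) + ennreal d * emeasure \<alpha> T"
    proof -
      have "(\<integral>\<^sup>+x. ennreal (g x) + ennreal d * indicator T x \<partial>\<alpha>) =
          (\<integral>\<^sup>+x. ennreal (g x) \<partial>\<alpha>) + (\<integral>\<^sup>+x. ennreal d * indicator T x \<partial>\<alpha>)"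
        by (rule nn_integral_add) measurable
      also have "(\<integral>\<^sup>+x. ennreal d * indicator T x \<partial>\<alpha>) = ennreal d * emeasure \<alpha> T"
        by (rule nn_integral_cmult_indicator) measurable
      finally show ?thesis .
    qed
    then show ?thesis using de by (simp add: add_left_mono)
  qed
  have pw: "ennreal s \<le> ennreal t + ennreal d * indicator T x" if "0 \<le> t" "\<bar>s - t\<bar> \<le> d * indicator T x" for s t x
  proof -
    have "ennreal s \<le> ennreal (t + d * indicator T x)" using that by (intro ennreal_leI) linarith
    also have "\<dots> = ennreal t + ennreal (d * indicator T x)" using that d by (intro ennreal_plus) auto
    also have "ennreal (d * indicator T x) = ennreal d * indicator T x" by (simp add: indicator_def)
    finally show ?thesis .
  qed
  show ?thesis
  proof (rule that[of "W0 \<inter> W'"])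
    show "open (W0 \<inter> W')" "0 \<in> W0 \<inter> W'" using T W' by auto
    fix v assume v: "v \<in> W0 \<inter> W'"
    have "(\<integral>\<^sup>+x. f (x + v) \<partial>\<alpha>) \<le> (\<integral>\<^sup>+x. ennreal (f x) + ennreal d * indicator T x \<partial>\<alpha>)"
      by (intro nn_integral_mono pw f bound v)
    also have "\<dots> \<le> (\<integral>\<^sup>+x. f x \<partial>\<alpha>) + e" by (rule int) measurable
    finally show "(\<integral>\<^sup>+x. f (x + v) \<partial>\<alpha>) \<le> (\<integral>\<^sup>+x. f x \<partial>\<alpha>) + e" .
    have "(\<integral>\<^sup>+x. f x \<partial>\<alpha>) \<le> (\<integral>\<^sup>+x. ennreal (f (x + v)) + ennreal d * indicator T x \<partial>\<alpha>)"
      using bound[OF v] by (intro nn_integral_mono pw f) (simp add: abs_minus_commute)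
    also have "\<dots> \<le> (\<integral>\<^sup>+x. f (x + v) \<partial>\<alpha>) + e" by (rule int) measurable
    finally show "(\<integral>\<^sup>+x. f x \<partial>\<alpha>) \<le> (\<integral>\<^sup>+x. f (x + v) \<partial>\<alpha>) + e" .
  qed
qed

text \<open>
  The product set \<open>CV\<close> in multiplicative notation. If \<open>C\<close> is a subgroup, the thickening is invariant under left translation by \<open>C\<close>.
\<close>

definition thickening :: "'a::group_add set \<Rightarrow> 'a set \<Rightarrow> 'a set" where
  "thickening V C = {x. \<exists>c\<in>C. - c + x \<in> V}"

lemma open_thickening:
  fixes V :: "'a::topological_group_add set"
  assumes "open V" shows "open (thickening V C)"
proof -
  have "thickening V C = (\<Union>c\<in>C. {x. - c + x \<in> V})" by (auto simp: thickening_def)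
  then show ?thesis using assms by (auto intro!: open_UN open_vimage_continuous continuous_intros)
qed

context
  fixes H :: "'a::{topological_group_add,t2_space,second_countable_topology} set" and \<alpha> m :: "'a measure"
    and V B :: "'a set" and D :: "'a \<Rightarrow> ennreal" and c :: ennreal
  assumes lc: "locally_compact_space (euclidean :: 'a topology)"
    and H: "H \<in> closed_subgroups" and a: "haar_measure_on H \<alpha>" and m: "haar_measure_on UNIV m"
    and V: "open V" "0 \<in> V" "V \<subseteq> B" "compact B"
  defines "D \<equiv> \<lambda>g. \<integral>\<^sup>+x. indicator V (- x + g) \<partial>\<alpha>"
    and "c \<equiv> \<integral>\<^sup>+g. indicator V g / D g \<partial>m"
begin

lemma thickening_density_pos_finite:
  assumes "g \<in> thickening V H" shows "0 < D g" "D g < \<infinity>"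
proof -
  have op: "open {x. - x + g \<in> V}" using V by (intro open_vimage_continuous continuous_intros)
  have "D g = (\<integral>\<^sup>+x. indicator {x. - x + g \<in> V} x \<partial>\<alpha>)" unfolding D_def
    by (intro nn_integral_cong) (auto simp: indicator_def)
  also have "\<dots> = emeasure \<alpha> {x. - x + g \<in> V}"
    using op haar_measure_onD(1)[OF a] by (intro nn_integral_indicator) auto
  finally have Dg: "D g = emeasure \<alpha> {x. - x + g \<in> V}" .
  obtain h where h: "h \<in> H" "- h + g \<in> V" using assms by (auto simp: thickening_def)
  then show "0 < D g" unfolding Dg by (intro haar_open_pos[OF H a op]) auto
  have co: "compact ((\<lambda>v. g - v) ` B)" using V by (intro compact_continuous_image continuous_intros)
  have "{x. - x + g \<in> V} \<subseteq> (\<lambda>v. g - v) ` B"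
  proof
    fix x assume "x \<in> {x. - x + g \<in> V}"
    then have "- x + g \<in> B" using V by auto
    moreover have "x = g - (- x + g)"
      by (simp only: diff_conv_add_uminus minus_add minus_minus add_minus_cancel)
    ultimately show "x \<in> (\<lambda>v. g - v) ` B" by (rule image_eqI[rotated])
  qed
  then have "D g \<le> emeasure \<alpha> ((\<lambda>v. g - v) ` B)" unfolding Dg
    using co haar_measure_onD(1)[OF a] by (intro emeasure_mono) (auto simp: compact_imp_closed)
  then show "D g < \<infinity>" using haar_measure_onD(5)[OF a co] by (rule le_less_trans)
qed

lemma subset_thickening: "V \<subseteq> thickening V H"
  using closed_subgroupsD(2)[OF H] by (auto simp: thickening_def intro!: bexI[of _ 0])

lemma thickening_density_measurable: "D \<in> borel_measurable borel"
proof -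
  interpret sigma_finite_measure \<alpha> by (rule haar_sigma_finite[OF lc a])
  note [measurable_cong] = haar_measure_onD(1)[OF a]
  have [measurable]: "V \<in> sets borel" using V by auto
  show ?thesis unfolding D_def by measurable
qed

text \<open>
  Fibres the restriction of \<open>m\<close> to the thickening of \<open>H\<close> over \<open>V\<close>, with right translates of \<open>\<alpha>\<close>
  on the fibres: the quotient formula for \<open>u = indicator V\<close>.
\<close>

lemma thickening_integral:
  assumes w: "w \<in> borel_measurable borel"
  shows "(\<integral>\<^sup>+g. w g * indicator (thickening V H) g \<partial>m) = (\<integral>\<^sup>+g. indicator V g / D g * (\<integral>\<^sup>+x. w (x + g) \<partial>\<alpha>) \<partial>m)"
proof -
  have inv: "indicator (thickening V H) (k + g) = (indicator (thickening V H) g :: ennreal)" if k: "k \<in> H" for k g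
  proof -
    have "k + g \<in> thickening V H" if gk: "g \<in> thickening V H" "k \<in> H" for k g
    proof -
      obtain h where "h \<in> H" "- h + g \<in> V" using gk by (auto simp: thickening_def)
      then have "k + h \<in> H" "- (k + h) + (k + g) \<in> V"
        using gk closed_subgroupsD(3)[OF H] by (simp, simp only: minus_add add.assoc minus_add_cancel)
      then show ?thesis unfolding thickening_def by blast
    qed
    from this[of g k] this[of "k + g" "- k"] show ?thesis
      using k closed_subgroupsD(4)[OF H] by (auto simp: indicator_def)
  qed
  have "(\<integral>\<^sup>+g. w g * indicator (thickening V H) g \<partial>m) =
    (\<integral>\<^sup>+g. indicator V g * (indicator (thickening V H) g / (\<integral>\<^sup>+x. indicator V (- x + g) \<partial>\<alpha>)) * (\<integral>\<^sup>+x. w (x + g) \<partial>\<alpha>) \<partial>m)"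
  proof (rule quotient_integral_formula[where K = H])
    show "sigma_finite_measure \<alpha>" "sigma_finite_measure m" by (rule haar_sigma_finite[OF lc], fact)+
    show "AE x in \<alpha>. x \<in> H" by (rule haar_AE_mem[OF a closed_subgroupsD(1)[OF H]])
    show "indicator (thickening V H) (k + g) = (indicator (thickening V H) g :: ennreal)" if "k \<in> H" for k g
      by (rule inv[OF that])
    fix g assume "indicator (thickening V H) g \<noteq> (0 :: ennreal)"
    then have "g \<in> thickening V H" by (auto simp: indicator_def split: if_splits)
    then show "0 < (\<integral>\<^sup>+x. indicator V (- x + g) \<partial>\<alpha>) \<and> (\<integral>\<^sup>+x. indicator V (- x + g) \<partial>\<alpha>) < \<infinity>"
      using thickening_density_pos_finite[of g] unfolding D_def by blast
  qed (use w V open_thickening[OF V(1)] haar_measure_onD[OF a] haar_measure_onD[OF m] in auto)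
  also have "\<dots> = (\<integral>\<^sup>+g. indicator V g / D g * (\<integral>\<^sup>+x. w (x + g) \<partial>\<alpha>) \<partial>m)"
  proof (rule nn_integral_cong)
    fix g
    have "indicator V g * (indicator (thickening V H) g / D g) = indicator V g / D g"
      using subset_thickening by (auto simp: indicator_def)
    then show "indicator V g * (indicator (thickening V H) g / (\<integral>\<^sup>+x. indicator V (- x + g) \<partial>\<alpha>)) * (\<integral>\<^sup>+x. w (x + g) \<partial>\<alpha>) =
        indicator V g / D g * (\<integral>\<^sup>+x. w (x + g) \<partial>\<alpha>)" unfolding D_def by simp
  qed
  finally show ?thesis .
qed

lemma thickening_constant_pos: "0 < c"
  unfolding c_def
proof (rule haar_integral_pos[OF m _ V(1,2)])
  note [measurable] = thickening_density_measurable
  have [measurable]: "V \<in> sets borel" using V by auto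
  show "(\<lambda>g. indicator V g / D g) \<in> borel_measurable borel" by measurable
  fix g assume "g \<in> V"
  moreover from this have "D g < \<infinity>" using subset_thickening thickening_density_pos_finite(2) by auto
  ultimately show "0 < indicator V g / D g" by (simp add: ennreal_zero_less_divide less_top[symmetric])
qed

lemma thickening_estimates:
  assumes [measurable]: "w \<in> borel_measurable borel"
    and up: "\<And>v. v \<in> V \<Longrightarrow> (\<integral>\<^sup>+x. w (x + v) \<partial>\<alpha>) \<le> (\<integral>\<^sup>+x. w x \<partial>\<alpha>) + e"
    and lo: "\<And>v. v \<in> V \<Longrightarrow> (\<integral>\<^sup>+x. w x \<partial>\<alpha>) \<le> (\<integral>\<^sup>+x. w (x + v) \<partial>\<alpha>) + e"
  shows "(\<integral>\<^sup>+g. w g * indicator (thickening V H) g \<partial>m) \<le> c * ((\<integral>\<^sup>+x. w x \<partial>\<alpha>) + e)"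
    "c * (\<integral>\<^sup>+x. w x \<partial>\<alpha>) \<le> (\<integral>\<^sup>+g. w g * indicator (thickening V H) g \<partial>m) + c * e"
proof -
  interpret sigma_finite_measure \<alpha> by (rule haar_sigma_finite[OF lc a])
  note [measurable_cong] = haar_measure_onD(1)[OF m] haar_measure_onD(1)[OF a]
  note [measurable] = thickening_density_measurable
  have [measurable]: "V \<in> sets borel" using V by auto
  have "(\<integral>\<^sup>+g. w g * indicator (thickening V H) g \<partial>m) = (\<integral>\<^sup>+g. indicator V g / D g * (\<integral>\<^sup>+x. w (x + g) \<partial>\<alpha>) \<partial>m)"
    by (rule thickening_integral) measurable
  also have "\<dots> \<le> (\<integral>\<^sup>+g. indicator V g / D g * ((\<integral>\<^sup>+x. w x \<partial>\<alpha>) + e) \<partial>m)"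
    using up by (intro nn_integral_mono) (auto simp: indicator_def intro!: mult_left_mono)
  also have "\<dots> = c * ((\<integral>\<^sup>+x. w x \<partial>\<alpha>) + e)"
    unfolding c_def by (rule nn_integral_multc) measurable
  finally show "(\<integral>\<^sup>+g. w g * indicator (thickening V H) g \<partial>m) \<le> c * ((\<integral>\<^sup>+x. w x \<partial>\<alpha>) + e)" .
  have "c * (\<integral>\<^sup>+x. w x \<partial>\<alpha>) = (\<integral>\<^sup>+g. indicator V g / D g * (\<integral>\<^sup>+x. w x \<partial>\<alpha>) \<partial>m)"
    unfolding c_def by (rule nn_integral_multc[symmetric]) measurable
  also have "\<dots> \<le> (\<integral>\<^sup>+g. indicator V g / D g * ((\<integral>\<^sup>+x. w (x + g) \<partial>\<alpha>) + e) \<partial>m)"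
    using lo by (intro nn_integral_mono) (auto simp: indicator_def intro!: mult_left_mono)
  also have "\<dots> = (\<integral>\<^sup>+g. indicator V g / D g * (\<integral>\<^sup>+x. w (x + g) \<partial>\<alpha>) + indicator V g / D g * e \<partial>m)"
    by (simp add: distrib_left)
  also have "\<dots> = (\<integral>\<^sup>+g. indicator V g / D g * (\<integral>\<^sup>+x. w (x + g) \<partial>\<alpha>) \<partial>m) + (\<integral>\<^sup>+g. indicator V g / D g * e \<partial>m)"
    by (rule nn_integral_add) measurable
  also have "(\<integral>\<^sup>+g. indicator V g / D g * e \<partial>m) = c * e"
    unfolding c_def by (rule nn_integral_multc) measurable
  also have "(\<integral>\<^sup>+g. indicator V g / D g * (\<integral>\<^sup>+x. w (x + g) \<partial>\<alpha>) \<partial>m) = (\<integral>\<^sup>+g. w g * indicator (thickening V H) g \<partial>m)"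
    by (rule thickening_integral[symmetric]) measurable
  finally show "c * (\<integral>\<^sup>+x. w x \<partial>\<alpha>) \<le> (\<integral>\<^sup>+g. w g * indicator (thickening V H) g \<partial>m) + c * e" .
qed

lemma thickening_constant_le:
  assumes [measurable]: "w \<in> borel_measurable borel"
    and lo: "\<And>v. v \<in> V \<Longrightarrow> r \<le> (\<integral>\<^sup>+x. w (x + v) \<partial>\<alpha>)"
  shows "c * r \<le> (\<integral>\<^sup>+g. w g * indicator (thickening V H) g \<partial>m)"
proof -
  interpret sigma_finite_measure \<alpha> by (rule haar_sigma_finite[OF lc a])
  note [measurable_cong] = haar_measure_onD(1)[OF m] haar_measure_onD(1)[OF a]
  note [measurable] = thickening_density_measurable
  have [measurable]: "V \<in> sets borel" using V by auto
  have "c * r = (\<integral>\<^sup>+g. indicator V g / D g * r \<partial>m)"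
    unfolding c_def by (rule nn_integral_multc[symmetric]) measurable
  also have "\<dots> \<le> (\<integral>\<^sup>+g. indicator V g / D g * (\<integral>\<^sup>+x. w (x + g) \<partial>\<alpha>) \<partial>m)"
    using lo by (intro nn_integral_mono) (auto simp: indicator_def intro!: mult_left_mono)
  also have "\<dots> = (\<integral>\<^sup>+g. w g * indicator (thickening V H) g \<partial>m)"
    by (rule thickening_integral[symmetric]) measurable
  finally show ?thesis .
qed

end

lemma ratio_estimate:
  fixes a C R :: ennreal and e :: real
  assumes "a < \<infinity>" "0 < C" "C < \<infinity>" "R < \<infinity>" "0 < e"
    and "a \<le> C * (R + e)" "C * R \<le> a + C * e"
  shows "\<bar>enn2real a / enn2real C - enn2real R\<bar> \<le> e"
proof -
  obtain a' C' R' where r: "a = ennreal a'" "C = ennreal C'" "R = ennreal R'" "0 \<le> a'" "0 \<le> C'" "0 \<le> R'"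
    using assms(1,3,4) by (metis ennreal_cases infinity_ennreal_def less_irrefl)
  have "0 < C'" using assms(2) r by (simp add: ennreal_less_zero_iff)
  have "ennreal a' \<le> ennreal (C' * (R' + e))" "ennreal (C' * R') \<le> ennreal (a' + C' * e)"
    using assms(5-7) r by (simp_all add: ennreal_mult' ennreal_plus)
  then have "a' \<le> C' * (R' + e)" "C' * R' \<le> a' + C' * e"
    using r assms(5) by (auto dest!: iffD1[OF ennreal_le_iff, rotated] simp del: ennreal_plus)
  then have "a' / C' \<le> R' + e" "R' \<le> a' / C' + e"
    using \<open>0 < C'\<close> by (simp_all add: field_simps)
  then show ?thesis using r by (simp add: abs_le_iff)
qed

text \<open>
  Recovers the Haar measure of \<open>H\<close>, normalized by \<open>f0\<close>, from the Haar measure of the whole group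
  alone. On the fibres over a small \<open>V\<close> the averages of \<open>f\<close> are close to its integral over \<open>H\<close>; the
  unknown total weight \<open>c n\<close> of the fibres cancels in the quotient. Since the thickening of \<open>H\<close> depends
  measurably on \<open>H\<close>, so does the limit, although the Haar measures of the subgroups are chosen arbitrarily.
\<close>

lemma thickening_ratio_tendsto:
  fixes f f0 :: "'a::{topological_group_add,t2_space,second_countable_topology} \<Rightarrow> real" and V :: "nat \<Rightarrow> 'a set"
  assumes lc: "locally_compact_space (euclidean :: 'a topology)"
    and H: "H \<in> closed_subgroups" and a: "haar_measure_on H \<alpha>" and m: "haar_measure_on UNIV m"
    and f: "continuous_on UNIV f" "\<And>x. 0 \<le> f x" "compact S" "\<And>x. x \<notin> S \<Longrightarrow> f x = 0"
    and f0: "continuous_on UNIV f0" "\<And>x. 0 \<le> f0 x" "compact S0" "\<And>x. x \<notin> S0 \<Longrightarrow> f0 x = 0"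
    and one: "(\<integral>\<^sup>+x. f0 x \<partial>\<alpha>) = 1"
    and V: "\<And>n. open (V n)" "\<And>n. 0 \<in> V n" "\<And>W. open W \<Longrightarrow> 0 \<in> W \<Longrightarrow> eventually (\<lambda>n. V n \<subseteq> W) sequentially"
  shows "(\<lambda>n. enn2real (\<integral>\<^sup>+x. ennreal (f x) * indicator (thickening (V n) H) x \<partial>m) /
    enn2real (\<integral>\<^sup>+x. ennreal (f0 x) * indicator (thickening (V n) H) x \<partial>m)) \<longlonglongrightarrow> enn2real (\<integral>\<^sup>+x. f x \<partial>\<alpha>)"
proof -
  obtain V0 B where V0: "open V0" "compact B" "(0::'a) \<in> V0" "V0 \<subseteq> B" using locally_compact_nhd[OF lc] .
  define I where "I g n = (\<integral>\<^sup>+x. ennreal (g x) * indicator (thickening (V n) H) x \<partial>m)" for g :: "'a \<Rightarrow> real" and n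
  define c where "c n = (\<integral>\<^sup>+g. indicator (V n) g / (\<integral>\<^sup>+x. indicator (V n) (- x + g) \<partial>\<alpha>) \<partial>m)" for n
  have [measurable]: "f \<in> borel_measurable borel" "f0 \<in> borel_measurable borel"
    using f(1) f0(1) by (auto intro: borel_measurable_continuous_onI)
  have I_le: "I g n \<le> (\<integral>\<^sup>+x. g x \<partial>m)" for g n
    unfolding I_def by (intro nn_integral_mono) (simp add: indicator_def)
  have I_fin: "I f n < \<infinity>" "I f0 n < \<infinity>" for n
    using I_le[of f n] I_le[of f0 n] haar_integral_finite[OF m f(1,3,4)] haar_integral_finite[OF m f0(1,3,4)]
    by (auto intro: le_less_trans)
  have c_pos: "0 < c n" if "V n \<subseteq> V0" for n
    unfolding c_def using that V0(4) by (intro thickening_constant_pos[OF lc H a m V(1,2) _ V0(2)]) auto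
  have c_fin: "eventually (\<lambda>n. 0 < c n \<and> c n < \<infinity>) sequentially"
  proof -
    \<comment> \<open>near the identity the averages of f0 are at least 1/2, which bounds c n by twice the integral of f0\<close>
    define e :: real where "e = 1 / 2"
    have e: "0 < e" "e + e = 1" by (simp_all add: e_def)
    obtain W where W: "open W" "0 \<in> W"
      "\<And>v. v \<in> W \<Longrightarrow> (\<integral>\<^sup>+x. f0 (x + v) \<partial>\<alpha>) \<le> (\<integral>\<^sup>+x. f0 x \<partial>\<alpha>) + e"
      "\<And>v. v \<in> W \<Longrightarrow> (\<integral>\<^sup>+x. f0 x \<partial>\<alpha>) \<le> (\<integral>\<^sup>+x. f0 (x + v) \<partial>\<alpha>) + e"
      by (rule haar_average_near_identity[OF lc a f0 e(1)]) (assumption | rule that)+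
    have half: "ennreal e \<le> (\<integral>\<^sup>+x. f0 (x + v) \<partial>\<alpha>)" if "v \<in> W" for v
    proof -
      have "ennreal e + ennreal e = ennreal (e + e)"
        using e by (intro ennreal_plus[symmetric]) auto
      also have "\<dots> \<le> ennreal e + (\<integral>\<^sup>+x. f0 (x + v) \<partial>\<alpha>)"
        using W(4)[OF that] one e(2) by (simp add: add.commute)
      finally show ?thesis unfolding ennreal_add_left_cancel_le by auto
    qed
    show ?thesis using V(3)[OF V0(1,3)] V(3)[OF W(1,2)]
    proof eventually_elim
      case (elim n)
      have "c n * ennreal e \<le> I f0 n"
        unfolding c_def I_def using elim V0(4) half
        by (intro thickening_constant_le[OF lc H a m V(1,2) _ V0(2)]) auto
      then have "c n * ennreal e < \<infinity>" using I_fin(2) by (rule le_less_trans)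
      then have "c n < \<infinity>" using e(1) by (auto simp: ennreal_mult_less_top)
      then show ?case using c_pos[OF elim(1)] by simp
    qed
  qed
  have lim: "(\<lambda>n. enn2real (I g n) / enn2real (c n)) \<longlonglongrightarrow> enn2real (\<integral>\<^sup>+x. g x \<partial>\<alpha>)"
    if g: "continuous_on UNIV g" "\<And>x. 0 \<le> g x" "compact T" "\<And>x. x \<notin> T \<Longrightarrow> g x = 0" for g and T
  proof (rule LIMSEQ_I)
    have [measurable]: "g \<in> borel_measurable borel" using g(1) by (intro borel_measurable_continuous_onI)
    fix r :: real assume "0 < r"
    then have r: "0 < r / 2" by simp
    obtain W where W: "open W" "0 \<in> W"
      "\<And>v. v \<in> W \<Longrightarrow> (\<integral>\<^sup>+x. g (x + v) \<partial>\<alpha>) \<le> (\<integral>\<^sup>+x. g x \<partial>\<alpha>) + (r / 2)"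
      "\<And>v. v \<in> W \<Longrightarrow> (\<integral>\<^sup>+x. g x \<partial>\<alpha>) \<le> (\<integral>\<^sup>+x. g (x + v) \<partial>\<alpha>) + (r / 2)"
      by (rule haar_average_near_identity[OF lc a g r]) (assumption | rule that)+
    have "eventually (\<lambda>n. \<bar>enn2real (I g n) / enn2real (c n) - enn2real (\<integral>\<^sup>+x. g x \<partial>\<alpha>)\<bar> \<le> r / 2) sequentially"
      using V(3)[OF V0(1,3)] V(3)[OF W(1,2)] c_fin
    proof eventually_elim
      case (elim n)
      have VB: "V n \<subseteq> B" using elim V0(4) by auto
      have "I g n < \<infinity>" using I_le[of g n] haar_integral_finite[OF m g(1,3,4)] by (rule le_less_trans)
      moreover have "I g n \<le> c n * ((\<integral>\<^sup>+x. g x \<partial>\<alpha>) + ennreal (r / 2))"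
        "c n * (\<integral>\<^sup>+x. g x \<partial>\<alpha>) \<le> I g n + c n * ennreal (r / 2)"
        unfolding c_def I_def using W(3,4) elim
        by (intro thickening_estimates[OF lc H a m V(1,2) VB V0(2)]; auto)+
      ultimately show ?case
        using elim haar_integral_finite[OF a g(1,3,4)] r by (intro ratio_estimate) auto
    qed
    then obtain N where "\<forall>n\<ge>N. \<bar>enn2real (I g n) / enn2real (c n) - enn2real (\<integral>\<^sup>+x. g x \<partial>\<alpha>)\<bar> \<le> r / 2"
      unfolding eventually_sequentially by auto
    then have "\<forall>n\<ge>N. norm (enn2real (I g n) / enn2real (c n) - enn2real (\<integral>\<^sup>+x. g x \<partial>\<alpha>)) < r"
      using \<open>0 < r\<close> by force
    then show "\<exists>N. \<forall>n\<ge>N. norm (enn2real (I g n) / enn2real (c n) - enn2real (\<integral>\<^sup>+x. g x \<partial>\<alpha>)) < r" by blast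
  qed
  have "(\<lambda>n. (enn2real (I f n) / enn2real (c n)) / (enn2real (I f0 n) / enn2real (c n))) \<longlonglongrightarrow>
      enn2real (\<integral>\<^sup>+x. f x \<partial>\<alpha>) / enn2real (\<integral>\<^sup>+x. f0 x \<partial>\<alpha>)"
    by (intro tendsto_divide lim[OF f] lim[OF f0]) (simp_all only: one enn2real_1 one_neq_zero not_False_eq_True)
  moreover have "eventually (\<lambda>n. (enn2real (I f n) / enn2real (c n)) / (enn2real (I f0 n) / enn2real (c n))
      = enn2real (I f n) / enn2real (I f0 n)) sequentially"
    using c_fin
  proof eventually_elim
    case (elim n)
    then have "enn2real (c n) \<noteq> 0" by (auto simp: enn2real_eq_0_iff)
    then show ?case by simp
  qed
  ultimately have "(\<lambda>n. enn2real (I f n) / enn2real (I f0 n)) \<longlonglongrightarrow>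
      enn2real (\<integral>\<^sup>+x. f x \<partial>\<alpha>) / enn2real (\<integral>\<^sup>+x. f0 x \<partial>\<alpha>)"
    by (rule Lim_transform_eventually)
  then show ?thesis unfolding I_def one by simp
qed

section \<open>Integration over cosets\<close>

text \<open>
  The bump function \<open>f0\<close> normalizes the Haar measures \<open>p H\<close>; the dense sequence \<open>q\<close> serves to spread
  translates of \<open>f0\<close> over the whole group.
\<close>

locale coset_weights =
  fixes f0 :: "'a::{topological_group_add,t2_space,second_countable_topology} \<Rightarrow> real"
    and S :: "'a set" and p :: "'a set \<Rightarrow> 'a measure" and q :: "nat \<Rightarrow> 'a"
  assumes lc: "locally_compact_space (euclidean :: 'a topology)"
    and f0_continuous: "continuous_on UNIV f0"
    and f0_range: "\<And>x. 0 \<le> f0 x" "\<And>x. f0 x \<le> 1" and f0_at_0: "f0 0 = 1"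
    and f0_support: "compact S" "\<And>x. x \<notin> S \<Longrightarrow> f0 x = 0"
    and haar_p: "\<And>H. H \<in> closed_subgroups \<Longrightarrow> haar_measure_on H (p H)"
    and p_normalized: "\<And>H. H \<in> closed_subgroups \<Longrightarrow> (\<integral>\<^sup>+x. f0 x \<partial>p H) = 1"
    and q_dense: "\<And>U. open U \<Longrightarrow> U \<noteq> {} \<Longrightarrow> \<exists>i. q i \<in> U"
begin

lemma f0_measurable [measurable]: "f0 \<in> borel_measurable borel"
  using f0_continuous by (rule borel_measurable_continuous_onI)

text \<open>
  A strictly positive function with finite integral over every coset of every closed subgroup. The
  integrals of the translates of \<open>f0\<close> over a fixed coset are uniformly bounded, so the geometric weights suffice.
\<close>

definition \<psi> :: "'a \<Rightarrow> ennreal" where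
  "\<psi> y = (\<Sum>i. ennreal ((1/2)^i) * ennreal (f0 (- q i + y)))"

text \<open>
  Integration against the image of \<open>p H\<close> under \<open>h \<mapsto> c + h\<close>, for \<open>C = c + H\<close>. Left invariance of \<open>p H\<close>
  makes the choice of \<open>c\<close> irrelevant.
\<close>

definition coset_integral :: "'a set \<Rightarrow> ('a \<Rightarrow> ennreal) \<Rightarrow> ennreal" where
  "coset_integral C f = (\<integral>\<^sup>+h. f ((SOME c. c \<in> C) + h) \<partial>p (differences C))"

lemma \<psi>_measurable [measurable]: "\<psi> \<in> borel_measurable borel"
  unfolding \<psi>_def by measurable

lemma coset_integral_eq:
  assumes C: "C \<in> closed_subgroup_cosets" "c \<in> C" and [measurable]: "f \<in> borel_measurable borel"
  shows "coset_integral C f = (\<integral>\<^sup>+h. f (c + h) \<partial>p (differences C))"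
proof -
  let ?c = "SOME c. c \<in> C" and ?H = "differences C"
  have c: "?c \<in> C" using C(2) by (rule someI)
  have H: "?H \<in> closed_subgroups" using coset_eq_translate_differences(2)[OF C] .
  have h: "- ?c + c \<in> ?H" unfolding differences_def using c C(2) by (intro image_eqI[of _ _ "(?c, c)"]) auto
  have "(\<integral>\<^sup>+h. f (?c + h) \<partial>p ?H) = (\<integral>\<^sup>+h. f (?c + ((- ?c + c) + h)) \<partial>p ?H)"
    by (rule nn_integral_translate[symmetric, OF haar_measure_onD(4)[OF haar_p[OF H] h] haar_measure_onD(1)[OF haar_p[OF H]],
          of "\<lambda>h. f (?c + h)"]) measurable
  then show ?thesis unfolding coset_integral_def by (simp only: add.assoc add_minus_cancel)
qed

lemma coset_nonempty:
  assumes "C \<in> closed_subgroup_cosets" shows "\<exists>c. c \<in> (C :: 'a set)"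
proof -
  obtain g H where H: "H \<in> closed_subgroups" "C = left_translate g H"
    by (rule closed_subgroup_cosetsE[OF assms]) (rule that)
  then have "g \<in> C" using closed_subgroupsD(2)[OF H(1)] by (simp add: mem_left_translate)
  then show ?thesis by (rule exI)
qed

lemma coset_integral_translate:
  assumes C: "C \<in> closed_subgroup_cosets" and [measurable]: "f \<in> borel_measurable borel"
  shows "coset_integral (left_translate g C) f = coset_integral C (\<lambda>x. f (g + x))"
proof -
  obtain c where c: "c \<in> C" using coset_nonempty[OF C] by auto
  then have "g + c \<in> left_translate g C" by (simp add: mem_left_translate)
  then have "coset_integral (left_translate g C) f = (\<integral>\<^sup>+h. f (g + c + h) \<partial>p (differences C))"
    using coset_integral_eq[OF left_translate_coset_in_cosets[OF C]] by simp
  also have "\<dots> = coset_integral C (\<lambda>x. f (g + x))"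
    using coset_integral_eq[OF C c, of "\<lambda>x. f (g + x)"] by (simp add: add.assoc)
  finally show ?thesis .
qed

text \<open>
  The left coset \<open>g + conjugate (- g) K\<close> is the right coset \<open>K + g\<close>. The conjugate by \<open>g\<close> of the Haar
  measure of \<open>conjugate (- g) K\<close> is a Haar measure of \<open>K\<close>, so uniqueness applies. The factor depends on \<open>g\<close>
  but not on the integrand.
\<close>

lemma coset_integral_right_coset:
  assumes K: "K \<in> closed_subgroups"
  obtains s :: ennreal where "0 < s" "s < \<infinity>"
    "\<And>f. f \<in> borel_measurable borel \<Longrightarrow>
      coset_integral (left_translate g (conjugate (- g) K)) f = s * (\<integral>\<^sup>+x. f (x + g) \<partial>p K)"
proof -
  let ?H = "conjugate (- g) K" and ?c = "\<lambda>x. g + x - g"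
  have H: "?H \<in> closed_subgroups" by (rule conjugate_in_closed_subgroups[OF K])
  have "conjugate g ?H = K" by (simp add: conjugate_conjugate) (simp add: conjugate_def)
  then have c: "haar_measure_on K (distr (p ?H) borel ?c)"
    using haar_measure_conjugate[OF haar_p[OF H] H, of g] by simp
  obtain s where s: "0 < s" "s < \<infinity>"
    "\<And>f. f \<in> borel_measurable borel \<Longrightarrow> (\<integral>\<^sup>+x. f x \<partial>distr (p ?H) borel ?c) = s * (\<integral>\<^sup>+x. f x \<partial>p K)"
    by (rule haar_measure_unique[OF lc K haar_p[OF K] c]) (rule that)
  show ?thesis
  proof (rule that[OF s(1,2)])
    fix f :: "'a \<Rightarrow> ennreal" assume [measurable]: "f \<in> borel_measurable borel"
    note [measurable_cong] = haar_measure_onD(1)[OF haar_p[OF H]]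
    have "g \<in> left_translate g ?H" using closed_subgroupsD(2)[OF H] by (simp add: mem_left_translate)
    then have "coset_integral (left_translate g ?H) f = (\<integral>\<^sup>+h. f (g + h) \<partial>p ?H)"
      using coset_integral_eq[OF left_translate_in_cosets[OF H]] differences_subgroup[OF H] by simp
    also have "\<dots> = (\<integral>\<^sup>+h. f (?c h + g) \<partial>p ?H)" by simp
    also have "\<dots> = (\<integral>\<^sup>+x. f (x + g) \<partial>distr (p ?H) borel ?c)"
      by (rule nn_integral_distr[symmetric]) measurable
    also have "\<dots> = s * (\<integral>\<^sup>+x. f (x + g) \<partial>p K)" by (rule s(3)) measurable
    finally show "coset_integral (left_translate g ?H) f = s * (\<integral>\<^sup>+x. f (x + g) \<partial>p K)" .
  qed
qed

lemma translate_integral_le: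
  assumes H: "H \<in> closed_subgroups"
  shows "(\<integral>\<^sup>+h. f0 (y + h) \<partial>p H) \<le> emeasure (p H) (differences S)"
proof -
  have meas: "{h. y + h \<in> S} \<in> sets borel"
    using f0_support(1) by (intro borel_closed closed_vimage_continuous continuous_intros compact_imp_closed)
  have "(\<integral>\<^sup>+h. f0 (y + h) \<partial>p H) \<le> (\<integral>\<^sup>+h. indicator {h. y + h \<in> S} h \<partial>p H)"
    using f0_range(2) f0_support(2) by (intro nn_integral_mono) (auto simp: indicator_def)
  also have "\<dots> = emeasure (p H) {h. y + h \<in> S}"
    using meas haar_measure_onD(1)[OF haar_p[OF H]] by (intro nn_integral_indicator) simp
  also have "\<dots> \<le> emeasure (p H) (differences S)"
    by (rule haar_translate_bound[OF haar_p[OF H] H f0_support(1)])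
  finally show ?thesis .
qed

lemma \<psi>_pos: "0 < \<psi> y"
proof -
  have "open {z. - z + y \<in> {x. 0 < f0 x}}"
    using f0_continuous by (intro open_vimage_continuous open_Collect_less continuous_intros)
  moreover have "y \<in> {z. - z + y \<in> {x. 0 < f0 x}}" by (simp add: f0_at_0)
  ultimately obtain i where i: "0 < f0 (- q i + y)" using q_dense by blast
  have "0 < ennreal ((1/2)^i) * ennreal (f0 (- q i + y))"
    using i by (simp add: ennreal_zero_less_mult_iff)
  also have "\<dots> \<le> \<psi> y"
    unfolding \<psi>_def using sum_le_suminf[OF summableI, of "{i}" "\<lambda>i. ennreal ((1/2)^i) * ennreal (f0 (- q i + y))"] by simp
  finally show ?thesis .
qed

lemma half_powers_suminf: "(\<Sum>i. ennreal ((1/2)^i) * r) = 2 * r"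
proof -
  have "(\<Sum>i. ennreal ((1/2)^i)) = ennreal 2"
    using geometric_sums[of "1/2::real"] by (intro suminf_ennreal_eq) auto
  then show ?thesis by simp
qed

lemma \<psi>_integral:
  assumes "sets M = sets borel"
  shows "(\<integral>\<^sup>+h. \<psi> (y + h) \<partial>M) = (\<Sum>i. ennreal ((1/2)^i) * (\<integral>\<^sup>+h. f0 (- q i + (y + h)) \<partial>M))"
proof -
  note [measurable_cong] = assms
  have "(\<integral>\<^sup>+h. \<psi> (y + h) \<partial>M) = (\<Sum>i. \<integral>\<^sup>+h. ennreal ((1/2)^i) * ennreal (f0 (- q i + (y + h))) \<partial>M)"
    unfolding \<psi>_def by (rule nn_integral_suminf) measurable
  also have "\<dots> = (\<Sum>i. ennreal ((1/2)^i) * (\<integral>\<^sup>+h. f0 (- q i + (y + h)) \<partial>M))"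
    by (intro suminf_cong nn_integral_cmult) measurable
  finally show ?thesis .
qed

lemma \<psi>_integral_pos_finite:
  assumes H: "H \<in> closed_subgroups"
  shows "0 < (\<integral>\<^sup>+h. \<psi> (y + h) \<partial>p H)" "(\<integral>\<^sup>+h. \<psi> (y + h) \<partial>p H) < \<infinity>"
proof -
  note hp = haar_p[OF H]
  note [measurable_cong] = haar_measure_onD(1)[OF hp]
  have "(\<integral>\<^sup>+h. \<psi> (y + h) \<partial>p H) \<le> (\<Sum>i. ennreal ((1/2)^i) * emeasure (p H) (differences S))"
    unfolding \<psi>_integral[OF haar_measure_onD(1)[OF hp]]
    using translate_integral_le[OF H] by (intro suminf_le) (auto simp: add.assoc[symmetric] intro!: mult_left_mono)
  also have "\<dots> = 2 * emeasure (p H) (differences S)" by (rule half_powers_suminf)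
  also have "\<dots> < \<infinity>" using haar_measure_onD(5)[OF hp compact_differences[OF f0_support(1)]] by (simp add: ennreal_mult_less_top)
  finally show "(\<integral>\<^sup>+h. \<psi> (y + h) \<partial>p H) < \<infinity>" .
  show "0 < (\<integral>\<^sup>+h. \<psi> (y + h) \<partial>p H)"
    by (rule haar_integral_pos[OF hp _ open_UNIV UNIV_I \<psi>_pos]) measurable
qed

lemma coset_weight_pos_finite:
  assumes C: "C \<in> closed_subgroup_cosets" shows "0 < coset_integral C \<psi>" "coset_integral C \<psi> < \<infinity>"
proof -
  obtain c where c: "c \<in> C" using coset_nonempty[OF C] by auto
  have "differences C \<in> closed_subgroups" using coset_eq_translate_differences(2)[OF C c] .
  then show "0 < coset_integral C \<psi>" "coset_integral C \<psi> < \<infinity>"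
    using \<psi>_integral_pos_finite coset_integral_eq[OF C c] by simp_all
qed

lemma measurable_thickening_indicator:
  assumes V: "open (V :: 'a set)"
  shows "(\<lambda>(C, x). indicator (thickening V C) x :: ennreal) \<in> borel_measurable (cos_borel \<Otimes>\<^sub>M borel)"
proof -
  have eq: "(\<lambda>(C, x). indicator (thickening V C) x :: ennreal) = indicator {p. \<exists>c\<in>fst p. - c + snd p \<in> V}"
    by (auto simp: fun_eq_iff thickening_def indicator_def)
  have "{p. \<exists>c\<in>fst p. - c + snd p \<in> V} \<inter> space (cos_borel \<Otimes>\<^sub>M borel) \<in> sets (cos_borel \<Otimes>\<^sub>M borel)"
    using measurable_thickening_cos[OF V] by (rule back_subst[of "\<lambda>A. A \<in> _"]) auto
  then show ?thesis unfolding eq by (subst borel_measurable_indicator_iff)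
qed

lemma measurable_thickening_integral:
  assumes V: "open (V :: 'a set)" and [measurable]: "f \<in> borel_measurable borel"
  shows "(\<lambda>C. \<integral>\<^sup>+x. f x * indicator (thickening V C) x \<partial>p UNIV) \<in> borel_measurable cos_borel"
proof -
  note hp = haar_p[OF UNIV_closed_subgroup]
  interpret sigma_finite_measure "p UNIV" by (rule haar_sigma_finite[OF lc hp])
  note [measurable_cong] = haar_measure_onD(1)[OF hp]
  have [measurable]: "(\<lambda>(C, x). indicator (thickening V C) x :: ennreal) \<in> borel_measurable (cos_borel \<Otimes>\<^sub>M borel)"
    by (rule measurable_thickening_indicator[OF V])
  have "(\<lambda>(C, x). f x * (case (C, x) of (C, x) \<Rightarrow> indicator (thickening V C) x)) \<in> borel_measurable (cos_borel \<Otimes>\<^sub>M p UNIV)"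
    by measurable
  then show ?thesis by (intro borel_measurable_nn_integral) simp
qed

text \<open>
  Both thickenings in the limit formula depend measurably on the coset: that of \<open>C\<close> itself in the numerator and that of
  the subgroup \<open>differences C\<close> in the denominator, which carries the normalization.
\<close>

lemma measurable_coset_integral_continuous:
  assumes f: "continuous_on UNIV f" "\<And>x. 0 \<le> f x" "compact T" "\<And>x. x \<notin> T \<Longrightarrow> f x = 0"
  shows "(\<lambda>C. coset_integral C (\<lambda>x. ennreal (f x))) \<in> borel_measurable cos_borel"
proof -
  obtain V :: "nat \<Rightarrow> 'a set" where V: "\<And>n. open (V n)" "\<And>n. 0 \<in> V n"
      "\<And>S. open S \<Longrightarrow> 0 \<in> S \<Longrightarrow> \<forall>\<^sub>F n in sequentially. V n \<subseteq> S"
    by (rule countable_basis_at_decseq[of "0::'a"]) (rule that)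
  have [measurable]: "f \<in> borel_measurable borel" using f(1) by (rule borel_measurable_continuous_onI)
  let ?N = "\<lambda>n C. \<integral>\<^sup>+x. ennreal (f x) * indicator (thickening (V n) C) x \<partial>p UNIV"
  let ?D = "\<lambda>n C. \<integral>\<^sup>+x. ennreal (f0 x) * indicator (thickening (V n) C) x \<partial>p UNIV"
  note hm = haar_p[OF UNIV_closed_subgroup]
  have N: "?N n \<in> borel_measurable cos_borel" for n by (rule measurable_thickening_integral[OF V(1)]) measurable
  have D: "?D n \<in> borel_measurable cos_borel" for n by (rule measurable_thickening_integral[OF V(1)]) measurable
  have DD: "(\<lambda>C. ?D n (differences C)) \<in> borel_measurable cos_borel" for n
    by (rule measurable_compose[OF measurable_differences D])
  have lim: "(\<lambda>n. enn2real (?N n C) / enn2real (?D n (differences C))) \<longlonglongrightarrow> enn2real (coset_integral C f)"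
    and fin: "coset_integral C f < \<infinity>" if "C \<in> space cos_borel" for C
  proof -
    have C: "C \<in> closed_subgroup_cosets" using that by simp
    then obtain c where c: "c \<in> C" using coset_nonempty by auto
    let ?H = "differences C"
    have H: "?H \<in> closed_subgroups" and Ceq: "C = left_translate c ?H"
      using coset_eq_translate_differences[OF C c] by auto
    have ci: "coset_integral C f = (\<integral>\<^sup>+h. f (c + h) \<partial>p ?H)" by (rule coset_integral_eq[OF C c]) measurable
    let ?f = "\<lambda>x. f (c + x)"
    have g: "continuous_on UNIV ?f"
      by (rule continuous_on_compose2[OF f(1)]) (auto intro!: continuous_intros)
    have T: "compact ((+) (- c) ` T)" by (rule compact_translate[OF f(3)])
    have supp: "?f x = 0" if "x \<notin> (+) (- c) ` T" for x
      using that f(4)[of "c + x"] by (simp add: mem_translate)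
    have "?N n C = (\<integral>\<^sup>+x. ennreal (?f x) * indicator (thickening (V n) ?H) x \<partial>p UNIV)" for n
    proof -
      have [measurable]: "thickening (V n) C \<in> sets borel" using open_thickening[OF V(1)] by auto
      have th: "c + x \<in> thickening (V n) C \<longleftrightarrow> x \<in> thickening (V n) ?H" for x
      proof -
        have "- (c + h) + (c + x) = - h + x" for h by (simp only: minus_add add.assoc minus_add_cancel)
        then show ?thesis by (subst Ceq) (auto simp: thickening_def left_translate_def)
      qed
      have "?N n C = (\<integral>\<^sup>+x. ennreal (f (c + x)) * indicator (thickening (V n) C) (c + x) \<partial>p UNIV)"
        by (rule nn_integral_translate[symmetric, OF haar_measure_onD(4)[OF hm UNIV_I] haar_measure_onD(1)[OF hm],
              of "\<lambda>x. ennreal (f x) * indicator (thickening (V n) C) x"]) measurable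
      then show ?thesis using th by (simp add: indicator_def)
    qed
    moreover have "(\<lambda>n. enn2real (\<integral>\<^sup>+x. ennreal (?f x) * indicator (thickening (V n) ?H) x \<partial>p UNIV) / enn2real (?D n ?H))
        \<longlonglongrightarrow> enn2real (\<integral>\<^sup>+h. ?f h \<partial>p ?H)"
      by (rule thickening_ratio_tendsto[OF lc H haar_p[OF H] hm g f(2) T supp f0_continuous f0_range(1) f0_support
            p_normalized[OF H] V])
    ultimately show "(\<lambda>n. enn2real (?N n C) / enn2real (?D n ?H)) \<longlonglongrightarrow> enn2real (coset_integral C f)"
      unfolding ci by simp
    show "coset_integral C f < \<infinity>" unfolding ci by (rule haar_integral_finite[OF haar_p[OF H] g T supp])
  qed
  have "(\<lambda>C. enn2real (coset_integral C f)) \<in> borel_measurable cos_borel"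
  proof (rule borel_measurable_LIMSEQ_real[OF lim])
    note [measurable] = N DD
    show "(\<lambda>C. enn2real (?N n C) / enn2real (?D n (differences C))) \<in> borel_measurable cos_borel" for n
      by measurable
  qed
  then have "(\<lambda>C. ennreal (enn2real (coset_integral C f))) \<in> borel_measurable cos_borel" by measurable
  then show ?thesis using fin by (subst measurable_cong[where g = "\<lambda>C. ennreal (enn2real (coset_integral C f))"]) auto
qed

lemma measurable_coset_weight: "(\<lambda>C. coset_integral C \<psi>) \<in> borel_measurable cos_borel"
proof -
  have m: "(\<lambda>C. coset_integral C (\<lambda>x. ennreal (f0 (- q i + x)))) \<in> borel_measurable cos_borel" for i
  proof (rule measurable_coset_integral_continuous)
    show "continuous_on UNIV (\<lambda>x. f0 (- q i + x))"
      by (rule continuous_on_compose2[OF f0_continuous]) (auto intro!: continuous_intros)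
    show "compact ((+) (q i) ` S)" by (rule compact_translate[OF f0_support(1)])
    show "f0 (- q i + x) = 0" if "x \<notin> (+) (q i) ` S" for x
      using that f0_support(2) by (simp add: mem_translate)
  qed (rule f0_range)
  have "coset_integral C \<psi> = (\<Sum>i. ennreal ((1/2)^i) * coset_integral C (\<lambda>x. ennreal (f0 (- q i + x))))"
    if "C \<in> space cos_borel" for C
  proof -
    have C: "C \<in> closed_subgroup_cosets" using that by simp
    then obtain c where c: "c \<in> C" using coset_nonempty by auto
    have H: "differences C \<in> closed_subgroups" using coset_eq_translate_differences[OF C c] by auto
    have "coset_integral C (\<lambda>x. ennreal (f0 (- q i + x))) = (\<integral>\<^sup>+h. f0 (- q i + (c + h)) \<partial>p (differences C))" for i
      by (rule coset_integral_eq[OF C c]) measurable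
    then show ?thesis
      using coset_integral_eq[OF C c \<psi>_measurable] \<psi>_integral[OF haar_measure_onD(1)[OF haar_p[OF H]], of c] by simp
  qed
  moreover have "(\<lambda>C. \<Sum>i. ennreal ((1/2)^i) * coset_integral C (\<lambda>x. ennreal (f0 (- q i + x)))) \<in> borel_measurable cos_borel"
    using m by measurable
  ultimately show ?thesis by (subst measurable_cong) auto
qed

abbreviation m :: "'a measure" where "m \<equiv> p UNIV"

abbreviation weight :: "'a set \<Rightarrow> ennreal" where "weight C \<equiv> coset_integral C \<psi>"

lemmas haar_m = haar_p[OF UNIV_closed_subgroup]

lemma sets_m [simp, measurable_cong]: "sets m = sets borel"
  by (rule haar_measure_onD(1)[OF haar_m])

lemma space_m [simp]: "space m = UNIV"
  by (rule haar_measure_onD(2)[OF haar_m])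

lemma sigma_finite_m: "sigma_finite_measure m"
  by (rule haar_sigma_finite[OF lc haar_m])

lemma m_invariant: "distr m borel ((+) k) = m"
  by (rule haar_measure_onD(4)[OF haar_m UNIV_I])

lemma measurable_weight_comp [measurable (raw)]:
  "f \<in> measurable M cos_borel \<Longrightarrow> (\<lambda>x. weight (f x)) \<in> borel_measurable M"
  by (rule measurable_compose[OF _ measurable_coset_weight])

lemma orbit_map_measurable [measurable]:
  fixes H :: "'a set"
  shows "H \<in> closed_subgroups \<Longrightarrow> (\<lambda>g. left_translate g H) \<in> measurable borel cos_borel"
  using measurable_left_translate_comp[of "\<lambda>_. H" borel "\<lambda>g. g"] by simp

section \<open>A measure on the left cosets of each closed subgroup\<close>

text \<open>
  The measure \<open>\<nu>\<^sup>H\<close> of the theorem. Dividing by the weight makes the density integrate to \<open>1\<close> over each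
  coset. This normalization is what cancels, for almost every \<open>H\<close>, the effect of translating \<open>\<psi>\<close>.
\<close>

definition coset_measure :: "'a set \<Rightarrow> 'a set measure" where
  "coset_measure H = distr (density m (\<lambda>g. \<psi> g / weight (left_translate g H))) cos_borel (\<lambda>g. left_translate g H)"

lemma sets_coset_measure [simp, measurable_cong]: "sets (coset_measure H) = sets cos_borel"
  by (simp add: coset_measure_def)

lemma space_coset_measure [simp]: "space (coset_measure H) = closed_subgroup_cosets"
  by (simp add: coset_measure_def)

lemma nn_integral_coset_measure:
  assumes H: "H \<in> closed_subgroups" and [measurable]: "F \<in> borel_measurable cos_borel"
  shows "(\<integral>\<^sup>+C. F C \<partial>coset_measure H) =
    (\<integral>\<^sup>+g. \<psi> g / weight (left_translate g H) * F (left_translate g H) \<partial>m)"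
proof -
  note [measurable] = orbit_map_measurable[OF H]
  have "(\<integral>\<^sup>+C. F C \<partial>coset_measure H) =
      (\<integral>\<^sup>+g. F (left_translate g H) \<partial>density m (\<lambda>g. \<psi> g / weight (left_translate g H)))"
    unfolding coset_measure_def by (rule nn_integral_distr) measurable
  also have "\<dots> = (\<integral>\<^sup>+g. \<psi> g / weight (left_translate g H) * F (left_translate g H) \<partial>m)"
    by (rule nn_integral_density) measurable
  finally show ?thesis .
qed

text \<open>
  Here the density of \<open>coset_measure H\<close> is at most \<open>n * \<psi> g\<close>, which is integrable. These sets
  exhaust the coset space because weights are positive.
\<close>

definition light_cosets :: "nat \<Rightarrow> 'a set set" where
  "light_cosets n = {C\<in>space cos_borel. inverse (weight C) < of_nat n}"

lemma light_cosets_measurable [measurable]: "light_cosets n \<in> sets cos_borel"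
  unfolding light_cosets_def by measurable

lemma Union_light_cosets: "(\<Union>n. light_cosets n) = closed_subgroup_cosets"
proof (intro equalityI subsetI)
  fix C :: "'a set" assume C: "C \<in> closed_subgroup_cosets"
  then have "inverse (weight C) < top"
    using coset_weight_pos_finite[OF C] by (simp add: less_top[symmetric])
  then obtain n where "inverse (weight C) < of_nat n" using ennreal_Ex_less_of_nat by blast
  then show "C \<in> (\<Union>n. light_cosets n)" using C by (auto simp: light_cosets_def)
qed (auto simp: light_cosets_def)

lemma \<psi>_integral_m: "(\<integral>\<^sup>+g. \<psi> g \<partial>m) < \<infinity>"
  using \<psi>_integral_pos_finite(2)[OF UNIV_closed_subgroup, of 0] by simp

lemma coset_measure_light_cosets:
  assumes H: "H \<in> closed_subgroups"
  shows "emeasure (coset_measure H) (light_cosets n) < \<infinity>"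
proof -
  have "emeasure (coset_measure H) (light_cosets n) = (\<integral>\<^sup>+C. indicator (light_cosets n) C \<partial>coset_measure H)"
    by simp
  also have "\<dots> = (\<integral>\<^sup>+g. \<psi> g / weight (left_translate g H) * indicator (light_cosets n) (left_translate g H) \<partial>m)"
    by (rule nn_integral_coset_measure[OF H]) measurable
  also have "\<dots> \<le> (\<integral>\<^sup>+g. of_nat n * \<psi> g \<partial>m)"
  proof (rule nn_integral_mono)
    fix g
    show "\<psi> g / weight (left_translate g H) * indicator (light_cosets n) (left_translate g H) \<le> of_nat n * \<psi> g"
    proof (cases "left_translate g H \<in> light_cosets n")
      case True
      then have "inverse (weight (left_translate g H)) \<le> of_nat n" by (auto simp: light_cosets_def)
      then have "\<psi> g * inverse (weight (left_translate g H)) \<le> \<psi> g * of_nat n" by (rule mult_left_mono) simp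
      then show ?thesis using True by (simp add: divide_ennreal_def mult.commute)
    qed simp
  qed
  also have "\<dots> = of_nat n * (\<integral>\<^sup>+g. \<psi> g \<partial>m)" by (rule nn_integral_cmult) measurable
  also have "\<dots> < \<infinity>" using \<psi>_integral_m by (simp add: ennreal_mult_less_top of_nat_less_top)
  finally show ?thesis .
qed

lemma sigma_finite_coset_measure:
  assumes H: "H \<in> closed_subgroups" shows "sigma_finite_measure (coset_measure H)"
proof
  show "\<exists>A. countable A \<and> A \<subseteq> sets (coset_measure H) \<and> \<Union> A = space (coset_measure H) \<and>
      (\<forall>a\<in>A. emeasure (coset_measure H) a \<noteq> \<infinity>)"
    using Union_light_cosets coset_measure_light_cosets[OF H]
    by (intro exI[of _ "range light_cosets"]) (auto simp: less_top[symmetric])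
qed

text \<open>
  The mass of the preimage of \<open>B\<close> under translation by \<open>k\<close>, written as an integral over the group so that it is visibly
  jointly measurable in \<open>k\<close> and \<open>H\<close>.
\<close>

definition translate_mass :: "'a set set \<Rightarrow> 'a \<Rightarrow> 'a set \<Rightarrow> ennreal" where
  "translate_mass B k H = (\<integral>\<^sup>+g. \<psi> g / weight (left_translate g H) * indicator B (left_translate (k + g) H) \<partial>m)"

lemma measurable_translate_mass:
  assumes [measurable]: "B \<in> sets cos_borel"
  shows "(\<lambda>(k, H). translate_mass B k H) \<in> borel_measurable (borel \<Otimes>\<^sub>M sub_borel)"
proof -
  interpret sigma_finite_measure m by (rule sigma_finite_m)
  have "(\<lambda>(x, g). \<psi> g / weight (left_translate g (snd x)) * indicator B (left_translate (fst x + g) (snd x)))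
      \<in> borel_measurable ((borel \<Otimes>\<^sub>M sub_borel) \<Otimes>\<^sub>M m)"
    by measurable
  then have "(\<lambda>x. \<integral>\<^sup>+g. \<psi> g / weight (left_translate g (snd x)) * indicator B (left_translate (fst x + g) (snd x)) \<partial>m)
      \<in> borel_measurable (borel \<Otimes>\<^sub>M sub_borel)"
    by (rule borel_measurable_nn_integral)
  then show ?thesis unfolding translate_mass_def case_prod_beta .
qed

lemma emeasure_translate_coset_measure:
  assumes H: "H \<in> closed_subgroups" and B [measurable]: "B \<in> sets cos_borel"
  shows "emeasure (distr (coset_measure H) (coset_measure H) (left_translate k)) B = translate_mass B k H"
proof -
  note [measurable] = left_translate_measurable
  have "emeasure (distr (coset_measure H) (coset_measure H) (left_translate k)) B =
      (\<integral>\<^sup>+C. indicator B C \<partial>distr (coset_measure H) (coset_measure H) (left_translate k))" by simp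
  also have "\<dots> = (\<integral>\<^sup>+C. indicator B (left_translate k C) \<partial>coset_measure H)"
    by (rule nn_integral_distr) measurable
  also have "\<dots> = (\<integral>\<^sup>+g. \<psi> g / weight (left_translate g H) * indicator B (left_translate k (left_translate g H)) \<partial>m)"
    by (rule nn_integral_coset_measure[OF H]) measurable
  finally show ?thesis unfolding translate_mass_def left_translate_left_translate .
qed

lemma emeasure_coset_measure:
  assumes H: "H \<in> closed_subgroups" and B [measurable]: "B \<in> sets cos_borel"
  shows "emeasure (coset_measure H) B = translate_mass B 0 H"
proof -
  have "emeasure (coset_measure H) B = (\<integral>\<^sup>+C. indicator B C \<partial>coset_measure H)" by simp
  also have "\<dots> = (\<integral>\<^sup>+g. \<psi> g / weight (left_translate g H) * indicator B (left_translate g H) \<partial>m)"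
    by (rule nn_integral_coset_measure[OF H]) measurable
  finally show ?thesis unfolding translate_mass_def by simp
qed

section \<open>Averaging over a conjugation invariant measure on subgroups\<close>

text \<open>
  The auxiliary weight \<open>u\<close> of the quotient formula. The reflected translates \<open>f0 (- q i + (- x + g))\<close> are bounded
  uniformly in \<open>g\<close> but not in \<open>i\<close>, so the coefficients have to depend on \<open>K\<close> and \<open>i\<close>.
\<close>

lemma integrable_weight_exists:
  assumes K: "K \<in> closed_subgroups"
  obtains u :: "'a \<Rightarrow> ennreal" where "u \<in> borel_measurable borel"
    "\<And>g. 0 < (\<integral>\<^sup>+x. u (- x + g) \<partial>p K)" "\<And>g. (\<integral>\<^sup>+x. u (- x + g) \<partial>p K) < \<infinity>"
proof -
  note hp = haar_p[OF K]
  note [measurable_cong] = haar_measure_onD(1)[OF hp]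
  define T where "T i = (\<lambda>s. - (q i + s)) ` S" for i
  have T: "compact (T i)" for i
    unfolding T_def using f0_support(1) by (intro compact_continuous_image continuous_intros)
  \<comment> \<open>dividing by c i brings the integral of the i-th translate below 1; the summand 1 keeps c i nonzero\<close>
  define c where "c i = 1 + emeasure (p K) (differences (T i))" for i
  have c: "0 < c i" "c i < \<infinity>" for i
    using haar_measure_onD(5)[OF hp compact_differences[OF T]] by (simp_all add: c_def add_pos_nonneg ennreal_add_less_top)
  define u where "u y = (\<Sum>i. ennreal ((1/2)^i) * (ennreal (f0 (- q i + y)) / c i))" for y
  have u [measurable]: "u \<in> borel_measurable borel" unfolding u_def by measurable
  have u_pos: "0 < u y" for y
  proof (rule ccontr)
    assume "\<not> 0 < u y"
    then have "u y = 0" by simp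
    then have zero: "ennreal ((1/2)^i) * (ennreal (f0 (- q i + y)) / c i) = 0" for i
      unfolding u_def by (simp add: suminf_eq_zero_iff summableI)
    have "ennreal (f0 (- q i + y)) = 0" for i
      using zero[of i] c[of i] by (auto simp: ennreal_divide_eq_0_iff)
    then have "\<psi> y = 0" unfolding \<psi>_def by simp
    then show False using \<psi>_pos[of y] by simp
  qed
  show ?thesis
  proof (rule that[OF u])
    fix g
    show "0 < (\<integral>\<^sup>+x. u (- x + g) \<partial>p K)"
      by (rule haar_integral_pos[OF hp _ open_UNIV UNIV_I u_pos]) measurable
    have bound: "(\<integral>\<^sup>+x. f0 (- q i + (- x + g)) \<partial>p K) \<le> c i" for i
    proof -
      have meas: "{x. - g + x \<in> T i} \<in> sets borel"
        using T by (intro borel_closed closed_vimage_continuous continuous_intros compact_imp_closed)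
      have "(\<integral>\<^sup>+x. f0 (- q i + (- x + g)) \<partial>p K) \<le> (\<integral>\<^sup>+x. indicator {x. - g + x \<in> T i} x \<partial>p K)"
      proof (rule nn_integral_mono)
        fix x show "ennreal (f0 (- q i + (- x + g))) \<le> indicator {x. - g + x \<in> T i} x"
        proof (cases "- q i + (- x + g) \<in> S")
          case True
          have "- g + x = - (q i + (- q i + (- x + g)))" by (simp only: add_minus_cancel minus_add minus_minus)
          then have "- g + x \<in> T i" unfolding T_def using True by (rule image_eqI)
          then show ?thesis using f0_range(2) by simp
        qed (simp add: f0_support(2))
      qed
      also have "\<dots> = emeasure (p K) {x. - g + x \<in> T i}"
        using meas haar_measure_onD(1)[OF hp] by (intro nn_integral_indicator) simp
      also have "\<dots> \<le> emeasure (p K) (differences (T i))" by (rule haar_translate_bound[OF hp K T])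
      also have "\<dots> \<le> c i" by (simp add: c_def)
      finally show ?thesis .
    qed
    have "(\<integral>\<^sup>+x. u (- x + g) \<partial>p K) = (\<Sum>i. \<integral>\<^sup>+x. ennreal ((1/2)^i) * (ennreal (f0 (- q i + (- x + g))) / c i) \<partial>p K)"
      unfolding u_def by (rule nn_integral_suminf) measurable
    also have "\<dots> = (\<Sum>i. ennreal ((1/2)^i) * ((\<integral>\<^sup>+x. f0 (- q i + (- x + g)) \<partial>p K) / c i))"
      by (intro suminf_cong) (simp add: nn_integral_cmult nn_integral_divide)
    also have "\<dots> \<le> (\<Sum>i. ennreal ((1/2)^i) * 1)"
    proof (intro suminf_le mult_left_mono summableI)
      fix i
      have "(\<integral>\<^sup>+x. f0 (- q i + (- x + g)) \<partial>p K) / c i \<le> c i / c i"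
        using bound by (rule divide_right_mono_ennreal)
      also have "c i / c i = 1" using c[of i] by (intro ennreal_divide_self) auto
      finally show "(\<integral>\<^sup>+x. f0 (- q i + (- x + g)) \<partial>p K) / c i \<le> 1" .
    qed simp
    also have "\<dots> = 2 * 1" by (rule half_powers_suminf)
    also have "\<dots> < \<infinity>" by simp
    finally show "(\<integral>\<^sup>+x. u (- x + g) \<partial>p K) < \<infinity>" .
  qed
qed

text \<open>
  For a fixed subgroup \<open>K\<close>, translating the density by \<open>k\<close> does not change the mass it assigns to sets of right cosets
  \<open>R g = K + g\<close>. By the quotient formula only its average over \<open>K + g\<close> matters. This average is a quotient of two integrals of
  \<open>x \<mapsto> \<psi> (- k + x)\<close>: against the translate by \<open>g\<close> of the Haar measure of \<open>K\<close>, and against the coset integral of \<open>K + g\<close>.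
  These two measures are proportional with a factor \<open>s\<close> that does not involve \<open>k\<close>, so the average is \<open>1 / s\<close>.
\<close>

lemma right_coset_mass_invariant:
  assumes K: "K \<in> closed_subgroups" and A [measurable]: "A \<in> sets sub_borel" and B [measurable]: "B \<in> sets cos_borel"
  defines "R \<equiv> \<lambda>g. left_translate g (conjugate (- g) K)"
    and "b \<equiv> \<lambda>g. indicator A (conjugate (- g) K) * indicator B (left_translate g (conjugate (- g) K)) :: ennreal"
  shows "(\<integral>\<^sup>+g. \<psi> (- k + g) / weight (left_translate (- k) (R g)) * b g \<partial>m) =
    (\<integral>\<^sup>+g. \<psi> (- l + g) / weight (left_translate (- l) (R g)) * b g \<partial>m)"
proof -
  note hp = haar_p[OF K]
  note [measurable_cong] = haar_measure_onD(1)[OF hp]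
  have Kc: "(\<lambda>g::'a. K) \<in> measurable borel sub_borel" using K by simp
  note [measurable] = Kc
  obtain u where u: "u \<in> borel_measurable borel"
    "\<And>g. 0 < (\<integral>\<^sup>+x. u (- x + g) \<partial>p K)" "\<And>g. (\<integral>\<^sup>+x. u (- x + g) \<partial>p K) < \<infinity>"
    by (rule integrable_weight_exists[OF K]) (rule that)
  have conj_inv: "conjugate (- (x + g)) K = conjugate (- g) K" if "x \<in> K" for x g
    using conjugate_by_member[OF K that] by (simp only: minus_add conjugate_conjugate[symmetric])
  have R_inv: "R (x + g) = R g" if x: "x \<in> K" for x g
  proof -
    have "(\<lambda>y. y + (x + g)) ` K = (\<lambda>y. y + g) ` (\<lambda>y. y + x) ` K" by (simp add: image_image add.assoc)
    also have "(\<lambda>y. y + x) ` K = K"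
    proof (intro equalityI subsetI)
      fix y assume "y \<in> K"
      then have "y + - x \<in> K" using closed_subgroupsD(3,4)[OF K] x by blast
      then have "y - x \<in> K" by simp
      then show "y \<in> (\<lambda>y. y + x) ` K" by (intro image_eqI[of _ _ "y - x"]) auto
    qed (use closed_subgroupsD(3)[OF K] x in auto)
    finally show ?thesis unfolding R_def right_coset_eq .
  qed
  have R_coset: "R g \<in> closed_subgroup_cosets" for g
    unfolding R_def by (intro left_translate_in_cosets conjugate_in_closed_subgroups K)
  have [measurable]: "b \<in> borel_measurable borel" unfolding b_def by measurable
  have w [measurable]: "(\<lambda>g. \<psi> (- k + g) / weight (left_translate (- k) (R g))) \<in> borel_measurable borel" for k
    unfolding R_def left_translate_left_translate by measurable
  have formula: "(\<integral>\<^sup>+g. \<psi> (- k + g) / weight (left_translate (- k) (R g)) * b g \<partial>m) =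
      (\<integral>\<^sup>+g. u g * (b g / (\<integral>\<^sup>+x. u (- x + g) \<partial>p K)) *
        (\<integral>\<^sup>+x. \<psi> (- k + (x + g)) / weight (left_translate (- k) (R (x + g))) \<partial>p K) \<partial>m)" for k
  proof (rule quotient_integral_formula[where K = K])
    show "sigma_finite_measure (p K)" by (rule haar_sigma_finite[OF lc hp])
    show "sigma_finite_measure m" by (rule sigma_finite_m)
    show "AE x in p K. x \<in> K" by (rule haar_AE_mem[OF hp closed_subgroupsD(1)[OF K]])
    show "b (x + g) = b g" if "x \<in> K" for x g
      using conj_inv[OF that] R_inv[OF that] unfolding b_def R_def by simp
    show "0 < (\<integral>\<^sup>+x. u (- x + g) \<partial>p K) \<and> (\<integral>\<^sup>+x. u (- x + g) \<partial>p K) < \<infinity>" for g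
      using u by simp
    show "distr m borel ((+) k) = m" for k by (rule m_invariant)
  qed (use u haar_measure_onD[OF hp] in \<open>auto intro: w\<close>)
  \<comment> \<open>the weight in the denominator is constant on the right coset and equals s times the integral of the numerator\<close>
  have average: "(\<integral>\<^sup>+x. \<psi> (- k + (x + g)) / weight (left_translate (- k) (R (x + g))) \<partial>p K) = 1 / s"
    if s: "0 < s" "s < \<infinity>" "\<And>f. f \<in> borel_measurable borel \<Longrightarrow> coset_integral (R g) f = s * (\<integral>\<^sup>+x. f (x + g) \<partial>p K)"
    for k g s
  proof -
    let ?I = "\<integral>\<^sup>+x. \<psi> (- k + (x + g)) \<partial>p K"
    have j: "weight (left_translate (- k) (R g)) = s * ?I"
      using coset_integral_translate[OF R_coset \<psi>_measurable, of "- k" g] s(3)[of "\<lambda>x. \<psi> (- k + x)"] by simp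
    have I: "0 < s * ?I" "s * ?I < \<infinity>"
      using coset_weight_pos_finite[OF left_translate_coset_in_cosets[OF R_coset], of "- k" g] unfolding j by auto
    then have I': "0 < ?I" "?I < \<infinity>" using s(1,2) by (auto simp: ennreal_zero_less_mult_iff ennreal_mult_less_top)
    have "(\<integral>\<^sup>+x. \<psi> (- k + (x + g)) / weight (left_translate (- k) (R (x + g))) \<partial>p K) =
        (\<integral>\<^sup>+x. \<psi> (- k + (x + g)) / (s * ?I) \<partial>p K)"
      using haar_AE_mem[OF hp closed_subgroupsD(1)[OF K]] R_inv j
      by (intro nn_integral_cong_AE) auto
    also have "\<dots> = ?I / (s * ?I)" by (rule nn_integral_divide) measurable
    also have "\<dots> = 1 / s"
    proof -
      obtain i r where ir: "?I = ennreal i" "s = ennreal r" "0 < i" "0 < r"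
        using I' s(1,2) by (cases ?I; cases s) auto
      have "ennreal i / (ennreal r * ennreal i) = ennreal (i / (r * i))"
        using ir(3,4) by (simp add: divide_ennreal flip: ennreal_mult)
      also have "i / (r * i) = 1 / r" using ir(3) by simp
      also have "ennreal (1 / r) = 1 / ennreal r"
        using divide_ennreal[of 1 r] ir(4) by simp
      finally show ?thesis unfolding ir(1,2) .
    qed
    finally show ?thesis .
  qed
  have "(\<integral>\<^sup>+x. \<psi> (- k + (x + g)) / weight (left_translate (- k) (R (x + g))) \<partial>p K) =
      (\<integral>\<^sup>+x. \<psi> (- l + (x + g)) / weight (left_translate (- l) (R (x + g))) \<partial>p K)" for g
  proof -
    obtain s where s: "0 < s" "s < \<infinity>" "\<And>f. f \<in> borel_measurable borel \<Longrightarrow>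
        coset_integral (left_translate g (conjugate (- g) K)) f = s * (\<integral>\<^sup>+x. f (x + g) \<partial>p K)"
      by (rule coset_integral_right_coset[OF K, of g]) (rule that)
    have "coset_integral (R g) f = s * (\<integral>\<^sup>+x. f (x + g) \<partial>p K)" if "f \<in> borel_measurable borel" for f
      using s(3)[OF that] by (simp add: R_def)
    then show ?thesis using average[OF s(1,2), of g k] average[OF s(1,2), of g l] by simp
  qed
  then show ?thesis unfolding formula by simp
qed

text \<open>
  The heart of the proof, and the place where conjugation invariance of \<open>\<mu>\<close> enters. Substituting \<open>H = conjugate (- g) K\<close> turns
  left cosets of \<open>H\<close> into right cosets of \<open>K\<close>. Translation by \<open>k\<close> takes the right coset \<open>K + g\<close> to the right coset
  \<open>conjugate k K + (k + g)\<close>; undoing this by the measure preserving substitutions in \<open>K\<close> and in \<open>g\<close> moves \<open>k\<close> from the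
  set \<open>B\<close> into the density, where it is harmless by the preceding lemma. The set \<open>A\<close> survives because it is tested
  on \<open>H\<close>, which translation does not move.
\<close>

lemma translate_mass_integral_invariant:
  assumes sets_\<mu>: "sets \<mu> = sets sub_borel" and sf: "sigma_finite_measure \<mu>"
    and inv: "\<And>g. distr \<mu> \<mu> (conjugate g) = \<mu>"
    and A [measurable]: "A \<in> sets sub_borel" and B [measurable]: "B \<in> sets cos_borel"
  shows "(\<integral>\<^sup>+H. indicator A H * translate_mass B k H \<partial>\<mu>) = (\<integral>\<^sup>+H. indicator A H * translate_mass B 0 H \<partial>\<mu>)"
proof -
  interpret M: sigma_finite_measure m by (rule sigma_finite_m)
  interpret S: sigma_finite_measure \<mu> by (rule sf)
  interpret P: pair_sigma_finite \<mu> m ..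
  note [measurable_cong] = sets_\<mu>
  have space_\<mu>: "space \<mu> = closed_subgroups" using sets_eq_imp_space_eq[OF sets_\<mu>] by simp
  have conj_int: "(\<integral>\<^sup>+H. F (conjugate g H) \<partial>\<mu>) = (\<integral>\<^sup>+H. F H \<partial>\<mu>)"
    if [measurable]: "F \<in> borel_measurable sub_borel" for F :: "'a set \<Rightarrow> ennreal" and g :: 'a
  proof -
    have "(\<integral>\<^sup>+H. F H \<partial>distr \<mu> \<mu> (conjugate g)) = (\<integral>\<^sup>+H. F (conjugate g H) \<partial>\<mu>)"
      by (rule nn_integral_distr) measurable
    then show ?thesis using inv by simp
  qed
  \<comment> \<open>J is the integrand in left coset coordinates, W the one in right coset coordinates\<close>
  let ?J = "\<lambda>k H g. indicator A H * (\<psi> g / weight (left_translate g H) * indicator B (left_translate (k + g) H)) :: ennreal"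
  let ?W = "\<lambda>k K g. \<psi> (- k + g) / weight (left_translate (- k) (left_translate g (conjugate (- g) K))) *
      (indicator A (conjugate (- g) K) * indicator B (left_translate g (conjugate (- g) K))) :: ennreal"
  have "(\<integral>\<^sup>+H. indicator A H * translate_mass B k H \<partial>\<mu>) = (\<integral>\<^sup>+K. (\<integral>\<^sup>+g. ?W k K g \<partial>m) \<partial>\<mu>)" for k
  proof -
    have "(\<integral>\<^sup>+H. indicator A H * translate_mass B k H \<partial>\<mu>) = (\<integral>\<^sup>+H. (\<integral>\<^sup>+g. ?J k H g \<partial>m) \<partial>\<mu>)"
    proof (rule nn_integral_cong)
      fix H assume "H \<in> space \<mu>"
      then have Hc: "(\<lambda>g::'a. H) \<in> measurable borel sub_borel" using space_\<mu> by simp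
      note [measurable] = Hc
      show "indicator A H * translate_mass B k H = (\<integral>\<^sup>+g. ?J k H g \<partial>m)"
        unfolding translate_mass_def by (rule nn_integral_cmult[symmetric]) measurable
    qed
    also have "\<dots> = (\<integral>\<^sup>+g. (\<integral>\<^sup>+H. ?J k H g \<partial>\<mu>) \<partial>m)"
      by (rule P.Fubini'[symmetric]) measurable
    \<comment> \<open>invariance under the single conjugation by - g, for each g separately\<close>
    also have "\<dots> = (\<integral>\<^sup>+g. (\<integral>\<^sup>+K. ?J k (conjugate (- g) K) g \<partial>\<mu>) \<partial>m)"
      by (intro nn_integral_cong conj_int[symmetric]) measurable
    also have "\<dots> = (\<integral>\<^sup>+K. (\<integral>\<^sup>+g. ?J k (conjugate (- g) K) g \<partial>m) \<partial>\<mu>)"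
      by (rule P.Fubini') measurable
    also have "\<dots> = (\<integral>\<^sup>+K. (\<integral>\<^sup>+g. ?J k (conjugate (- g) (conjugate (- k) K)) g \<partial>m) \<partial>\<mu>)"
      by (rule conj_int[symmetric]) measurable
    also have "\<dots> = (\<integral>\<^sup>+K. (\<integral>\<^sup>+g. ?W k K g \<partial>m) \<partial>\<mu>)"
    proof (rule nn_integral_cong)
      fix K assume "K \<in> space \<mu>"
      then have Kc: "(\<lambda>g::'a. K) \<in> measurable borel sub_borel" using space_\<mu> by simp
      note [measurable] = Kc
      have "(\<integral>\<^sup>+g. ?J k (conjugate (- g) (conjugate (- k) K)) g \<partial>m) =
          (\<integral>\<^sup>+g. ?J k (conjugate (- (- k + g)) (conjugate (- k) K)) (- k + g) \<partial>m)"
        by (rule nn_integral_translate[symmetric, OF m_invariant sets_m,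
              of "\<lambda>g. ?J k (conjugate (- g) (conjugate (- k) K)) g"]) measurable
      also have "\<dots> = (\<integral>\<^sup>+g. ?W k K g \<partial>m)"
      proof (rule nn_integral_cong)
        fix g
        have "- (- k + g) + - k = - g" by (simp only: minus_add minus_minus add.assoc right_minus add_0_right)
        then have "conjugate (- (- k + g)) (conjugate (- k) K) = conjugate (- g) K"
          by (simp only: conjugate_conjugate)
        then show "?J k (conjugate (- (- k + g)) (conjugate (- k) K)) (- k + g) = ?W k K g"
          by (simp only: left_translate_left_translate add_minus_cancel mult_ac)
      qed
      finally show "(\<integral>\<^sup>+g. ?J k (conjugate (- g) (conjugate (- k) K)) g \<partial>m) = (\<integral>\<^sup>+g. ?W k K g \<partial>m)" .
    qed
    finally show ?thesis .
  qed
  moreover have "(\<integral>\<^sup>+K. (\<integral>\<^sup>+g. ?W k K g \<partial>m) \<partial>\<mu>) = (\<integral>\<^sup>+K. (\<integral>\<^sup>+g. ?W 0 K g \<partial>m) \<partial>\<mu>)"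
    by (intro nn_integral_cong right_coset_mass_invariant A B) (simp add: space_\<mu>)
  ultimately show ?thesis by simp
qed

section \<open>Invariance for almost every subgroup\<close>

text \<open>
  The sets \<open>light_cosets n\<close> are added to a countable generator so that a measure that is finite on them is determined
  by its values on the pi-system.
\<close>

lemma pi_system_exists:
  obtains E :: "'a set set set" where "countable E" "Int_stable E" "E \<subseteq> sets cos_borel" "range light_cosets \<subseteq> E"
    "sets (cos_borel :: 'a set measure) = sigma_sets closed_subgroup_cosets E"
proof -
  obtain \<H> :: "'a set set set" where \<H>: "countable \<H>" "\<H> \<subseteq> sets cos_borel"
      "sets (cos_borel :: 'a set measure) = sigma_sets closed_subgroup_cosets \<H>"
    by (rule countable_generator_cos_borel) (rule that)
  let ?G = "\<H> \<union> range light_cosets"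
  let ?E = "Inter ` {F. F \<subseteq> ?G \<and> finite F \<and> F \<noteq> {}}"
  have G: "?G \<subseteq> sets cos_borel" using \<H>(2) light_cosets_measurable by auto
  have "countable {F. F \<subseteq> ?G \<and> finite F \<and> F \<noteq> {}}"
    using \<H>(1) by (intro countable_subset[OF _ countable_Collect_finite_subset[of ?G]]) auto
  then have cE: "countable ?E" by (rule countable_image)
  have stable: "Int_stable ?E"
  proof (rule Int_stableI)
    fix A B assume "A \<in> ?E" "B \<in> ?E"
    then obtain F F' where "A = \<Inter>F" "B = \<Inter>F'" "F \<subseteq> ?G" "finite F" "F \<noteq> {}" "F' \<subseteq> ?G" "finite F'" by auto
    then show "A \<inter> B \<in> ?E" by (intro image_eqI[of _ _ "F \<union> F'"]) auto
  qed
  have E: "?E \<subseteq> sets cos_borel"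
  proof
    fix A assume "A \<in> ?E"
    then obtain F where "A = \<Inter>F" "F \<subseteq> ?G" "finite F" "F \<noteq> {}" by auto
    moreover from this have "(\<Inter>X\<in>F. X) \<in> sets cos_borel" using G by (intro sets.finite_INT) auto
    ultimately show "A \<in> sets cos_borel" by simp
  qed
  have GE: "?G \<subseteq> ?E"
  proof
    fix A assume "A \<in> ?G"
    then show "A \<in> ?E" by (intro image_eqI[of _ _ "{A}"]) auto
  qed
  have "sigma_sets closed_subgroup_cosets ?E \<subseteq> sets (cos_borel :: 'a set measure)"
    using sets.sigma_sets_subset[OF E] by simp
  moreover have "sets (cos_borel :: 'a set measure) \<subseteq> sigma_sets closed_subgroup_cosets ?E"
    unfolding \<H>(3) using GE by (intro sigma_sets_mono') auto
  ultimately have "sets (cos_borel :: 'a set measure) = sigma_sets closed_subgroup_cosets ?E"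
    by (intro equalityI)
  moreover have "range light_cosets \<subseteq> ?E" using GE by (rule subset_trans[rotated]) simp
  ultimately show ?thesis using that[OF cE stable E] by simp
qed

text \<open>
  The translations that preserve the measure form a subgroup. A conull subgroup is the whole group: it meets each of its
  translates, because those are conull too.
\<close>

lemma invariant_translations_all:
  assumes H: "H \<in> closed_subgroups"
    and ae: "AE k in m. distr (coset_measure H) (coset_measure H) (left_translate k) = coset_measure H"
  shows "distr (coset_measure H) (coset_measure H) (left_translate g) = coset_measure H"
proof -
  let ?\<nu> = "coset_measure H"
  define I where "I = {k. distr ?\<nu> ?\<nu> (left_translate k) = ?\<nu>}"
  have lt: "left_translate k \<in> measurable ?\<nu> ?\<nu>" for k
    using left_translate_measurable by (simp cong: measurable_cong_sets)
  have comp: "distr (distr ?\<nu> ?\<nu> (left_translate l)) ?\<nu> (left_translate k) = distr ?\<nu> ?\<nu> (left_translate (k + l))" for k l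
    by (subst distr_distr[OF lt lt]) (simp add: comp_def left_translate_left_translate)
  have diff: "k - l \<in> I" if "k \<in> I" "l \<in> I" for k l
  proof -
    have "distr ?\<nu> ?\<nu> (left_translate (k - l)) = distr (distr ?\<nu> ?\<nu> (left_translate l)) ?\<nu> (left_translate (k - l))"
      using that(2) by (simp add: I_def)
    also have "\<dots> = ?\<nu>" unfolding comp using that(1) by (simp add: I_def)
    finally show ?thesis by (simp add: I_def)
  qed
  have "AE k in m. k \<in> I" using ae by (simp add: I_def)
  moreover have "AE k in m. g + k \<in> I"
  proof -
    have "AE k in distr m borel ((+) g). k \<in> I"
      by (subst m_invariant) (rule \<open>AE k in m. k \<in> I\<close>)
    then show ?thesis by (rule AE_distrD[rotated]) measurable
  qed
  ultimately have "AE k in m. g \<in> I"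
  proof eventually_elim
    case (elim k)
    then show ?case using diff[of "g + k" k] by (simp add: add.assoc)
  qed
  moreover have "\<not> (AE k in m. False)"
  proof
    assume "AE k in m. False"
    then have "emeasure m UNIV = 0" using AE_iff_measurable[of UNIV m "\<lambda>_. False"] by simp
    then show False using haar_measure_onD(6)[OF haar_m open_UNIV] by simp
  qed
  ultimately have "g \<in> I" by (cases "g \<in> I") auto
  then show ?thesis by (simp add: I_def)
qed

lemma coset_measure_nonzero:
  assumes H: "H \<in> closed_subgroups"
  shows "emeasure (coset_measure H) closed_subgroup_cosets \<noteq> 0"
proof -
  note [measurable] = orbit_map_measurable[OF H]
  have pos: "0 < \<psi> g / weight (left_translate g H)" for g
    using \<psi>_pos[of g] coset_weight_pos_finite[OF left_translate_in_cosets[OF H], of g]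
    by (simp add: ennreal_zero_less_divide less_top[symmetric])
  have "0 < (\<integral>\<^sup>+g. \<psi> g / weight (left_translate g H) \<partial>m)"
    by (rule haar_integral_pos[OF haar_m _ open_UNIV UNIV_I pos]) measurable
  also have "\<dots> = translate_mass (space cos_borel) 0 H"
    unfolding translate_mass_def using left_translate_in_cosets[OF H] by simp
  also have "\<dots> = emeasure (coset_measure H) (space cos_borel)"
    by (rule emeasure_coset_measure[OF H sets.top, symmetric])
  finally show ?thesis by simp
qed

lemma coset_measure_supported:
  assumes H: "H \<in> closed_subgroups"
  shows "AE C in coset_measure H. C \<in> left_cosets H"
proof -
  let ?Z = "{C \<in> space cos_borel. differences C \<noteq> H}"
  have H': "H \<in> closed_subgroup_cosets" using left_translate_in_cosets[OF H, of 0] by simp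
  have "differences -` {H} \<inter> space cos_borel \<in> sets cos_borel"
    by (rule measurable_sets[OF measurable_differences measurable_singleton_cos[OF H']])
  then have "space cos_borel - (differences -` {H} \<inter> space cos_borel) \<in> sets cos_borel"
    by (intro sets.Diff sets.top)
  moreover have "space cos_borel - (differences -` {H} \<inter> space cos_borel) = ?Z" by auto
  ultimately have Z: "?Z \<in> sets cos_borel" by simp
  show ?thesis
  proof (rule AE_I[of _ _ ?Z])
    show "?Z \<in> sets (coset_measure H)" using Z by simp
    have "C \<in> left_cosets (differences C)" if C: "C \<in> closed_subgroup_cosets" for C :: "'a set"
    proof -
      obtain c where c: "c \<in> C" using coset_nonempty[OF C] by (elim exE)
      have "C = left_translate c (differences C)" by (rule coset_eq_translate_differences(1)[OF C c])
      then show ?thesis unfolding left_cosets_def by (rule image_eqI) simp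
    qed
    then show "{C \<in> space (coset_measure H). C \<notin> left_cosets H} \<subseteq> ?Z" by auto
    have "emeasure (coset_measure H) ?Z = translate_mass ?Z 0 H" by (rule emeasure_coset_measure[OF H Z])
    also have "\<dots> = 0" unfolding translate_mass_def using differences_subgroup[OF H] by simp
    finally show "emeasure (coset_measure H) ?Z = 0" .
  qed
qed

text \<open>
  Equality of integrals over all \<open>A\<close> gives equality of densities almost everywhere, for each \<open>k\<close> and \<open>B\<close>. Fubini's theorem
  exchanges the quantifiers, so that for almost every \<open>H\<close> almost every \<open>k\<close> works, simultaneously for all
  \<open>B\<close> in a countable pi-system.
\<close>

lemma coset_measure_AE_invariant:
  assumes sets_\<mu>: "sets \<mu> = sets sub_borel" and sf: "sigma_finite_measure \<mu>"
    and inv: "\<And>g. distr \<mu> \<mu> (conjugate g) = \<mu>"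
  shows "AE H in \<mu>. \<forall>g. distr (coset_measure H) (coset_measure H) (left_translate g) = coset_measure H"
proof -
  interpret M: sigma_finite_measure m by (rule sigma_finite_m)
  interpret S: sigma_finite_measure \<mu> by (rule sf)
  interpret P: pair_sigma_finite m \<mu> ..
  note [measurable_cong] = sets_\<mu>
  have space_\<mu>: "space \<mu> = closed_subgroups" using sets_eq_imp_space_eq[OF sets_\<mu>] by simp
  obtain E :: "'a set set set" where E: "countable E" "Int_stable E" "E \<subseteq> sets cos_borel" "range light_cosets \<subseteq> E"
    "sets (cos_borel :: 'a set measure) = sigma_sets closed_subgroup_cosets E"
    by (rule pi_system_exists) (rule that)
  have "AE H in \<mu>. AE k in m. translate_mass B k H = translate_mass B 0 H" if B: "B \<in> E" for B
  proof -
    have B' [measurable]: "B \<in> sets cos_borel" using B E(3) by auto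
    have tm: "(\<lambda>(k, H). translate_mass B k H) \<in> borel_measurable (m \<Otimes>\<^sub>M \<mu>)"
      using measurable_translate_mass[OF B'] by (simp cong: measurable_cong_sets)
    have tk: "translate_mass B k \<in> borel_measurable \<mu>" for k
      using measurable_compose[OF measurable_Pair1'[of k m \<mu>] tm] by simp
    have fixed: "AE H in \<mu>. translate_mass B k H = translate_mass B 0 H" for k
    proof -
      have "density \<mu> (translate_mass B k) = density \<mu> (translate_mass B 0)"
      proof (rule measure_eqI)
        fix A assume "A \<in> sets (density \<mu> (translate_mass B k))"
        then have A: "A \<in> sets \<mu>" "A \<in> sets sub_borel" using sets_\<mu> by auto
        show "emeasure (density \<mu> (translate_mass B k)) A = emeasure (density \<mu> (translate_mass B 0)) A"
          using translate_mass_integral_invariant[OF sets_\<mu> sf inv A(2) B', of k] tk A(1)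
          by (simp add: emeasure_density mult.commute)
      qed simp
      then show ?thesis using tk by (subst (asm) S.density_unique_iff) auto
    qed
    have "(\<lambda>x. translate_mass B 0 (snd x)) \<in> borel_measurable (m \<Otimes>\<^sub>M \<mu>)"
      using measurable_compose[OF measurable_snd tk] .
    moreover have "(\<lambda>x. translate_mass B (fst x) (snd x)) \<in> borel_measurable (m \<Otimes>\<^sub>M \<mu>)"
      using tm by (simp add: case_prod_beta)
    ultimately have "{x \<in> space (m \<Otimes>\<^sub>M \<mu>). translate_mass B (fst x) (snd x) = translate_mass B 0 (snd x)} \<in> sets (m \<Otimes>\<^sub>M \<mu>)"
      by measurable
    then show ?thesis using fixed by (subst P.AE_commute[symmetric]) auto
  qed
  then have "AE H in \<mu>. \<forall>B\<in>E. AE k in m. translate_mass B k H = translate_mass B 0 H"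
    using E(1) by (subst AE_ball_countable) auto
  then show ?thesis
  proof (rule AE_mp, intro AE_I2 impI allI)
    fix H g assume "H \<in> space \<mu>" and "\<forall>B\<in>E. AE k in m. translate_mass B k H = translate_mass B 0 H"
    then have H: "H \<in> closed_subgroups" and ae: "AE k in m. \<forall>B\<in>E. translate_mass B k H = translate_mass B 0 H"
      using space_\<mu> E(1) by (auto simp: AE_ball_countable)
    from ae have "AE k in m. distr (coset_measure H) (coset_measure H) (left_translate k) = coset_measure H"
    proof eventually_elim
      case (elim k)
      have "coset_measure H = distr (coset_measure H) (coset_measure H) (left_translate k)"
      proof (rule measure_eqI_generator_eq[OF E(2), where A = light_cosets])
        show "E \<subseteq> Pow closed_subgroup_cosets"
          using E(3) sets.sets_into_space[of _ "cos_borel :: 'a set measure"] by auto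
        show "emeasure (coset_measure H) B = emeasure (distr (coset_measure H) (coset_measure H) (left_translate k)) B"
          if "B \<in> E" for B
          using elim that E(3) emeasure_translate_coset_measure[OF H, of B k] emeasure_coset_measure[OF H, of B] by auto
        show "emeasure (coset_measure H) (light_cosets i) \<noteq> \<infinity>" for i
          using coset_measure_light_cosets[OF H, of i] by auto
      qed (use E(4,5) Union_light_cosets in auto)
      then show ?case by simp
    qed
    then show "distr (coset_measure H) (coset_measure H) (left_translate g) = coset_measure H"
      by (rule invariant_translations_all[OF H])
  qed
qed

end

section \<open>Conclusion\<close>

lemma coset_weights_exist:
  assumes lc: "locally_compact_space (euclidean :: 'a::{topological_group_add,t2_space,second_countable_topology} topology)"
  shows "\<exists>(f0 :: 'a \<Rightarrow> real) S p q. coset_weights f0 S p q"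
proof -
  obtain f0 :: "'a \<Rightarrow> real" and S where f0: "continuous_on UNIV f0" "\<And>x. 0 \<le> f0 x" "\<And>x. f0 x \<le> 1" "f0 0 = 1"
      "compact S" "\<And>x. x \<notin> S \<Longrightarrow> f0 x = 0"
    by (rule bump_function_exists[OF lc]) (rule that)
  have [measurable]: "f0 \<in> borel_measurable borel" using f0(1) by (rule borel_measurable_continuous_onI)
  have "\<exists>M. haar_measure_on H M \<and> (\<integral>\<^sup>+x. f0 x \<partial>M) = 1" if H: "H \<in> closed_subgroups" for H
  proof -
    obtain \<alpha> where a: "haar_measure_on H \<alpha>" using haar_measure_exists[OF lc H] by auto
    note [measurable_cong] = haar_measure_onD(1)[OF a]
    let ?I = "\<integral>\<^sup>+x. f0 x \<partial>\<alpha>"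
    have fin: "?I < \<infinity>" by (rule haar_integral_finite[OF a f0(1,5,6)])
    have op: "open {x. 0 < f0 x}" using f0(1) by (intro open_Collect_less continuous_intros)
    have pos: "0 < ?I"
      by (rule haar_integral_pos[OF a _ op]) (use f0(4) in auto)
    have "haar_measure_on H (scale_measure (1 / ?I) \<alpha>)"
    proof (rule haar_measure_scale[OF a])
      show "0 < 1 / ?I" using fin by (simp add: ennreal_zero_less_divide less_top[symmetric])
      show "1 / ?I < \<infinity>" using pos by (simp add: ennreal_divide_eq_top_iff less_top[symmetric])
    qed
    moreover have "(\<integral>\<^sup>+x. f0 x \<partial>scale_measure (1 / ?I) \<alpha>) = 1"
    proof -
      have "(\<integral>\<^sup>+x. f0 x \<partial>scale_measure (1 / ?I) \<alpha>) = 1 / ?I * ?I"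
        by (rule nn_integral_scale_measure) measurable
      then show ?thesis using pos fin by (simp add: ennreal_divide_times ennreal_divide_self less_top[symmetric])
    qed
    ultimately show ?thesis by blast
  qed
  then have "\<forall>H. \<exists>M. H \<in> closed_subgroups \<longrightarrow> haar_measure_on H M \<and> (\<integral>\<^sup>+x. f0 x \<partial>M) = 1" by blast
  then obtain p where p: "\<forall>H. H \<in> closed_subgroups \<longrightarrow> haar_measure_on H (p H) \<and> (\<integral>\<^sup>+x. f0 x \<partial>p H) = 1"
    by (rule choice[THEN exE])
  obtain \<B> :: "'a set set" where \<B>: "countable \<B>" "topological_basis \<B>" using ex_countable_basis by blast
  have ne: "\<exists>x. B \<noteq> {} \<longrightarrow> x \<in> B" for B :: "'a set" by auto
  then have "\<forall>B::'a set. \<exists>x. B \<noteq> {} \<longrightarrow> x \<in> B" by blast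
  then obtain e :: "'a set \<Rightarrow> 'a" where e: "\<forall>B. B \<noteq> {} \<longrightarrow> e B \<in> B" by (rule choice[THEN exE])
  have "\<B> \<noteq> {}" using topological_basisE[OF \<B>(2) open_UNIV UNIV_I] by blast
  then have q: "range (\<lambda>i. e (from_nat_into \<B> i)) = e ` \<B>"
    using \<B>(1) by (metis image_image range_from_nat_into)
  have "\<exists>i. e (from_nat_into \<B> i) \<in> U" if U: "open U" "U \<noteq> {}" for U
  proof -
    obtain x where x: "x \<in> U" using U(2) by auto
    obtain B where B: "B \<in> \<B>" "x \<in> B" "B \<subseteq> U" by (rule topological_basisE[OF \<B>(2) U(1) x]) (rule that)
    then have "e B \<in> U" using e by auto
    moreover have "e B \<in> range (\<lambda>i. e (from_nat_into \<B> i))" unfolding q using B(1) by auto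
    ultimately show ?thesis by auto
  qed
  then have "coset_weights f0 S p (\<lambda>i. e (from_nat_into \<B> i))"
    using lc f0 p by unfold_locales auto
  then show ?thesis by blast
qed

theorem theorem3p1:
  fixes \<mu> :: "'a::{topological_group_add, t2_space, second_countable_topology} set measure"
  assumes "locally_compact_space (euclidean :: 'a topology)"
    and "invariant_subgroup_measure \<mu>"
  shows "\<exists>\<nu> :: 'a set \<Rightarrow> 'a set measure.
    borel_measure_map Sub_topology Cos_topology \<nu> \<and>
    (AE H in \<mu>.
      emeasure (\<nu> H) (space (\<nu> H)) \<noteq> 0 \<and>
      invariant_measure left_translate (\<nu> H) \<and>
      (AE C in \<nu> H. C \<in> left_cosets H))"
proof -
  obtain f0 :: "'a \<Rightarrow> real" and S p q where "coset_weights f0 S p q"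
    using coset_weights_exist[OF assms(1)] by (elim exE)
  then interpret coset_weights f0 S p q .
  have sets_\<mu>: "sets \<mu> = sets sub_borel" and sf: "sigma_finite_measure \<mu>"
    and inv: "\<And>g. distr \<mu> \<mu> (conjugate g) = \<mu>"
    using assms(2) by (auto simp: invariant_subgroup_measure_def sigma_finite_borel_measures_def invariant_measure_def)
  have space_\<mu>: "space \<mu> = closed_subgroups" using sets_eq_imp_space_eq[OF sets_\<mu>] by simp
  have "topspace Sub_topology = (closed_subgroups :: 'a set set)"
    using closed_subgroups_closed unfolding Sub_topology_def by (auto simp: topspace_fell)
  then have "coset_measure \<in> topspace Sub_topology \<rightarrow> sigma_finite_borel_measures Cos_topology"
    by (auto simp: sigma_finite_borel_measures_def sigma_finite_coset_measure)
  moreover have "(\<lambda>H. emeasure (coset_measure H) B) \<in> borel_measurable sub_borel" if B: "B \<in> sets cos_borel" for B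
  proof -
    have "translate_mass B 0 \<in> borel_measurable sub_borel"
      using measurable_compose[OF measurable_Pair1'[of "0::'a" borel sub_borel] measurable_translate_mass[OF B]] by simp
    then show ?thesis using emeasure_coset_measure[OF _ B] by (subst measurable_cong[where g = "translate_mass B 0"]) auto
  qed
  ultimately have "borel_measure_map Sub_topology Cos_topology coset_measure"
    unfolding borel_measure_map_def by blast
  moreover have "AE H in \<mu>. emeasure (coset_measure H) (space (coset_measure H)) \<noteq> 0 \<and>
      invariant_measure left_translate (coset_measure H) \<and> (AE C in coset_measure H. C \<in> left_cosets H)"
    using coset_measure_AE_invariant[OF sets_\<mu> sf inv] AE_space[of \<mu>]
  proof eventually_elim
    case (elim H)
    then show ?case
      using coset_measure_nonzero[of H] coset_measure_supported[of H] space_\<mu> by (auto simp: invariant_measure_def)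
  qed
  ultimately show ?thesis by blast
qed

end
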